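(* Let $\Gamma\subset\mathbb R^N$ be a network with Hamiltonians $H_\gamma$ and a flux limiter $(c_x)_{x\in\mathbf V}$ as in the context, let $L$ be the associated overall Lagrangian, and let $u_0:\Gamma\to\mathbb R$ be continuous. The function $$u(x,t)=\inf_\xi\left\{\int_0^tL(\xi,\dot\xi)\,d\tau+u_0(\xi(0))\right\},$$ where the infimum is over all absolutely continuous curves $\xi:[0,t]\to\Gamma$ with $\xi(t)=x$, is continuous in $\Gamma\times[0,+\infty)$.
   Context: Network. $\mathcal E$ is a finite collection of simple curves $\gamma:[0,1]\to\mathbb R^N$, called arcs, each $C^1$ up to the endpoints with nowhere vanishing derivative, and $\Gamma=\bigcup_{\gamma\in\mathcal E}\gamma([0,1])$. For each arc $\gamma$ the inverse arc $\widetilde\gamma(s)=\gamma(1-s)$ is also regarded as an arc. It is assumed that $\gamma((0,1))\cap\gamma'([0,1])=\emptyset$ whenever $\gamma\ne\gamma'$ and $\gamma\neq\widetilde{\gamma'}$. The set $\mathbf V$ of vertices is the set of initial and terminal points of arcs. $\Gamma$ is connected (any two vertices are linked by a finite concatenation of arcs) and there are no loops ($\gamma(0)\ne\gamma(1)$ for every arc). For $x\in\mathbf V$, $\Gamma_x=\{\gamma \text{ arc}: \gamma(1)=x\}$. The tangent bundle $T\Gamma$ is the set of $(x,q)\in\Gamma\times\mathbb R^N$ such that $q=\lambda\dot\gamma(s)$ for some arc $\gamma$, $s\in[0,1]$ with $x=\gamma(s)$, and $\lambda\in\mathbb R$. Hamiltonians and Lagrangians. For each arc $\gamma$, $H_\gamma:[0,1]\times\mathbb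 R\to\mathbb R$ is continuous, convex in the second variable $\mu$, satisfies $\lim_{|\mu|\to\infty}\inf_{s\in[0,1]}H_\gamma(s,\mu)/|\mu|=+\infty$, and $H_{\widetilde\gamma}(s,\mu)=H_\gamma(1-s,-\mu)$. Set $L_\gamma(s,\lambda)=\max_{\mu\in\mathbb R}(\lambda\mu-H_\gamma(s,\mu))$ and $c_\gamma=-\max_{s\in[0,1]}\min_{\mu\in\mathbb R}H_\gamma(s,\mu)=\min_{s\in[0,1]}L_\gamma(s,0)$. A flux limiter is a function $x\mapsto c_x$ from $\mathbf V$ to $\mathbb R$ with $c_x\le\min_{\gamma\in\Gamma_x}c_\gamma$ for every $x\in\mathbf V$. Overall Lagrangian. $L:T\Gamma\to\mathbb R$ is defined by: if $x\in\gamma((0,1))$, $L(x,q)=L_\gamma\big(\gamma^{-1}(x),\tfrac{q\cdot\dot\gamma(\gamma^{-1}(x))}{|\dot\gamma(\gamma^{-1}(x))|^2}\big)$; if $x\in\mathbf V$, $q\ne0$, $L(x,q)=\min L_\gamma\big(1,\tfrac{q\cdot\dot\gamma(1)}{|\dot\gamma(1)|^2}\big)$, the minimum being over those $\gamma\in\Gamma_x$ with $\dot\gamma(1)$ parallel to $q$; if $x\in\mathbf V$, $L(x,0)=c_x$. It is extended by $L=+\infty$ to $(\mathbb R^N\times\mathbb R^N)\setminus T\Gamma$. *)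

theory Defs
  imports "HOL-Analysis.Analysis"
begin

section \<open>Networks\<close>

text \<open>A curve on \<open>[0,1]\<close> is a total function of which only the values on \<open>{0..1}\<close> matter; hence all
  derivatives are taken within \<open>{0..1}\<close> and are one-sided at the end points.\<close>

definition velocity :: "(real \<Rightarrow> 'a::euclidean_space) \<Rightarrow> real \<Rightarrow> 'a" where
  "velocity \<gamma> s = vector_derivative \<gamma> (at s within {0..1})"

definition regular_C1 :: "(real \<Rightarrow> 'a::euclidean_space) \<Rightarrow> bool" where
  "regular_C1 \<gamma> \<longleftrightarrow>
     (\<forall>s\<in>{0..1}. (\<gamma> has_vector_derivative velocity \<gamma> s) (at s within {0..1}) \<and> velocity \<gamma> s \<noteq> 0) \<and>
     continuous_on {0..1} (velocity \<gamma>)"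

definition arcs :: "(real \<Rightarrow> 'a::euclidean_space) set \<Rightarrow> (real \<Rightarrow> 'a) set" where
  "arcs E = E \<union> reversepath ` E"

definition carrier :: "(real \<Rightarrow> 'a::euclidean_space) set \<Rightarrow> 'a set" where
  "carrier E = (\<Union>\<gamma>\<in>E. \<gamma> ` {0..1})"

definition vertices :: "(real \<Rightarrow> 'a::euclidean_space) set \<Rightarrow> 'a set" where
  "vertices E = pathstart ` arcs E \<union> pathfinish ` arcs E"

definition arcs_into :: "(real \<Rightarrow> 'a::euclidean_space) set \<Rightarrow> 'a \<Rightarrow> (real \<Rightarrow> 'a) set" where
  "arcs_into E x = {\<gamma> \<in> arcs E. \<gamma> 1 = x}"

definition network :: "(real \<Rightarrow> 'a::euclidean_space) set \<Rightarrow> bool" where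
  "network E \<longleftrightarrow>
     finite E \<and>
     (\<forall>\<gamma>\<in>arcs E. simple_path \<gamma> \<and> regular_C1 \<gamma> \<and> \<gamma> 0 \<noteq> \<gamma> 1) \<and>
     (\<forall>\<gamma>\<in>arcs E. \<forall>\<gamma>'\<in>arcs E.
        \<gamma> \<noteq> \<gamma>' \<and> \<gamma> \<noteq> reversepath \<gamma>' \<longrightarrow> \<gamma> ` {0<..<1} \<inter> \<gamma>' ` {0..1} = {}) \<and>
     (\<forall>x\<in>vertices E. \<forall>y\<in>vertices E. (x, y) \<in> {(\<gamma> 0, \<gamma> 1) |\<gamma>. \<gamma> \<in> arcs E}\<^sup>*)"

definition tangent_bundle :: "(real \<Rightarrow> 'a::euclidean_space) set \<Rightarrow> ('a \<times> 'a) set" where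
  "tangent_bundle E =
     {(x, q). x \<in> carrier E \<and> (\<exists>\<gamma>\<in>arcs E. \<exists>s\<in>{0..1}. \<exists>l. x = \<gamma> s \<and> q = l *\<^sub>R velocity \<gamma> s)}"


section \<open>Hamiltonians, Lagrangians, flux limiters\<close>

text \<open>A family of Hamiltonians \<open>H \<gamma> s \<mu>\<close> is relevant only for arcs \<open>\<gamma>\<close> and \<open>s\<close> in \<open>{0..1}\<close>.\<close>

definition hamiltonians ::
    "(real \<Rightarrow> 'a::euclidean_space) set \<Rightarrow> ((real \<Rightarrow> 'a) \<Rightarrow> real \<Rightarrow> real \<Rightarrow> real) \<Rightarrow> bool" where
  "hamiltonians E H \<longleftrightarrow>
     (\<forall>\<gamma>\<in>arcs E.
        continuous_on ({0..1} \<times> UNIV) (\<lambda>(s, \<mu>). H \<gamma> s \<mu>) \<and>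
        (\<forall>s\<in>{0..1}. convex_on UNIV (H \<gamma> s)) \<and>
        filterlim (\<lambda>\<mu>. INF s\<in>{0..1}. H \<gamma> s \<mu> / \<bar>\<mu>\<bar>) at_top at_infinity \<and>
        (\<forall>s\<in>{0..1}. \<forall>\<mu>. H (reversepath \<gamma>) s \<mu> = H \<gamma> (1 - s) (- \<mu>)))"

text \<open>In the next two definitions the suprema and the infimum are attained for Hamiltonians as above,
  by continuity and superlinear growth.\<close>

definition arc_lagrangian ::
    "((real \<Rightarrow> 'a::euclidean_space) \<Rightarrow> real \<Rightarrow> real \<Rightarrow> real) \<Rightarrow> (real \<Rightarrow> 'a) \<Rightarrow> real \<Rightarrow> real \<Rightarrow> real" where
  "arc_lagrangian H \<gamma> s l = (SUP \<mu>. l * \<mu> - H \<gamma> s \<mu>)"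

definition arc_const ::
    "((real \<Rightarrow> 'a::euclidean_space) \<Rightarrow> real \<Rightarrow> real \<Rightarrow> real) \<Rightarrow> (real \<Rightarrow> 'a) \<Rightarrow> real" where
  "arc_const H \<gamma> = - (SUP s\<in>{0..1}. INF \<mu>. H \<gamma> s \<mu>)"

definition flux_limiter ::
    "(real \<Rightarrow> 'a::euclidean_space) set \<Rightarrow> ((real \<Rightarrow> 'a) \<Rightarrow> real \<Rightarrow> real \<Rightarrow> real) \<Rightarrow> ('a \<Rightarrow> real) \<Rightarrow> bool" where
  "flux_limiter E H c \<longleftrightarrow> (\<forall>x\<in>vertices E. c x \<le> (MIN \<gamma>\<in>arcs_into E x. arc_const H \<gamma>))"

text \<open>A point in the interior of an arc lies on exactly that arc and its inverse, which give the same
  value by the symmetry of \<open>H\<close> under inversion, so the choice made by \<open>SOME\<close> is immaterial. The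
  minimum at a vertex is over a finite set, nonempty for \<open>(x, q)\<close> in the tangent bundle.\<close>

definition lagrangian ::
    "(real \<Rightarrow> 'a::euclidean_space) set \<Rightarrow> ((real \<Rightarrow> 'a) \<Rightarrow> real \<Rightarrow> real \<Rightarrow> real) \<Rightarrow> ('a \<Rightarrow> real)
      \<Rightarrow> 'a \<Rightarrow> 'a \<Rightarrow> ereal" where
  "lagrangian E H c x q =
     (if (x, q) \<notin> tangent_bundle E then \<infinity>
      else if \<exists>\<gamma>\<in>arcs E. x \<in> \<gamma> ` {0<..<1} then
        (let \<gamma> = (SOME \<gamma>. \<gamma> \<in> arcs E \<and> x \<in> \<gamma> ` {0<..<1});
             s = the_inv_into {0..1} \<gamma> x
         in ereal (arc_lagrangian H \<gamma> s ((q \<bullet> velocity \<gamma> s) / (norm (velocity \<gamma> s))\<^sup>2)))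
      else if q \<noteq> 0 then
        ereal (MIN \<gamma>\<in>{\<gamma> \<in> arcs_into E x. \<exists>l. q = l *\<^sub>R velocity \<gamma> 1}.
          arc_lagrangian H \<gamma> 1 ((q \<bullet> velocity \<gamma> 1) / (norm (velocity \<gamma> 1))\<^sup>2))
      else ereal (c x))"


section \<open>The value function\<close>

definition absolutely_continuous_curve :: "real \<Rightarrow> real \<Rightarrow> (real \<Rightarrow> 'a::metric_space) \<Rightarrow> bool" where
  "absolutely_continuous_curve a b \<xi> \<longleftrightarrow>
     (\<forall>\<epsilon>>0. \<exists>\<delta>>0. \<forall>I :: (real \<times> real) set.
        finite I \<and> (\<forall>(r, s)\<in>I. a \<le> r \<and> r \<le> s \<and> s \<le> b) \<and>
        disjoint_family_on (\<lambda>(r, s). {r<..<s}) I \<and> (\<Sum>(r, s)\<in>I. s - r) < \<delta>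
        \<longrightarrow> (\<Sum>(r, s)\<in>I. dist (\<xi> r) (\<xi> s)) < \<epsilon>)"

text \<open>Lebesgue integral of an extended real valued function, as the integral of the positive part minus
  that of the negative part: \<open>e2ennreal\<close> truncates negative values to \<open>0\<close>. The Lagrangian is bounded
  below, so the action of a curve on a bounded interval never has the form \<open>\<infinity> - \<infinity>\<close>.\<close>

definition ereal_integral :: "'b measure \<Rightarrow> ('b \<Rightarrow> ereal) \<Rightarrow> ereal" where
  "ereal_integral M f =
     enn2ereal (\<integral>\<^sup>+ \<tau>. e2ennreal (f \<tau>) \<partial>M) - enn2ereal (\<integral>\<^sup>+ \<tau>. e2ennreal (- f \<tau>) \<partial>M)"

text \<open>An absolutely continuous curve is differentiable almost everywhere; the arbitrary value of
  \<open>vector_derivative\<close> on the remaining null set does not affect the integral.\<close>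

definition action ::
    "(real \<Rightarrow> 'a::euclidean_space) set \<Rightarrow> ((real \<Rightarrow> 'a) \<Rightarrow> real \<Rightarrow> real \<Rightarrow> real) \<Rightarrow> ('a \<Rightarrow> real)
      \<Rightarrow> real \<Rightarrow> (real \<Rightarrow> 'a) \<Rightarrow> ereal" where
  "action E H c t \<xi> =
     ereal_integral (lebesgue_on {0..t})
       (\<lambda>\<tau>. lagrangian E H c (\<xi> \<tau>) (vector_derivative \<xi> (at \<tau> within {0..t})))"

definition value_function ::
    "(real \<Rightarrow> 'a::euclidean_space) set \<Rightarrow> ((real \<Rightarrow> 'a) \<Rightarrow> real \<Rightarrow> real \<Rightarrow> real) \<Rightarrow> ('a \<Rightarrow> real)
      \<Rightarrow> ('a \<Rightarrow> real) \<Rightarrow> 'a \<Rightarrow> real \<Rightarrow> ereal" where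
  "value_function E H c u0 x t =
     (INF \<xi>\<in>{\<xi>. absolutely_continuous_curve 0 t \<xi> \<and> \<xi> ` {0..t} \<subseteq> carrier E \<and> \<xi> t = x}.
        action E H c t \<xi> + ereal (u0 (\<xi> 0)))"

end

theory Submission
  imports Defs
begin

text \<open>
  The Lagrangian is superlinear in the velocity, uniformly on the network, and bounded on bounded sets
  of the tangent bundle. Two comparisons follow. Moving along an arc from \<open>x\<close> to a nearby \<open>y\<close> with
  parameter speed at most \<open>1\<close> during a time \<open>h\<close> costs at most \<open>M h\<close>, so \<open>u(y, t + h) \<le> u(x, t) + M h\<close>.
  Conversely, cutting the initial piece on \<open>[0, h]\<close> off an almost optimal curve \<open>\<xi>\<close> for \<open>(x, t)\<close> gives
  \<open>u(x, t - h) \<le> u(x, t) + \<epsilon>\<close> for small \<open>h\<close>, since superlinearity makes \<open>\<xi>(h)\<close> close to \<open>\<xi>(0)\<close>; no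
  regularity of minimizers is needed. To compare \<open>(x, t)\<close> with a nearby \<open>(y, t')\<close>, go back in time from
  \<open>(x, t)\<close> to \<open>(x, t' - h)\<close> and then move from \<open>x\<close> to \<open>y\<close> during the time \<open>h\<close>.

  Bounding \<open>|\<xi>(h) - \<xi>(0)|\<close> by the action requires that an absolutely continuous curve is differentiable
  almost everywhere and that its speed controls its displacement. Both are obtained from the Vitali
  covering theorem and the Henstock--Kurzweil integral, without functions of bounded variation.
\<close>

section \<open>Differentiability of absolutely continuous curves\<close>

text \<open>L may jump at the vertices, so it is only ever compared with constants and with linear
  lower bounds in the speed. Curves are cut, translated in time and prolonged by arc segments, but
  never perturbed in space.

  At a point without derivative \<open>vector_derivative\<close> is an arbitrary vector. The action
  therefore says nothing about displacement until such points are known to form a null set.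

  The cut needs a bound on the action of the removed piece. It comes from boundedness of the value
  function on bounded time intervals: the whole curve is almost optimal, and the remaining piece
  cannot be arbitrarily cheap.

  Going back to time t' - h presupposes h <= t'. For t' < h both values are compared with the
  initial datum instead, which is possible because both times are then below 2 h.\<close>

lemma sum_increments_division:
  fixes f :: "real \<Rightarrow> 'b::real_normed_vector"
  assumes "a \<le> b" "p division_of {a..b}"
  shows "(\<Sum>K\<in>p. f (Sup K) - f (Inf K)) = f b - f a"
proof -
  have *: "K \<noteq> {} \<and> (\<exists>u v. K = cbox u v)" if "K \<in> p" for K
    using assms(2) that by (meson division_ofD(3,4))
  \<comment> \<open>The telescoping rule is used in its tagged form; the left end point is a tag
    that certainly lies in its interval.\<close>
  define q where "q = (\<lambda>K::real set. (Inf K, K)) ` p"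
  have inK: "Inf K \<in> K" if "K \<in> p" for K
    using *[OF that] by (auto simp: cbox_interval)
  have "q tagged_division_of {a..b}"
    unfolding q_def
  proof (rule tagged_division_ofI)
    show "finite ((\<lambda>K::real set. (Inf K, K)) ` p)" using assms(2) by blast
    show "\<And>x K. (x, K) \<in> (\<lambda>K. (Inf K, K)) ` p \<Longrightarrow> x \<in> K" using inK by blast
    show "\<And>x K. (x, K) \<in> (\<lambda>K. (Inf K, K)) ` p \<Longrightarrow> K \<subseteq> {a..b}"
      using assms(2) by blast
    show "\<And>x K. (x, K) \<in> (\<lambda>K. (Inf K, K)) ` p \<Longrightarrow> \<exists>a b. K = cbox a b"
      using * by blast
    show "interior K1 \<inter> interior K2 = {}"
      if "(x1, K1) \<in> (\<lambda>K. (Inf K, K)) ` p" "(x2, K2) \<in> (\<lambda>K. (Inf K, K)) ` p"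
         "(x1, K1) \<noteq> (x2, K2)" for x1 K1 x2 K2
      using that assms(2) division_ofD(5) by auto
    show "\<Union> {K. \<exists>x. (x, K) \<in> (\<lambda>K. (Inf K, K)) ` p} = {a..b}"
    proof -
      have "{K. \<exists>x. (x, K) \<in> (\<lambda>K. (Inf K, K)) ` p} = p" by auto
      then show ?thesis using assms(2) by auto
    qed
  qed
  from additive_tagged_division_1[OF assms(1) this, of f]
  show ?thesis unfolding q_def
    by (subst (asm) sum.reindex) (auto simp: inj_on_def)
qed

lemma division_interval_cases:
  fixes p :: "real set set"
  assumes "p division_of S" "K \<in> p"
  obtains u v where "u \<le> v" "K = {u..v}" "Inf K = u" "Sup K = v"
proof -
  obtain u v where "K = cbox u v" "K \<noteq> {}"
    using division_ofD(3,4)[OF assms(1)] assms(2) by blast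
  then show ?thesis using that by (auto simp: cbox_interval)
qed

text \<open>Members of a division overlap at most at end points, so their pairs of end points form
  an admissible family in the definition of absolute continuity. Vitali coverings and gauge fine
  divisions both deliver divisions.\<close>

lemma AC_division:
  assumes "absolutely_continuous_curve a b f" "\<epsilon> > 0"
  obtains \<delta> where "\<delta> > 0"
    "\<And>p. \<lbrakk>p division_of \<Union>p; \<Union>p \<subseteq> {a..b}; (\<Sum>K\<in>p. Sup K - Inf K) < \<delta>\<rbrakk>
        \<Longrightarrow> (\<Sum>K\<in>p. dist (f (Inf K)) (f (Sup K))) < \<epsilon>"
proof -
  obtain \<delta> where "\<delta> > 0" and \<delta>: "\<And>I :: (real \<times> real) set.
        finite I \<and> (\<forall>(r, s)\<in>I. a \<le> r \<and> r \<le> s \<and> s \<le> b) \<and>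
        disjoint_family_on (\<lambda>(r, s). {r<..<s}) I \<and> (\<Sum>(r, s)\<in>I. s - r) < \<delta>
        \<longrightarrow> (\<Sum>(r, s)\<in>I. dist (f r) (f s)) < \<epsilon>"
    using assms unfolding absolutely_continuous_curve_def by meson
  show ?thesis
  proof (rule that[OF \<open>\<delta> > 0\<close>])
    fix p :: "real set set"
    assume p: "p division_of \<Union>p" "\<Union>p \<subseteq> {a..b}" "(\<Sum>K\<in>p. Sup K - Inf K) < \<delta>"
    define I where "I = (\<lambda>K::real set. (Inf K, Sup K)) ` p"
    \<comment> \<open>The definition sums over a set of pairs, so distinct intervals must not be
      identified.\<close>
    have inj: "inj_on (\<lambda>K::real set. (Inf K, Sup K)) p"
    proof (rule inj_onI)
      fix K L assume "K \<in> p" "L \<in> p" "(Inf K, Sup K) = (Inf L, Sup L)"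
      then show "K = L"
        using division_interval_cases[OF p(1), of K] division_interval_cases[OF p(1), of L] by (smt (verit) prod.inject)
    qed
    have "finite I" using p(1) unfolding I_def by blast
    moreover have "\<forall>(r, s)\<in>I. a \<le> r \<and> r \<le> s \<and> s \<le> b"
    proof -
      have "a \<le> Inf K \<and> Inf K \<le> Sup K \<and> Sup K \<le> b" if K: "K \<in> p" for K
      proof -
        obtain u v where uv: "u \<le> v" "K = {u..v}" "Inf K = u" "Sup K = v"
          using division_interval_cases[OF p(1) K] .
        have "K \<subseteq> {a..b}" using p(2) K by blast
        then show ?thesis using uv by auto
      qed
      then show ?thesis unfolding I_def by auto
    qed
    moreover have "disjoint_family_on (\<lambda>(r, s). {r<..<s}) I"
    proof -
      have "{Inf K<..<Sup K} \<inter> {Inf L<..<Sup L} = {}" if KL: "K \<in> p" "L \<in> p" "K \<noteq> L" for K L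
      proof -
        have "interior M = {Inf M<..<Sup M}" if "M \<in> p" for M
          by (rule division_interval_cases[OF p(1) that]) auto
        with KL show ?thesis using division_ofD(5)[OF p(1) KL] by simp
      qed
      then show ?thesis unfolding disjoint_family_on_def I_def by auto
    qed
    moreover have "(\<Sum>(r, s)\<in>I. s - r) < \<delta>"
      unfolding I_def using p(3) by (subst sum.reindex[OF inj]) auto
    ultimately have "(\<Sum>(r, s)\<in>I. dist (f r) (f s)) < \<epsilon>"
      using \<delta> by blast
    then show "(\<Sum>K\<in>p. dist (f (Inf K)) (f (Sup K))) < \<epsilon>"
      unfolding I_def by (subst (asm) sum.reindex[OF inj]) auto
  qed
qed

lemma measure_division:
  fixes p :: "real set set"
  assumes "p division_of \<Union>p"
  shows "measure lebesgue (\<Union>p) = (\<Sum>K\<in>p. Sup K - Inf K)"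
proof -
  have "(\<Sum>K\<in>p. measure lebesgue K) = measure lebesgue (\<Union>p)"
    using assms by (rule content_division)
  moreover have "measure lebesgue K = Sup K - Inf K" if "K \<in> p" for K
    by (rule division_interval_cases[OF assms that]) auto
  ultimately show ?thesis by simp
qed

section \<open>Vitali coverings and null sets of bad slopes\<close>

text \<open>The Vitali covering theorem gives countably many disjoint intervals inside U that miss
  only a null part of S. Their union has finite measure, so finitely many of them leave out less
  than e of it; \<open>T\<close> is the null part together with this tail. An interval only has to
  contain x, without being centred there, so slopes to the left and to the right of x both
  qualify.\<close>

lemma Vitali_intervals:
  fixes S U :: "real set"
  assumes U: "open U" "U \<in> lmeasurable" "S \<subseteq> U" and "e > 0"
    and cov: "\<And>x d. \<lbrakk>x \<in> S; d > 0\<rbrakk> \<Longrightarrow> \<exists>u v. u \<le> x \<and> x \<le> v \<and> u < v \<and> v - u < d \<and> P u v"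
  obtains p T where "p division_of \<Union>p" "\<Union>p \<subseteq> U"
    "\<And>K. K \<in> p \<Longrightarrow> Inf K < Sup K \<and> P (Inf K) (Sup K)"
    "S \<subseteq> \<Union>p \<union> T" "T \<in> lmeasurable" "measure lebesgue T < e"
proof -
  define J where "J = {(u, v). u < v \<and> {u..v} \<subseteq> U \<and> P u v}"
  define c where "c = (\<lambda>(u::real, v). (u + v) / 2)"
  define r where "r = (\<lambda>(u::real, v). (v - u) / 2)"
  have cb: "cball (c i) (r i) = {fst i..snd i}" for i
    by (auto simp: c_def r_def cball_eq_atLeastAtMost split: prod.splits) (auto simp: field_simps)
  have cover: "\<exists>i. i \<in> J \<and> x \<in> cball (c i) (r i) \<and> r i < d" if x: "x \<in> S" "0 < d" for x d
  proof -
    obtain e' where e': "e' > 0" "ball x e' \<subseteq> U" using U x by (meson openE subsetD)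
    obtain u v where uv: "u \<le> x" "x \<le> v" "u < v" "v - u < min d e'" "P u v"
      using cov[OF x(1), of "min d e'"] x e' by auto
    have "{u..v} \<subseteq> ball x e'" using uv by (auto simp: dist_real_def)
    then have "(u, v) \<in> J" using uv e' unfolding J_def by auto
    moreover have "x \<in> cball (c (u, v)) (r (u, v))" unfolding cb using uv by auto
    moreover have "r (u, v) < d" using uv unfolding r_def by auto
    ultimately show ?thesis by blast
  qed
  have rpos: "0 < r i" if "i \<in> J" for i using that unfolding J_def r_def by auto
  obtain C where C: "countable C" "C \<subseteq> J"
     "pairwise (\<lambda>i j. disjnt (cball (c i) (r i)) (cball (c j) (r j))) C"
     "negligible (S - (\<Union>i \<in> C. cball (c i) (r i)))"
    by (rule Vitali_covering_theorem_cballs[of J r S c, OF rpos cover]) auto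
  define D where "D = (\<lambda>i. {fst i..snd i}) ` C"
  have D: "K \<in> D \<Longrightarrow> \<exists>u v. u < v \<and> K = {u..v} \<and> K \<subseteq> U \<and> P u v" for K
    using C(2) unfolding D_def J_def by auto
  have Dm: "D \<subseteq> lmeasurable"
  proof
    fix K assume "K \<in> D"
    then obtain u v where "K = {u..v}" using D by blast
    then show "K \<in> lmeasurable" by simp
  qed
  have Dd: "K \<inter> L = {}" if KL: "K \<in> D" "L \<in> D" "K \<noteq> L" for K L
  proof -
    obtain i j where ij: "i \<in> C" "j \<in> C" "K = {fst i..snd i}" "L = {fst j..snd j}"
      using KL(1,2) unfolding D_def by blast
    then have "i \<noteq> j" using KL(3) by auto
    then show ?thesis using C(3) ij unfolding pairwise_def cb disjnt_def by simp
  qed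
  have "countable D" unfolding D_def using C(1) by auto
  moreover have "measure lebesgue (\<Union>D') \<le> measure lebesgue U" if "D' \<subseteq> D" "finite D'" for D'
  proof (rule measure_mono_fmeasurable)
    show "\<Union>D' \<subseteq> U" using that D by blast
    show "\<Union>D' \<in> sets lebesgue"
      by (rule sets.finite_Union) (use that Dm in \<open>auto simp: fmeasurableD\<close>)
  qed (rule U)
  ultimately obtain F where F: "F \<subseteq> D" "finite F" "measure lebesgue (\<Union>D) - e < measure lebesgue (\<Union>F)"
    using measure_countable_Union_approachable[of D e "measure lebesgue U"] Dm \<open>e > 0\<close> by blast
  have UDm: "\<Union>D \<in> lmeasurable"
  proof (rule fmeasurableI2[OF U(2)])
    show "\<Union>D \<subseteq> U" using D by blast
    show "\<Union>D \<in> sets lebesgue"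
      by (rule sets.countable_Union) (use \<open>countable D\<close> Dm in \<open>auto simp: fmeasurableD\<close>)
  qed
  have UFm: "\<Union>F \<in> lmeasurable"
    by (rule fmeasurable.finite_Union) (use F Dm in auto)
  define T where "T = (S - \<Union>D) \<union> (\<Union>D - \<Union>F)"
  have neg: "negligible (S - \<Union>D)" using C(4) unfolding cb D_def by simp
  have m: "measure lebesgue (\<Union>D - \<Union>F) < e"
    using F UDm UFm by (subst measurable_measure_Diff) (auto simp: fmeasurableD)
  have Dm2: "\<Union>D - \<Union>F \<in> lmeasurable" using UDm UFm by (rule fmeasurable.Diff)
  show ?thesis
  proof (rule that)
    show "F division_of \<Union>F"
    proof (rule division_ofI)
      show "\<And>K. K \<in> F \<Longrightarrow> K \<noteq> {}" using F(1) D by fastforce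
      show "\<And>K. K \<in> F \<Longrightarrow> \<exists>a b. K = cbox a b" using F(1) D by (metis cbox_interval subsetD)
      show "\<And>K1 K2. K1 \<in> F \<Longrightarrow> K2 \<in> F \<Longrightarrow> K1 \<noteq> K2 \<Longrightarrow> interior K1 \<inter> interior K2 = {}"
        using F(1) Dd interior_subset by blast
    qed (use F in auto)
    show "\<Union>F \<subseteq> U" using F(1) D by blast
    show "Inf K < Sup K \<and> P (Inf K) (Sup K)" if "K \<in> F" for K
      using that F(1) D by (metis cInf_atLeastAtMost cSup_atLeastAtMost less_imp_le subsetD)
    show "S \<subseteq> \<Union>F \<union> T" unfolding T_def by auto
    show "T \<in> lmeasurable" unfolding T_def
      using neg Dm2 by (simp add: fmeasurable.Un negligible_imp_measurable)
    show "measure lebesgue T < e" unfolding T_def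
      using m neg Dm2
      by (metis Un_commute fmeasurableD measure_Un_null_set negligible_iff_null_sets)
  qed
qed

text \<open>
  Cover \<open>E\<close>, up to measure \<open>\<delta>\<close>, by finitely many intervals \<open>F\<close> of slope above \<open>q\<close> inside an open set that
  is almost optimal for the outer measure \<open>m\<close> of \<open>E\<close>, and then by finitely many intervals \<open>G\<close> of slope
  below \<open>l\<close> inside \<open>F\<close>. Both have total length about \<open>m\<close>, so by absolute continuity the increments of \<open>f\<close>
  over \<open>F\<close> and over \<open>G\<close> almost agree, which forces \<open>(q - l) m\<close> to be small.
\<close>

lemma negligible_oscillating_slopes:
  fixes f :: "real \<Rightarrow> real"
  assumes AC: "absolutely_continuous_curve a b f" and "E \<subseteq> {a<..<b}" and "l < q"
    and low: "\<And>x d. \<lbrakk>x \<in> E; d > 0\<rbrakk> \<Longrightarrow> \<exists>u v. u \<le> x \<and> x \<le> v \<and> u < v \<and> v - u < d \<and> f v - f u < l * (v - u)"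
    and upp: "\<And>x d. \<lbrakk>x \<in> E; d > 0\<rbrakk> \<Longrightarrow> \<exists>u v. u \<le> x \<and> x \<le> v \<and> u < v \<and> v - u < d \<and> f v - f u > q * (v - u)"
  shows "negligible E"
proof -
  define M where "M = {measure lebesgue T |T. T \<in> lmeasurable \<and> E \<subseteq> T}"
  define m where "m = Inf M"
  have bddM: "bdd_below M" unfolding M_def by (intro bdd_belowI[of _ 0]) auto
  have ablm: "{a<..<b} \<in> lmeasurable" by simp
  have "M \<noteq> {}" unfolding M_def using \<open>E \<subseteq> {a<..<b}\<close> ablm by blast
  have m_le: "m \<le> measure lebesgue T" if "T \<in> lmeasurable" "E \<subseteq> T" for T
    unfolding m_def by (rule cInf_lower[OF _ bddM]) (use that M_def in auto)
  have "m \<le> 0"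
  proof (rule ccontr)
    assume "\<not> m \<le> 0"
    then have mpos: "m > 0" by simp
    define \<epsilon> where "\<epsilon> = (q - l) * m / 4"
    have "\<epsilon> > 0" using mpos \<open>l < q\<close> unfolding \<epsilon>_def by simp
    obtain \<delta>0 where \<delta>0: "\<delta>0 > 0"
      "\<And>p. \<lbrakk>p division_of \<Union>p; \<Union>p \<subseteq> {a..b}; (\<Sum>K\<in>p. Sup K - Inf K) < \<delta>0\<rbrakk>
        \<Longrightarrow> (\<Sum>K\<in>p. dist (f (Inf K)) (f (Sup K))) < \<epsilon>"
      by (rule AC_division[OF AC \<open>\<epsilon> > 0\<close>]) (rule that, assumption, blast)
    \<comment> \<open>The residual intervals R below have total length under 3 \<delta>, hence the
      requirement \<open>3 * \<delta> < \<delta>0\<close>. The bound m / 4 makes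
      \<open>\<sigma> F\<close> at least 3 m / 4, and the last term keeps l times the residual
      length above -3/16 of (q - l) m. As 3/4 - 3/16 exceeds 1/4, this contradicts the choice of
      \<open>\<epsilon>\<close>.\<close>
    define \<delta> where "\<delta> = min (\<delta>0 / 4) (min (m / 4) ((q - l) * m / (16 * (\<bar>l\<bar> + 1))))"
    have \<delta>: "\<delta> > 0" "3 * \<delta> < \<delta>0" "\<delta> \<le> m / 4" "\<delta> \<le> (q - l) * m / (16 * (\<bar>l\<bar> + 1))"
      using \<delta>0(1) mpos \<open>l < q\<close> unfolding \<delta>_def by (auto simp: min_def)
    have l\<delta>: "\<bar>l\<bar> * (3 * \<delta>) \<le> 3 * ((q - l) * m / 16)"
    proof -
      have "\<bar>l\<bar> * \<delta> \<le> (\<bar>l\<bar> + 1) * \<delta>" using \<delta>(1) by (simp add: algebra_simps)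
      also have "\<dots> \<le> (q - l) * m / 16"
        using \<delta>(4) by (simp add: pos_le_divide_eq field_simps)
      finally show ?thesis by linarith
    qed
    obtain T where T: "T \<in> lmeasurable" "E \<subseteq> T" "measure lebesgue T < m + \<delta> / 2"
    proof -
      have "Inf M < m + \<delta> / 2" using \<delta>(1) unfolding m_def by simp
      then show ?thesis using that cInf_lessD[OF \<open>M \<noteq> {}\<close>] unfolding M_def by blast
    qed
    have "T \<in> sets lebesgue" using T(1) by (rule fmeasurableD)
    moreover have "\<delta> / 2 > 0" using \<delta>(1) by simp
    ultimately obtain U0 where U0: "open U0" "T \<subseteq> U0" "U0 - T \<in> lmeasurable"
        "emeasure lebesgue (U0 - T) < ennreal (\<delta> / 2)"
      by (rule sets_lebesgue_outer_open) (rule that)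
    have U0m: "U0 \<in> lmeasurable"
      using fmeasurable.Un[OF T(1) U0(3)] U0(2) by (simp add: Un_absorb1)
    have "measure lebesgue (U0 - T) < \<delta> / 2"
      using U0(3,4) \<delta>(1) by (simp add: emeasure_eq_measure2 ennreal_less_iff)
    then have mU0: "measure lebesgue U0 < m + \<delta>"
      using T U0 U0m by (simp add: measurable_measure_Diff fmeasurableD)
    define U where "U = U0 \<inter> {a<..<b}"
    have U: "open U" "U \<in> lmeasurable" "E \<subseteq> U" "U \<subseteq> {a<..<b}"
      unfolding U_def using U0 U0m T ablm \<open>E \<subseteq> {a<..<b}\<close> by (auto intro: fmeasurable.Int)
    have mU: "measure lebesgue U < m + \<delta>"
      using measure_mono_fmeasurable[of U U0 lebesgue] U(2) U0m mU0 unfolding U_def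
      by (auto simp: fmeasurableD)
    obtain F T1 where F: "F division_of \<Union>F" "\<Union>F \<subseteq> U"
      "\<And>K. K \<in> F \<Longrightarrow> Inf K < Sup K \<and> f (Sup K) - f (Inf K) > q * (Sup K - Inf K)"
      and T1: "E \<subseteq> \<Union>F \<union> T1" "T1 \<in> lmeasurable" "measure lebesgue T1 < \<delta>"
      by (rule Vitali_intervals[OF U(1-3) \<delta>(1), of "\<lambda>u v. f v - f u > q * (v - u)"])
        (use upp in auto)
    \<comment> \<open>The second covering has to take place in an open set. Passing to the interior
      loses only end points of finitely many intervals, a null set by \<open>neg\<close>.\<close>
    define W where "W = interior (\<Union>F)"
    have Fm: "\<Union>F \<in> lmeasurable" using F(1) by (rule lmeasurable_division)
    have W: "open W" "W \<in> lmeasurable" "E \<inter> W \<subseteq> W"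
    proof -
      show "W \<in> lmeasurable" unfolding W_def
        by (rule fmeasurableI2[OF Fm interior_subset]) auto
    qed (auto simp: W_def)
    obtain G T2 where G: "G division_of \<Union>G" "\<Union>G \<subseteq> W"
      "\<And>K. K \<in> G \<Longrightarrow> Inf K < Sup K \<and> f (Sup K) - f (Inf K) < l * (Sup K - Inf K)"
      and T2: "E \<inter> W \<subseteq> \<Union>G \<union> T2" "T2 \<in> lmeasurable" "measure lebesgue T2 < \<delta>"
      by (rule Vitali_intervals[OF W \<delta>(1), of "\<lambda>u v. f v - f u < l * (v - u)"])
        (use low in auto)
    have Gm: "\<Union>G \<in> lmeasurable" using G(1) by (rule lmeasurable_division)
    have neg: "negligible (\<Union>F - W)"
    proof -
      have "\<Union>F - W \<subseteq> (\<Union>K\<in>F. K - interior K)"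
        unfolding W_def by (auto intro: interior_mono[THEN subsetD, rotated])
      moreover have "negligible (\<Union>K\<in>F. K - interior K)"
      proof (rule negligible_Union)
        show "finite ((\<lambda>K. K - interior K) ` F)" using F(1) by blast
        fix T assume "T \<in> (\<lambda>K. K - interior K) ` F"
        then obtain K where K: "K \<in> F" "T = K - interior K" by blast
        obtain u v where "K = cbox u v" using K(1) F(1) by blast
        then show "negligible T" using K(2) negligible_frontier_interval[of u v] by simp
      qed
      ultimately show ?thesis by (rule negligible_subset[rotated])
    qed
    define \<sigma> where "\<sigma> = (\<lambda>p::real set set. \<Sum>K\<in>p. Sup K - Inf K)"
    define \<Delta> where "\<Delta> = (\<lambda>p::real set set. \<Sum>K\<in>p. f (Sup K) - f (Inf K))"
    have \<sigma>F: "\<sigma> F = measure lebesgue (\<Union>F)" "\<sigma> G = measure lebesgue (\<Union>G)"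
      using measure_division F(1) G(1) unfolding \<sigma>_def by auto
    have "\<sigma> F < m + \<delta>"
      using measure_mono_fmeasurable[of "\<Union>F" U lebesgue] F(2) U(2) Fm mU \<sigma>F
      by (auto simp: fmeasurableD)
    have "m < \<sigma> F + \<delta>"
    proof -
      have "m \<le> measure lebesgue (\<Union>F \<union> T1)" using T1 Fm by (intro m_le) auto
      also have "\<dots> \<le> measure lebesgue (\<Union>F) + measure lebesgue T1"
        using T1 Fm by (intro measure_Un_le) (auto simp: fmeasurableD)
      finally show ?thesis using T1 \<sigma>F by simp
    qed
    have "m < \<sigma> G + 2 * \<delta>"
    proof -
      have Nm: "\<Union>F - W \<in> lmeasurable" "measure lebesgue (\<Union>F - W) = 0"
        using neg by (auto simp: negligible_imp_measurable negligible_imp_measure0)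
      have "m \<le> measure lebesgue (\<Union>G \<union> (T2 \<union> (T1 \<union> (\<Union>F - W))))"
        by (intro m_le fmeasurable.Un T1 T2 Gm Nm) (use T1(1) T2(1) in blast)
      also have "\<dots> \<le> measure lebesgue (\<Union>G) + (measure lebesgue T2 + (measure lebesgue T1 + measure lebesgue (\<Union>F - W)))"
        by (intro order_trans[OF measure_Un_le] add_mono order_refl)
           (auto intro!: sets.Un fmeasurableD T1 T2 Gm Nm)
      finally show ?thesis using T1 T2 \<sigma>F Nm by simp
    qed
    have "\<Union>F \<subseteq> cbox a b" "a \<le> b"
    proof -
      show "\<Union>F \<subseteq> cbox a b" using F(2) U(4) by fastforce
      show "a \<le> b"
      proof (rule ccontr)
        assume "\<not> a \<le> b"
        then have "E = {}" using \<open>E \<subseteq> {a<..<b}\<close> by auto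
        then show False using m_le[of "{}"] mpos by simp
      qed
    qed
    \<comment> \<open>F is completed to a division of the whole interval, then F is replaced by G
      and the result is completed again. Both divisions telescope to the same total, so the new
      intervals R account exactly for the difference of F and G, in length as well as in increments
      of f.\<close>
    then obtain D where D: "F \<subseteq> D" "D division_of {a..b}"
      using partial_division_extend_interval[OF F(1), of a b] unfolding cbox_interval by blast
    have finD: "finite D" using D(2) by blast
    have DFG: "interior K \<inter> interior J = {}" if KJ: "K \<in> D - F" "J \<in> G" for K J
    proof -
      have "interior K \<inter> interior (\<Union>F) = {}"
      proof (rule Int_interior_Union_intervals)
        show "finite F" using F(1) by blast
        show "\<And>T. T \<in> F \<Longrightarrow> \<exists>a b. T = cbox a b" using F(1) by blast
        show "interior K \<inter> interior T = {}" if "T \<in> F" for T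
          by (rule division_ofD(5)[OF D(2)]) (use KJ D(1) that in auto)
      qed auto
      moreover have "interior J \<subseteq> interior (\<Union>F)"
        using KJ(2) G(2) interior_subset[of J] unfolding W_def by blast
      ultimately show ?thesis by blast
    qed
    have GI: "interior J \<noteq> {}" if "J \<in> G" for J
      by (rule division_interval_cases[OF G(1) that]) (use G(3)[OF that] in auto)
    have disj: "(D - F) \<inter> G = {}" using DFG GI by blast
    define D1 where "D1 = (D - F) \<union> G"
    have "D1 division_of \<Union>D1"
    proof (rule division_ofI)
      show "finite D1" using finD G(1) unfolding D1_def by blast
      show "\<And>K. K \<in> D1 \<Longrightarrow> K \<noteq> {}"
        using division_ofD(3)[OF D(2)] division_ofD(3)[OF G(1)] unfolding D1_def by blast
      show "\<And>K. K \<in> D1 \<Longrightarrow> \<exists>a b. K = cbox a b"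
        using division_ofD(4)[OF D(2)] division_ofD(4)[OF G(1)] unfolding D1_def by blast
      show "interior K1 \<inter> interior K2 = {}" if "K1 \<in> D1" "K2 \<in> D1" "K1 \<noteq> K2" for K1 K2
        using that division_ofD(5)[OF D(2), of K1 K2] division_ofD(5)[OF G(1), of K1 K2]
          DFG[of K1 K2] DFG[of K2 K1] unfolding D1_def by blast
    qed auto
    moreover have "\<Union>D1 \<subseteq> cbox a b"
    proof -
      have "\<Union>D = {a..b}" using D(2) by blast
      moreover have "\<Union>G \<subseteq> \<Union>F" using G(2) interior_subset unfolding W_def by blast
      ultimately have "\<Union>D1 \<subseteq> {a..b}" using D(1) unfolding D1_def by blast
      then show ?thesis by (simp add: cbox_interval)
    qed
    ultimately obtain D2 where D2: "D1 \<subseteq> D2" "D2 division_of {a..b}"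
      using partial_division_extend_interval[of D1 a b] unfolding cbox_interval by blast
    define R where "R = D2 - D1"
    have finD2: "finite D2" using D2(2) by blast
    have split: "sum g F = sum g G + sum g R" if tot: "sum g D = sum g D2" for g :: "real set \<Rightarrow> real"
    proof -
      have fG: "finite G" using G(1) by blast
      have "sum g D = sum g F + sum g (D - F)"
        using sum.subset_diff[OF D(1) finD, of g] by simp
      moreover have "sum g D2 = sum g R + sum g D1"
        unfolding R_def using sum.subset_diff[OF D2(1) finD2, of g] by simp
      moreover have "sum g D1 = sum g (D - F) + sum g G"
        unfolding D1_def using disj finD fG by (intro sum.union_disjoint) auto
      ultimately show ?thesis using tot by simp
    qed
    have s\<sigma>: "\<sigma> F = \<sigma> G + \<sigma> R"
      unfolding \<sigma>_def by (rule split)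
        (use sum_increments_division[OF \<open>a \<le> b\<close> D(2), of "\<lambda>x. x"] sum_increments_division[OF \<open>a \<le> b\<close> D2(2), of "\<lambda>x. x"] in simp)
    have s\<Delta>: "\<Delta> F = \<Delta> G + \<Delta> R"
      unfolding \<Delta>_def by (rule split)
        (use sum_increments_division[OF \<open>a \<le> b\<close> D(2), of f] sum_increments_division[OF \<open>a \<le> b\<close> D2(2), of f] in simp)
    have Rdiv: "R division_of \<Union>R"
      by (rule division_of_subset[of D2]) (use D2(2) division_ofD(6)[OF D2(2)] R_def in auto)
    have "\<sigma> R < \<delta>0" using s\<sigma> \<open>m < \<sigma> G + 2 * \<delta>\<close> \<open>\<sigma> F < m + \<delta>\<close> \<delta>(2) by simp
    moreover have "\<Union>R \<subseteq> {a..b}" using division_ofD(6)[OF D2(2)] unfolding R_def by blast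
    ultimately have "(\<Sum>K\<in>R. dist (f (Inf K)) (f (Sup K))) < \<epsilon>"
      using \<delta>0(2)[OF Rdiv] unfolding \<sigma>_def by blast
    moreover have "\<Delta> R \<le> (\<Sum>K\<in>R. dist (f (Inf K)) (f (Sup K)))"
      unfolding \<Delta>_def by (rule sum_mono) (simp add: dist_real_def)
    ultimately have "\<Delta> R < \<epsilon>" by simp
    moreover have "q * \<sigma> F \<le> \<Delta> F"
      unfolding \<sigma>_def \<Delta>_def sum_distrib_left by (rule sum_mono) (use F(3) in force)
    moreover have "\<Delta> G \<le> l * \<sigma> G"
      unfolding \<sigma>_def \<Delta>_def sum_distrib_left by (rule sum_mono) (use G(3) in force)
    ultimately have "q * \<sigma> F < l * \<sigma> G + \<epsilon>" using s\<Delta> by simp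
    then have 1: "(q - l) * \<sigma> F + l * \<sigma> R < \<epsilon>" using s\<sigma> by (simp add: algebra_simps)
    have "0 \<le> \<sigma> R" unfolding \<sigma>_def
      by (rule sum_nonneg) (metis division_interval_cases[OF Rdiv] diff_ge_0_iff_ge)
    have "\<bar>l * \<sigma> R\<bar> \<le> \<bar>l\<bar> * (3 * \<delta>)"
      unfolding abs_mult
      using \<open>0 \<le> \<sigma> R\<close> s\<sigma> \<open>m < \<sigma> G + 2 * \<delta>\<close> \<open>\<sigma> F < m + \<delta>\<close> by (intro mult_left_mono) auto
    moreover have "(q - l) * \<sigma> F \<ge> (q - l) * (3 * m / 4)"
      using \<open>l < q\<close> \<delta>(3) \<open>m < \<sigma> F + \<delta>\<close> by (intro mult_left_mono) auto
    moreover have "(q - l) * m > 0" using mpos \<open>l < q\<close> by simp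
    ultimately show False using 1 l\<delta> unfolding \<epsilon>_def by (simp add: field_simps)
  qed
  show ?thesis
    unfolding negligible_outer
  proof (intro allI impI)
    fix e :: real assume "e > 0"
    then have "Inf M < e" using \<open>m \<le> 0\<close> m_def by simp
    then show "\<exists>T. E \<subseteq> T \<and> T \<in> lmeasurable \<and> measure lebesgue T < e"
      using cInf_lessD[OF \<open>M \<noteq> {}\<close>] unfolding M_def by blast
  qed
qed

text \<open>Absolute continuity controls only families of total length below \<delta>, so the
  argument runs inside balls of radius \<delta> / 3. There, disjoint intervals of slope beyond 2 / e
  have increments of total size below 1, hence total length below e / 2. The part of E outside them
  lies in a set of measure below e / 2.\<close>

lemma negligible_infinite_slopes:
  fixes f :: "real \<Rightarrow> real"
  assumes AC: "absolutely_continuous_curve a b f" and "E \<subseteq> {a<..<b}"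
    and steep: "\<And>x d N. \<lbrakk>x \<in> E; d > 0\<rbrakk> \<Longrightarrow> \<exists>u v. u \<le> x \<and> x \<le> v \<and> u < v \<and> v - u < d \<and> \<bar>f v - f u\<bar> > N * (v - u)"
  shows "negligible E"
proof -
  obtain \<delta> where \<delta>: "\<delta> > 0"
    "\<And>p. \<lbrakk>p division_of \<Union>p; \<Union>p \<subseteq> {a..b}; (\<Sum>K\<in>p. Sup K - Inf K) < \<delta>\<rbrakk>
        \<Longrightarrow> (\<Sum>K\<in>p. dist (f (Inf K)) (f (Sup K))) < 1"
    by (rule AC_division[OF AC zero_less_one]) (rule that, assumption, blast)
  have "negligible (E \<inter> ball x (\<delta> / 3))" for x
    unfolding negligible_outer_le
  proof (intro allI impI)
    fix e :: real assume "e > 0"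
    define W where "W = ball x (\<delta> / 3) \<inter> {a<..<b}"
    have W: "open W" "W \<in> lmeasurable" "E \<inter> W \<subseteq> W"
      unfolding W_def by (auto intro: fmeasurable.Int)
    have mW: "measure lebesgue W < \<delta>"
    proof -
      have "measure lebesgue W \<le> measure lebesgue {x - \<delta>/3<..<x + \<delta>/3}"
        unfolding W_def ball_eq_greaterThanLessThan
        by (rule measure_mono_fmeasurable) auto
      also have "\<dots> < \<delta>" using \<delta>(1) by simp
      finally show ?thesis .
    qed
    have cov: "\<exists>u v. u \<le> x \<and> x \<le> v \<and> u < v \<and> v - u < d \<and> \<bar>f v - f u\<bar> > (2 / e) * (v - u)"
      if "x \<in> E \<inter> W" "d > 0" for x d
      using steep[of x d "2 / e"] that by blast
    obtain p T where p: "p division_of \<Union>p" "\<Union>p \<subseteq> W"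
      "\<And>K. K \<in> p \<Longrightarrow> Inf K < Sup K \<and> \<bar>f (Sup K) - f (Inf K)\<bar> > (2 / e) * (Sup K - Inf K)"
      and T: "E \<inter> W \<subseteq> \<Union>p \<union> T" "T \<in> lmeasurable" "measure lebesgue T < e / 2"
      by (rule Vitali_intervals[where P = "\<lambda>u v. \<bar>f v - f u\<bar> > (2 / e) * (v - u)",
            OF W half_gt_zero[OF \<open>e > 0\<close>] cov]) (assumption, assumption, rule that)
    have pm: "\<Union>p \<in> lmeasurable" using p(1) by (rule lmeasurable_division)
    have \<sigma>: "measure lebesgue (\<Union>p) = (\<Sum>K\<in>p. Sup K - Inf K)"
      using p(1) by (rule measure_division)
    have "measure lebesgue (\<Union>p) \<le> measure lebesgue W"
      using p(2) W(2) pm by (intro measure_mono_fmeasurable) (auto simp: fmeasurableD)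
    then have "(\<Sum>K\<in>p. dist (f (Inf K)) (f (Sup K))) < 1"
      using \<sigma> mW p(2) by (intro \<delta>(2)[OF p(1)]) (auto simp: W_def)
    moreover have "(2 / e) * (\<Sum>K\<in>p. Sup K - Inf K) \<le> (\<Sum>K\<in>p. dist (f (Inf K)) (f (Sup K)))"
      unfolding sum_distrib_left
      by (rule sum_mono) (use p(3) in \<open>force simp: dist_real_def abs_minus_commute\<close>)
    ultimately have "(2 / e) * measure lebesgue (\<Union>p) < 1" using \<sigma> by simp
    then have "measure lebesgue (\<Union>p) < e / 2" using \<open>e > 0\<close> by (simp add: field_simps)
    moreover have "measure lebesgue (\<Union>p \<union> T) \<le> measure lebesgue (\<Union>p) + measure lebesgue T"
      using T pm by (intro measure_Un_le) (auto simp: fmeasurableD)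
    ultimately have "measure lebesgue (\<Union>p \<union> T) \<le> e" using T(3) by simp
    moreover have "E \<inter> ball x (\<delta> / 3) \<subseteq> \<Union>p \<union> T"
      using T(1) \<open>E \<subseteq> {a<..<b}\<close> unfolding W_def by blast
    ultimately show "\<exists>T. E \<inter> ball x (\<delta> / 3) \<subseteq> T \<and> T \<in> lmeasurable \<and> measure lebesgue T \<le> e"
      using T(2) pm by (intro exI[of _ "\<Union>p \<union> T"]) (auto intro: fmeasurable.Un)
  qed
  then show ?thesis
    unfolding locally_negligible_alt[of E]
    using \<delta>(1) by (metis Int_iff centre_in_ball divide_pos_pos open_ball openin_open_Int zero_less_numeral)
qed

section \<open>Differentiability almost everywhere of real functions\<close>

text \<open>A difference quotient does not change when its two points are exchanged, so a point to
  the left of x yields an interval that ends at x. This turns the behaviour of quotients near x into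
  the fine covers that Vitali's theorem requires.\<close>

lemma frequently_slope_interval:
  fixes f :: "real \<Rightarrow> real"
  assumes "\<exists>\<^sub>F y in at x. R ((f y - f x) / (y - x))" "d > 0"
  shows "\<exists>u v. u \<le> x \<and> x \<le> v \<and> u < v \<and> v - u < d \<and> R ((f v - f u) / (v - u))"
proof -
  obtain y where y: "y \<noteq> x" "dist y x < d" "R ((f y - f x) / (y - x))"
    using assms unfolding frequently_at by blast
  show ?thesis
  proof (cases "y > x")
    case True
    then show ?thesis using y by (intro exI[of _ x] exI[of _ y]) (auto simp: dist_real_def)
  next
    case False
    have "(f y - f x) / (y - x) = (f x - f y) / (x - y)"
      using y(1) by (simp add: divide_simps) (simp add: algebra_simps)
    then show ?thesis using y False
      by (intro exI[of _ y] exI[of _ x]) (auto simp: dist_real_def)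
  qed
qed

text \<open>If the difference quotients at x have no real limit, then either they are unbounded near
  x, or their finite lower and upper limits are separated by two rationals. This leaves countably
  many exceptional sets, each null by one of the two slope lemmas.\<close>

lemma AC_negligible_nondifferentiable_real:
  fixes f :: "real \<Rightarrow> real"
  assumes AC: "absolutely_continuous_curve a b f"
  shows "negligible {x \<in> {a<..<b}. \<not> f differentiable (at x)}"
proof -
  define Q where "Q = (\<lambda>x y. (f y - f x) / (y - x))"
  define Einf where "Einf = {x \<in> {a<..<b}. \<forall>N. \<exists>\<^sub>F y in at x. \<bar>Q x y\<bar> > N}"
  define Eo where "Eo = (\<lambda>(l, q). {x \<in> {a<..<b}. l < q \<and> (\<exists>\<^sub>F y in at x. Q x y < l) \<and> (\<exists>\<^sub>F y in at x. Q x y > q)})"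
  have "negligible Einf"
  proof (rule negligible_infinite_slopes[OF AC])
    fix x d N :: real assume "x \<in> Einf" "d > 0"
    then have "\<exists>\<^sub>F y in at x. \<bar>(f y - f x) / (y - x)\<bar> > N" unfolding Einf_def Q_def by auto
    from frequently_slope_interval[where R = "\<lambda>r. \<bar>r\<bar> > N", OF this \<open>d > 0\<close>] 
    show "\<exists>u v. u \<le> x \<and> x \<le> v \<and> u < v \<and> v - u < d \<and> \<bar>f v - f u\<bar> > N * (v - u)"
      by (elim ex_forward) (auto simp: field_simps)
  qed (auto simp: Einf_def)
  moreover have "negligible (Eo (l, q))" for l q
  proof (cases "l < q")
    case True
    show ?thesis
    proof (rule negligible_oscillating_slopes[OF AC _ True])
      show "Eo (l, q) \<subseteq> {a<..<b}" by (auto simp: Eo_def)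
      fix x d :: real assume x: "x \<in> Eo (l, q)" "d > 0"
      then have "\<exists>\<^sub>F y in at x. (f y - f x) / (y - x) < l" unfolding Eo_def Q_def by auto
      from frequently_slope_interval[where R = "\<lambda>r. r < l", OF this \<open>d > 0\<close>]
      show "\<exists>u v. u \<le> x \<and> x \<le> v \<and> u < v \<and> v - u < d \<and> f v - f u < l * (v - u)"
        by (elim ex_forward) (auto simp: field_simps)
      have "\<exists>\<^sub>F y in at x. (f y - f x) / (y - x) > q" using x unfolding Eo_def Q_def by auto
      from frequently_slope_interval[where R = "\<lambda>r. r > q", OF this \<open>d > 0\<close>]
      show "\<exists>u v. u \<le> x \<and> x \<le> v \<and> u < v \<and> v - u < d \<and> q * (v - u) < f v - f u"
        by (elim ex_forward) (auto simp: field_simps)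
    qed
  qed (auto simp: Eo_def)
  moreover have sub: "{x \<in> {a<..<b}. \<not> f differentiable (at x)} \<subseteq> Einf \<union> (\<Union>i\<in>\<rat> \<times> \<rat>. Eo i)"
  proof (rule subsetI, rule ccontr)
    fix x assume x: "x \<in> {x \<in> {a<..<b}. \<not> f differentiable (at x)}"
      and n: "x \<notin> Einf \<union> (\<Union>i\<in>\<rat> \<times> \<rat>. Eo i)"
    define u where "u = Limsup (at x) (\<lambda>y. ereal (Q x y))"
    define l where "l = Liminf (at x) (\<lambda>y. ereal (Q x y))"
    obtain N where N: "\<forall>\<^sub>F y in at x. \<bar>Q x y\<bar> \<le> N"
      using x n unfolding Einf_def by (auto simp: frequently_def not_less)
    have "l \<le> u" unfolding l_def u_def by (rule Liminf_le_Limsup) simp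
    have "u \<le> ereal N" unfolding u_def
      by (rule Limsup_bounded) (use N in \<open>eventually_elim, auto\<close>)
    have "ereal (- N) \<le> l" unfolding l_def
      by (rule Liminf_bounded) (use N in \<open>eventually_elim, auto\<close>)
    have "l = u"
    proof (rule ccontr)
      assume "l \<noteq> u"
      then have "l < u" using \<open>l \<le> u\<close> by simp
      obtain l' u' where lu: "l = ereal l'" "u = ereal u'"
        using \<open>u \<le> ereal N\<close> \<open>ereal (- N) \<le> l\<close> \<open>l \<le> u\<close> by (cases l; cases u) auto
      obtain r where r: "r \<in> \<rat>" "l' < r" "r < u'"
        using Rats_dense_in_real[of l' u'] \<open>l < u\<close> lu by auto
      obtain s where s: "s \<in> \<rat>" "r < s" "s < u'"
        using Rats_dense_in_real[of r u'] r by auto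
      have "\<exists>\<^sub>F y in at x. Q x y < r"
      proof (rule ccontr)
        assume "\<not> (\<exists>\<^sub>F y in at x. Q x y < r)"
        then have "\<forall>\<^sub>F y in at x. ereal r \<le> ereal (Q x y)" by (simp add: frequently_def not_less)
        then have "ereal r \<le> l" unfolding l_def by (rule Liminf_bounded)
        then show False using lu r by simp
      qed
      moreover have "\<exists>\<^sub>F y in at x. Q x y > s"
      proof (rule ccontr)
        assume "\<not> (\<exists>\<^sub>F y in at x. Q x y > s)"
        then have "\<forall>\<^sub>F y in at x. ereal (Q x y) \<le> ereal s" by (simp add: frequently_def not_less)
        then have "u \<le> ereal s" unfolding u_def by (rule Limsup_bounded)
        then show False using lu s by simp
      qed
      ultimately have "x \<in> Eo (r, s)" using x r s unfolding Eo_def by auto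
      then show False using n r s by auto
    qed
    then have lim: "((\<lambda>y. ereal (Q x y)) \<longlongrightarrow> l) (at x)"
      by (subst tendsto_iff_Liminf_eq_Limsup) (auto simp: l_def u_def)
    obtain l' where "l = ereal l'"
      using \<open>u \<le> ereal N\<close> \<open>ereal (- N) \<le> l\<close> \<open>l \<le> u\<close> by (cases l; cases u) auto
    then have "(Q x \<longlongrightarrow> l') (at x)" using lim by simp
    then have "(f has_real_derivative l') (at x)"
      unfolding has_field_derivative_iff Q_def .
    then show False using x by (auto simp: real_differentiable_def)
  qed
  moreover have "negligible (\<Union>i\<in>\<rat> \<times> \<rat>. Eo i)"
    using countable_rat by (intro negligible_countable_Union) (use \<open>\<And>l q. negligible (Eo (l, q))\<close> in auto)
  ultimately show ?thesis
    using negligible_subset[OF negligible_Un sub] by blast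
qed

section \<open>Fundamental theorem of calculus\<close>

text \<open>In a gauge fine tagged division, an interval tagged outside N satisfies the straddle
  estimate with error e / 2 times its length. Intervals tagged in N lie in an open set of measure
  below \<delta>, so absolute continuity makes their increments small although no derivative is
  available at the tags. Each kind uses at most half of the admissible error.\<close>

lemma AC_has_integral_deriv:
  fixes f :: "real \<Rightarrow> real"
  assumes AC: "absolutely_continuous_curve a b f" and "a \<le> b"
  shows "(deriv f has_integral (f b - f a)) {a..b}"
proof -
  \<comment> \<open>The end points are exceptional because a two-sided derivative there would depend
    on values of f outside the interval.\<close>
  define N where "N = {x \<in> {a<..<b}. \<not> f differentiable (at x)} \<union> {a, b}"
  have "negligible N"
    unfolding N_def using AC_negligible_nondifferentiable_real[OF AC] by (auto intro: negligible_Un)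
  \<comment> \<open>With value 0 on N, a tag in N contributes only the increment of f over its
    interval.\<close>
  define g where "g = (\<lambda>x. if x \<in> N then 0 else deriv f x)"
  have "(g has_integral (f b - f a)) {a..b}"
  proof (cases "a = b")
    case False
    then have "a < b" using \<open>a \<le> b\<close> by simp
    show ?thesis
      unfolding has_integral_factor_content_real
    proof (intro allI impI)
      fix e :: real assume "e > 0"
      define \<epsilon> where "\<epsilon> = e * (b - a) / 2"
      have "\<epsilon> > 0" using \<open>e > 0\<close> \<open>a < b\<close> unfolding \<epsilon>_def by simp
      obtain \<delta> where \<delta>: "\<delta> > 0"
        "\<And>p. \<lbrakk>p division_of \<Union>p; \<Union>p \<subseteq> {a..b}; (\<Sum>K\<in>p. Sup K - Inf K) < \<delta>\<rbrakk>
          \<Longrightarrow> (\<Sum>K\<in>p. dist (f (Inf K)) (f (Sup K))) < \<epsilon>"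
        by (rule AC_division[OF AC \<open>\<epsilon> > 0\<close>]) (rule that, assumption, blast)
      have Nm: "N \<in> lmeasurable" "measure lebesgue N = 0"
        using \<open>negligible N\<close> by (auto simp: negligible_imp_measurable negligible_imp_measure0)
      obtain U where U: "open U" "N \<subseteq> U" "U - N \<in> lmeasurable" "emeasure lebesgue (U - N) < ennreal \<delta>"
        using fmeasurableD[OF Nm(1)] \<delta>(1) by (rule sets_lebesgue_outer_open) (rule that)
      have Um: "U \<in> lmeasurable"
        using fmeasurable.Un[OF Nm(1) U(3)] U(2) by (simp add: Un_absorb1)
      have "measure lebesgue (U - N) < \<delta>"
        using U(3,4) \<delta>(1) by (simp add: emeasure_eq_measure2 ennreal_less_iff)
      then have mU: "measure lebesgue U < \<delta>"
        using Nm U Um by (simp add: measurable_measure_Diff fmeasurableD)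
      have "\<exists>d>0. (x \<in> N \<longrightarrow> ball x d \<subseteq> U) \<and>
          (x \<in> {a..b} - N \<longrightarrow> (\<forall>y. \<bar>y - x\<bar> < d \<longrightarrow> \<bar>f y - f x - (y - x) * g x\<bar> \<le> (e / 2) * \<bar>y - x\<bar>))" for x
      proof (cases "x \<in> N")
        case True
        then show ?thesis using U(1,2) by (meson Diff_iff openE subsetD)
      next
        case nN: False
        show ?thesis
        proof (cases "x \<in> {a..b}")
          case True
          then have "f differentiable (at x)" using nN unfolding N_def by auto
          then have "(f has_real_derivative g x) (at x)"
            using nN unfolding g_def by (simp add: DERIV_deriv_iff_real_differentiable)
          then have "(f has_derivative (\<lambda>h. h * g x)) (at x)"
            by (simp add: has_field_derivative_def mult_commute_abs)
          then show ?thesis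
            unfolding has_derivative_at_alt using half_gt_zero[OF \<open>e > 0\<close>] nN by fastforce
        qed (use nN in \<open>auto intro: exI[of _ 1]\<close>)
      qed
      then obtain d where d: "\<And>x. d x > 0" "\<And>x. x \<in> N \<Longrightarrow> ball x (d x) \<subseteq> U"
        "\<And>x y. x \<in> {a..b} - N \<Longrightarrow> \<bar>y - x\<bar> < d x \<Longrightarrow> \<bar>f y - f x - (y - x) * g x\<bar> \<le> (e / 2) * \<bar>y - x\<bar>"
        by metis
      show "\<exists>\<gamma>. gauge \<gamma> \<and> (\<forall>p. p tagged_division_of {a..b} \<and> \<gamma> fine p \<longrightarrow>
          norm ((\<Sum>(x, k)\<in>p. measure lborel k *\<^sub>R g x) - (f b - f a)) \<le> e * measure lborel {a..b})"
      proof (intro exI[of _ "\<lambda>x. ball x (d x)"] conjI allI impI)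
        show "gauge (\<lambda>x. ball x (d x))" using d(1) by (rule gauge_ball_dependent[rule_format])
        fix p assume "p tagged_division_of {a..b} \<and> (\<lambda>x. ball x (d x)) fine p"
        then have p: "p tagged_division_of {a..b}" and fine: "\<And>x K. (x, K) \<in> p \<Longrightarrow> K \<subseteq> ball x (d x)"
          unfolding fine_def by auto
        have finp: "finite p" using p by blast
        have pK: "\<exists>u v. u \<le> v \<and> K = {u..v} \<and> u \<le> x \<and> x \<le> v \<and> a \<le> u \<and> v \<le> b" if xK: "(x, K) \<in> p" for x K
        proof -
          obtain u v where "K = cbox u v" "x \<in> K" "K \<subseteq> {a..b}" using p xK by blast
          then show ?thesis by (intro exI[of _ u] exI[of _ v]) auto
        qed
        define h where "h = (\<lambda>(x::real, K::real set). measure lborel K *\<^sub>R g x - (f (Sup K) - f (Inf K)))"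
        define p1 where "p1 = {(x, K) \<in> p. x \<in> N}"
        define p2 where "p2 = {(x, K) \<in> p. x \<notin> N}"
        have p12: "p = p1 \<union> p2" "p1 \<inter> p2 = {}" "finite p1" "finite p2"
          using finp unfolding p1_def p2_def by (auto intro: finite_subset[OF _ finp])
        have "(\<Sum>(x, K)\<in>p. measure lborel K *\<^sub>R g x) - (f b - f a) = sum h p"
          using additive_tagged_division_1[OF \<open>a \<le> b\<close> p, of f] unfolding h_def
          by (simp add: case_prod_unfold sum_subtractf)
        also have "\<dots> = sum h p1 + sum h p2"
          using p12 by (simp add: sum.union_disjoint)
        finally have eq: "(\<Sum>(x, K)\<in>p. measure lborel K *\<^sub>R g x) - (f b - f a) = sum h p1 + sum h p2" .
        have "norm (sum h p2) \<le> (\<Sum>(x, K)\<in>p2. (e / 2) * (Sup K - Inf K))"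
        proof (rule sum_norm_le)
          fix i assume i: "i \<in> p2"
          then obtain x K where xK: "i = (x, K)" "(x, K) \<in> p" "x \<notin> N" unfolding p2_def by auto
          obtain u v where uv: "u \<le> v" "K = {u..v}" "u \<le> x" "x \<le> v" "a \<le> u" "v \<le> b" using pK[OF xK(2)] by blast
          have "u \<in> ball x (d x)" "v \<in> ball x (d x)"
            by (rule subsetD[OF fine[OF xK(2)]], use uv in simp)+
          then have *: "\<bar>f u - f x - (u - x) * g x\<bar> \<le> (e / 2) * \<bar>u - x\<bar>" "\<bar>f v - f x - (v - x) * g x\<bar> \<le> (e / 2) * \<bar>v - x\<bar>"
            using uv xK(3) by (intro d(3); simp add: dist_real_def abs_minus_commute)+
          have "h i = (f u - f x - (u - x) * g x) - (f v - f x - (v - x) * g x)"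
            using uv unfolding h_def xK(1) by (simp add: algebra_simps)
          then have "\<bar>h i\<bar> \<le> (e / 2) * \<bar>u - x\<bar> + (e / 2) * \<bar>v - x\<bar>" using * by linarith
          also have "\<dots> = (e / 2) * (v - u)" using uv by (simp add: field_simps)
          finally show "norm (h i) \<le> (case i of (x, K) \<Rightarrow> (e / 2) * (Sup K - Inf K))"
            using uv unfolding xK(1) by simp
        qed
        also have "\<dots> \<le> (\<Sum>(x, K)\<in>p. (e / 2) * (Sup K - Inf K))"
        proof (rule sum_mono2[OF finp])
          show "p2 \<subseteq> p" using p12 by auto
          fix i assume "i \<in> p - p2"
          then show "0 \<le> (case i of (x, K) \<Rightarrow> (e / 2) * (Sup K - Inf K))"
            using pK \<open>e > 0\<close> by (cases i) fastforce
        qed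
        also have "\<dots> = (e / 2) * (b - a)"
          unfolding additive_tagged_division_1[OF \<open>a \<le> b\<close> p, of "\<lambda>x. x", symmetric] sum_distrib_left
          by (simp add: case_prod_unfold)
        finally have P2: "norm (sum h p2) \<le> \<epsilon>" unfolding \<epsilon>_def by simp
        have p1part: "p1 tagged_partial_division_of {a..b}"
          by (rule tagged_partial_division_subset[of p]) (use p p12 in \<open>auto simp: tagged_division_of_def\<close>)
        define r where "r = snd ` p1"
        have r: "r division_of \<Union>r"
          unfolding r_def by (rule partial_division_of_tagged_division[OF p1part])
        have rU: "\<Union>r \<subseteq> U \<inter> {a..b}"
        proof -
          have "K \<subseteq> U \<inter> {a..b}" if "(x, K) \<in> p1" for x K
          proof -
            have "(x, K) \<in> p" "x \<in> N" using that unfolding p1_def by auto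
            then show ?thesis using fine d(2) p by blast
          qed
          then show ?thesis unfolding r_def by fastforce
        qed
        have "(\<Sum>K\<in>r. Sup K - Inf K) \<le> measure lebesgue U"
          unfolding measure_division[OF r, symmetric]
          using rU Um lmeasurable_division[OF r] by (intro measure_mono_fmeasurable) (auto simp: fmeasurableD)
        then have "(\<Sum>K\<in>r. dist (f (Inf K)) (f (Sup K))) < \<epsilon>"
          using mU rU by (intro \<delta>(2)[OF r]) auto
        moreover have "(\<Sum>K\<in>r. dist (f (Inf K)) (f (Sup K))) = (\<Sum>i\<in>p1. dist (f (Inf (snd i))) (f (Sup (snd i))))"
          unfolding r_def
        proof (subst sum.reindex_nontrivial)
          \<comment> \<open>Two tags may share one interval, but then its interior is disjoint from
            itself, so it is a single point and its increment vanishes.\<close>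
          fix i j assume ij: "i \<in> p1" "j \<in> p1" "i \<noteq> j" "snd i = snd j"
          obtain x K y where K: "i = (x, K)" "j = (y, K)" using ij(4) by (cases i; cases j) auto
          then have "interior K \<inter> interior K = {}"
            using p1part ij unfolding tagged_partial_division_of_def by blast
          moreover obtain u v where "u \<le> v" "K = {u..v}" using pK[of x K] ij(1) K unfolding p1_def by blast
          ultimately show "dist (f (Inf (snd i))) (f (Sup (snd i))) = 0" using K by auto
        qed (use p12 in auto)
        moreover have "norm (sum h p1) \<le> (\<Sum>i\<in>p1. dist (f (Inf (snd i))) (f (Sup (snd i))))"
        proof (rule sum_norm_le)
          fix i assume "i \<in> p1"
          then show "norm (h i) \<le> dist (f (Inf (snd i))) (f (Sup (snd i)))"
            unfolding p1_def h_def g_def by (auto simp: dist_real_def)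
        qed
        ultimately have P1: "norm (sum h p1) \<le> \<epsilon>" by simp
        show "norm ((\<Sum>(x, k)\<in>p. measure lborel k *\<^sub>R g x) - (f b - f a)) \<le> e * measure lborel {a..b}"
          unfolding eq using P1 P2 norm_triangle_ineq[of "sum h p1" "sum h p2"] \<open>a < b\<close> unfolding \<epsilon>_def by simp
      qed
    qed
  next
    case True
    then show ?thesis using has_integral_refl(1)[of g b] by simp
  qed
  then show ?thesis
    by (rule has_integral_spike[OF \<open>negligible N\<close>, rotated]) (simp add: g_def)
qed

section \<open>Vector valued curves: derivative and displacement\<close>

lemma AC_nonexpansive_image:
  assumes "absolutely_continuous_curve a b f"
    and "\<And>r s. dist (g r) (g s) \<le> dist (f r) (f s)"
  shows "absolutely_continuous_curve a b g"
  unfolding absolutely_continuous_curve_def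
proof (intro allI impI)
  fix \<epsilon> :: real assume "\<epsilon> > 0"
  then obtain \<delta> where "\<delta> > 0" and \<delta>: "\<And>I :: (real \<times> real) set.
        finite I \<and> (\<forall>(r, s)\<in>I. a \<le> r \<and> r \<le> s \<and> s \<le> b) \<and>
        disjoint_family_on (\<lambda>(r, s). {r<..<s}) I \<and> (\<Sum>(r, s)\<in>I. s - r) < \<delta>
        \<longrightarrow> (\<Sum>(r, s)\<in>I. dist (f r) (f s)) < \<epsilon>"
    using assms(1) unfolding absolutely_continuous_curve_def by meson
  have "(\<Sum>(r, s)\<in>I. dist (g r) (g s)) \<le> (\<Sum>(r, s)\<in>I. dist (f r) (f s))" for I :: "(real \<times> real) set"
    by (rule sum_mono) (auto simp: assms(2))
  then show "\<exists>\<delta>>0. \<forall>I :: (real \<times> real) set.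
        finite I \<and> (\<forall>(r, s)\<in>I. a \<le> r \<and> r \<le> s \<and> s \<le> b) \<and>
        disjoint_family_on (\<lambda>(r, s). {r<..<s}) I \<and> (\<Sum>(r, s)\<in>I. s - r) < \<delta>
        \<longrightarrow> (\<Sum>(r, s)\<in>I. dist (g r) (g s)) < \<epsilon>"
    using \<delta> \<open>\<delta> > 0\<close> by (meson le_less_trans)
qed

lemma AC_inner:
  fixes f :: "real \<Rightarrow> 'b::real_inner"
  assumes "absolutely_continuous_curve a b f" "norm e \<le> 1"
  shows "absolutely_continuous_curve a b (\<lambda>x. f x \<bullet> e)"
proof (rule AC_nonexpansive_image[OF assms(1)])
  fix r s
  have "\<bar>(f r - f s) \<bullet> e\<bar> \<le> norm (f r - f s) * norm e" by (rule Cauchy_Schwarz_ineq2)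
  also have "\<dots> \<le> norm (f r - f s) * 1" using assms(2) by (intro mult_left_mono) auto
  finally show "dist (f r \<bullet> e) (f s \<bullet> e) \<le> dist (f r) (f s)"
    by (simp add: dist_norm inner_diff_left)
qed

lemma AC_negligible_nondifferentiable:
  fixes f :: "real \<Rightarrow> 'b::euclidean_space"
  assumes "absolutely_continuous_curve a b f"
  shows "negligible {x \<in> {a<..<b}. \<not> f differentiable (at x)}"
proof -
  have "{x \<in> {a<..<b}. \<not> f differentiable (at x)}
      \<subseteq> (\<Union>e\<in>Basis. {x \<in> {a<..<b}. \<not> (\<lambda>x. f x \<bullet> e) differentiable (at x)})"
    using differentiable_componentwise_within[of f _ UNIV] by auto
  moreover have "negligible (\<Union>e\<in>Basis. {x \<in> {a<..<b}. \<not> (\<lambda>x. f x \<bullet> e) differentiable (at x)})"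
    using AC_negligible_nondifferentiable_real[OF AC_inner[OF assms]] by (intro negligible_Union) auto
  ultimately show ?thesis by (rule negligible_subset[rotated])
qed

text \<open>The scalar fundamental theorem is applied to the component of f in the direction of the
  chord from f a to f b. The derivative g of that component is handed out as a measurable function
  whose modulus is below the speed, since later estimates split and scale an integral.\<close>

lemma AC_dist_le_nn_integral:
  fixes f :: "real \<Rightarrow> 'b::euclidean_space"
  assumes AC: "absolutely_continuous_curve a b f" and "a \<le> b"
  obtains g :: "real \<Rightarrow> real" where "g \<in> borel_measurable (lebesgue_on {a..b})"
    "AE x in lebesgue_on {a..b}. \<bar>g x\<bar> \<le> norm (vector_derivative f (at x))"
    "ennreal (dist (f a) (f b)) \<le> (\<integral>\<^sup>+x. ennreal \<bar>g x\<bar> \<partial>lebesgue_on {a..b})"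
proof -
  \<comment> \<open>If f a = f b, this is the zero vector, and both properties in \<open>e\<close>
    remain true.\<close>
  define e where "e = (f b - f a) /\<^sub>R norm (f b - f a)"
  have e: "norm e \<le> 1" "(f b - f a) \<bullet> e = norm (f b - f a)"
  proof -
    show "norm e \<le> 1" unfolding e_def by (cases "f b = f a") simp_all
    have "(f b - f a) \<bullet> e = norm (f b - f a) * norm (f b - f a) / norm (f b - f a)"
      unfolding e_def by (simp add: dot_square_norm power2_eq_square divide_inverse mult_ac)
    then show "(f b - f a) \<bullet> e = norm (f b - f a)" by simp
  qed
  define g where "g = deriv (\<lambda>x. f x \<bullet> e)"
  have hi: "(g has_integral (f b \<bullet> e - f a \<bullet> e)) {a..b}"
    unfolding g_def by (rule AC_has_integral_deriv[OF AC_inner[OF AC e(1)] \<open>a \<le> b\<close>])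
  have gm: "g \<in> borel_measurable (lebesgue_on {a..b})"
    using hi by (intro integrable_imp_measurable) auto
  have ge: "\<bar>g x\<bar> \<le> norm (vector_derivative f (at x))" if "f differentiable (at x)" for x
  proof -
    have "(f has_vector_derivative vector_derivative f (at x)) (at x)"
      using that by (simp add: vector_derivative_works)
    then have "((\<lambda>x. f x \<bullet> e) has_vector_derivative (vector_derivative f (at x) \<bullet> e)) (at x)"
      using bounded_linear.has_vector_derivative[OF bounded_linear_inner_left] by blast
    then have "g x = vector_derivative f (at x) \<bullet> e"
      unfolding g_def by (simp add: has_real_derivative_iff_has_vector_derivative DERIV_imp_deriv)
    moreover have "\<bar>vector_derivative f (at x) \<bullet> e\<bar> \<le> norm (vector_derivative f (at x)) * norm e"
      by (rule Cauchy_Schwarz_ineq2)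
    moreover have "norm (vector_derivative f (at x)) * norm e \<le> norm (vector_derivative f (at x)) * 1"
      using e(1) by (intro mult_left_mono) auto
    ultimately show ?thesis by simp
  qed
  have AEg: "AE x in lebesgue_on {a..b}. \<bar>g x\<bar> \<le> norm (vector_derivative f (at x))"
  proof -
    have "negligible ({x \<in> {a<..<b}. \<not> f differentiable (at x)} \<union> {a, b})"
      using AC_negligible_nondifferentiable[OF AC] by (auto intro: negligible_Un)
    then have "AE x in lebesgue. x \<notin> {x \<in> {a<..<b}. \<not> f differentiable (at x)} \<union> {a, b}"
      by (metis AE_not_in negligible_iff_null_sets)
    then show ?thesis
      by (subst AE_restrict_space_iff, simp, elim eventually_mono) (auto intro!: ge)
  qed
  \<comment> \<open>\<open>hi\<close> is a gauge integral. If \<bar>g\<bar> has a finite integral,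
    it is also a Lebesgue integral; otherwise the bound is trivial.\<close>
  have "ennreal (dist (f a) (f b)) \<le> (\<integral>\<^sup>+x. ennreal \<bar>g x\<bar> \<partial>lebesgue_on {a..b})"
  proof (cases "(\<integral>\<^sup>+x. ennreal \<bar>g x\<bar> \<partial>lebesgue_on {a..b}) = \<infinity>")
    case False
    then have int: "integrable (lebesgue_on {a..b}) g"
      using gm by (simp add: integrable_iff_bounded less_top)
    then have "integral\<^sup>L (lebesgue_on {a..b}) g = f b \<bullet> e - f a \<bullet> e"
      by (intro has_integral_unique[OF has_integral_integral_lebesgue_on[OF int] hi]) simp
    then have "norm (integral\<^sup>L (lebesgue_on {a..b}) g) = dist (f a) (f b)"
      using e(2) by (simp add: inner_diff_left dist_norm norm_minus_commute)
    then show ?thesis using integral_norm_bound_ennreal[OF int] by simp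
  qed simp
  then show ?thesis using that gm AEg by blast
qed

section \<open>Operations on absolutely continuous curves\<close>

lemma AC_lipschitz:
  assumes "\<And>r s. \<lbrakk>a \<le> r; r \<le> s; s \<le> b\<rbrakk> \<Longrightarrow> dist (f r) (f s) \<le> L * (s - r)"
  shows "absolutely_continuous_curve a b f"
  unfolding absolutely_continuous_curve_def
proof (intro allI impI)
  fix \<epsilon> :: real assume "\<epsilon> > 0"
  define L' where "L' = \<bar>L\<bar> + 1"
  have "L' > 0" unfolding L'_def by simp
  show "\<exists>\<delta>>0. \<forall>I :: (real \<times> real) set.
        finite I \<and> (\<forall>(r, s)\<in>I. a \<le> r \<and> r \<le> s \<and> s \<le> b) \<and>
        disjoint_family_on (\<lambda>(r, s). {r<..<s}) I \<and> (\<Sum>(r, s)\<in>I. s - r) < \<delta>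
        \<longrightarrow> (\<Sum>(r, s)\<in>I. dist (f r) (f s)) < \<epsilon>"
  proof (intro exI[of _ "\<epsilon> / L'"] conjI allI impI)
    show "\<epsilon> / L' > 0" using \<open>\<epsilon> > 0\<close> \<open>L' > 0\<close> by simp
    fix I :: "(real \<times> real) set"
    assume I: "finite I \<and> (\<forall>(r, s)\<in>I. a \<le> r \<and> r \<le> s \<and> s \<le> b) \<and>
        disjoint_family_on (\<lambda>(r, s). {r<..<s}) I \<and> (\<Sum>(r, s)\<in>I. s - r) < \<epsilon> / L'"
    have "(\<Sum>(r, s)\<in>I. dist (f r) (f s)) \<le> (\<Sum>(r, s)\<in>I. L' * (s - r))"
    proof (rule sum_mono, clarify)
      fix r s assume "(r, s) \<in> I"
      then have rs: "a \<le> r" "r \<le> s" "s \<le> b" using I by auto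
      have "dist (f r) (f s) \<le> L * (s - r)" using assms rs by blast
      also have "\<dots> \<le> L' * (s - r)" using rs unfolding L'_def by (intro mult_right_mono) auto
      finally show "dist (f r) (f s) \<le> L' * (s - r)" .
    qed
    also have "\<dots> = L' * (\<Sum>(r, s)\<in>I. s - r)" by (simp add: sum_distrib_left case_prod_unfold)
    also have "\<dots> < \<epsilon>" using I \<open>L' > 0\<close> by (simp add: field_simps)
    finally show "(\<Sum>(r, s)\<in>I. dist (f r) (f s)) < \<epsilon>" .
  qed
qed

text \<open>Under a nondecreasing map that does not stretch, nonoverlapping intervals stay
  nonoverlapping and their total length does not grow. Translations in time and clamping to one side
  of a point are of this kind.\<close>

lemma AC_compose_mono_nonexpansive:
  assumes AC: "absolutely_continuous_curve a b f"
    and h: "\<And>r s. \<lbrakk>a' \<le> r; r \<le> s; s \<le> b'\<rbrakk> \<Longrightarrow> a \<le> h r \<and> h r \<le> h s \<and> h s \<le> b \<and> h s - h r \<le> s - r"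
  shows "absolutely_continuous_curve a' b' (\<lambda>x. f (h x))"
  unfolding absolutely_continuous_curve_def
proof (intro allI impI)
  fix \<epsilon> :: real assume "\<epsilon> > 0"
  then obtain \<delta> where "\<delta> > 0" and \<delta>: "\<And>I :: (real \<times> real) set.
        finite I \<and> (\<forall>(r, s)\<in>I. a \<le> r \<and> r \<le> s \<and> s \<le> b) \<and>
        disjoint_family_on (\<lambda>(r, s). {r<..<s}) I \<and> (\<Sum>(r, s)\<in>I. s - r) < \<delta>
        \<longrightarrow> (\<Sum>(r, s)\<in>I. dist (f r) (f s)) < \<epsilon>"
    using AC unfolding absolutely_continuous_curve_def by meson
  show "\<exists>\<delta>>0. \<forall>I :: (real \<times> real) set.
        finite I \<and> (\<forall>(r, s)\<in>I. a' \<le> r \<and> r \<le> s \<and> s \<le> b') \<and>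
        disjoint_family_on (\<lambda>(r, s). {r<..<s}) I \<and> (\<Sum>(r, s)\<in>I. s - r) < \<delta>
        \<longrightarrow> (\<Sum>(r, s)\<in>I. dist (f (h r)) (f (h s))) < \<epsilon>"
  proof (intro exI[of _ \<delta>] conjI allI impI \<open>\<delta> > 0\<close>)
    fix I :: "(real \<times> real) set"
    assume "finite I \<and> (\<forall>(r, s)\<in>I. a' \<le> r \<and> r \<le> s \<and> s \<le> b') \<and>
        disjoint_family_on (\<lambda>(r, s). {r<..<s}) I \<and> (\<Sum>(r, s)\<in>I. s - r) < \<delta>"
    then have fin: "finite I" and Iab: "\<And>r s. (r, s) \<in> I \<Longrightarrow> a' \<le> r \<and> r \<le> s \<and> s \<le> b'"
      and dj: "disjoint_family_on (\<lambda>(r, s). {r<..<s}) I" and sm: "(\<Sum>(r, s)\<in>I. s - r) < \<delta>" by auto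
    define H where "H = (\<lambda>(r, s). (h r, h s))"
    \<comment> \<open>h may be constant on stretches, so images can degenerate or coincide. Images
      of two different nondegenerate intervals still do not overlap.\<close>
    have sep: "h s \<le> h r' \<or> h s' \<le> h r \<or> r = s \<or> r' = s'" if "(r, s) \<in> I" "(r', s') \<in> I" "(r, s) \<noteq> (r', s')" for r s r' s'
    proof (rule ccontr)
      assume n: "\<not> ?thesis"
      have "{r<..<s} \<inter> {r'<..<s'} = {}"
        using dj that unfolding disjoint_family_on_def by fastforce
      moreover have "r < s" "r' < s'" using n Iab[OF that(1)] Iab[OF that(2)] by auto
      ultimately have "(max r r' + min s s') / 2 \<notin> {r<..<s} \<inter> {r'<..<s'}" "r < s" "r' < s'" by auto
      then have "s \<le> r' \<or> s' \<le> r" by (auto simp: max_def min_def split: if_splits)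
      then show False using n h[of s r'] h[of s' r] Iab[OF that(1)] Iab[OF that(2)] by auto
    qed
    \<comment> \<open>Pairs with a common image have an image of length zero, so passing to the set
      of image pairs does not change the sums.\<close>
    have triv: "dist (f (fst (H i))) (f (snd (H i))) = 0 \<and> snd (H i) - fst (H i) = 0"
      if "i \<in> I" "j \<in> I" "i \<noteq> j" "H i = H j" for i j
    proof -
      obtain r s r' s' where ij: "i = (r, s)" "j = (r', s')" by (cases i; cases j) auto
      have "h r = h r'" "h s = h s'" using that(4) unfolding H_def ij by auto
      moreover have "h r \<le> h s" using h[of r s] Iab[of r s] that(1) ij by auto
      ultimately have "h r = h s" using sep[of r s r' s'] that ij by fastforce
      then show ?thesis unfolding H_def ij by simp
    qed
    have "(\<Sum>(r, s)\<in>H ` I. s - r) = (\<Sum>i\<in>I. snd (H i) - fst (H i))"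
      unfolding case_prod_unfold
      by (subst sum.reindex_nontrivial[OF fin]) (rule triv[THEN conjunct2], assumption+, simp add: comp_def)
    also have "\<dots> \<le> (\<Sum>(r, s)\<in>I. s - r)"
      by (rule sum_mono) (use h Iab in \<open>auto simp: H_def\<close>)
    finally have 1: "(\<Sum>(r, s)\<in>H ` I. s - r) < \<delta>" using sm by simp
    have 2: "\<forall>(r, s)\<in>H ` I. a \<le> r \<and> r \<le> s \<and> s \<le> b"
      using h Iab unfolding H_def by fastforce
    have 3: "disjoint_family_on (\<lambda>(r, s). {r<..<s}) (H ` I)"
      unfolding disjoint_family_on_def
    proof (intro ballI impI)
      fix m n assume mn: "m \<in> H ` I" "n \<in> H ` I" "m \<noteq> n"
      then obtain r s r' s' where *: "(r, s) \<in> I" "(r', s') \<in> I" "m = (h r, h s)" "n = (h r', h s')"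
        unfolding H_def by auto
      then have "(r, s) \<noteq> (r', s')" using mn(3) by auto
      from sep[OF *(1,2) this] show "(case m of (r, s) \<Rightarrow> {r<..<s}) \<inter> (case n of (r, s) \<Rightarrow> {r<..<s}) = {}"
        unfolding *(3,4) by auto
    qed
    have "(\<Sum>(r, s)\<in>H ` I. dist (f r) (f s)) < \<epsilon>"
      by (intro \<delta>[THEN mp] conjI 1 2 3 finite_imageI fin)
    moreover have "(\<Sum>(r, s)\<in>H ` I. dist (f r) (f s)) = (\<Sum>i\<in>I. dist (f (fst (H i))) (f (snd (H i))))"
      unfolding case_prod_unfold
      by (subst sum.reindex_nontrivial[OF fin]) (rule triv[THEN conjunct1], assumption+, simp add: comp_def)
    ultimately show "(\<Sum>(r, s)\<in>I. dist (f (h r)) (f (h s))) < \<epsilon>"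
      by (simp add: H_def case_prod_unfold)
  qed
qed

lemma AC_subinterval:
  assumes "absolutely_continuous_curve a b f" "a \<le> a'" "b' \<le> b"
  shows "absolutely_continuous_curve a' b' f"
  by (rule AC_compose_mono_nonexpansive[OF assms(1), where h = "\<lambda>x. x"]) (use assms in auto)

text \<open>Clamping both end points first to one side of b and then to the other splits an
  increment across b by the triangle inequality, so no interval of the family has to be cut.\<close>

lemma AC_combine:
  assumes ab: "absolutely_continuous_curve a b f" and bc: "absolutely_continuous_curve b c f"
    and "a \<le> b" "b \<le> c"
  shows "absolutely_continuous_curve a c f"
proof -
  have 1: "absolutely_continuous_curve a c (\<lambda>x. f (min x b))"
    by (rule AC_compose_mono_nonexpansive[OF ab]) (use assms in \<open>auto simp: min_def\<close>)
  have 2: "absolutely_continuous_curve a c (\<lambda>x. f (max x b))"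
    by (rule AC_compose_mono_nonexpansive[OF bc]) (use assms in \<open>auto simp: max_def\<close>)
  show ?thesis
    unfolding absolutely_continuous_curve_def
  proof (intro allI impI)
    fix \<epsilon> :: real assume "\<epsilon> > 0"
    then have e2: "\<epsilon> / 2 > 0" by simp
    obtain d1 where "d1 > 0" and d1: "\<And>I :: (real \<times> real) set.
        finite I \<and> (\<forall>(r, s)\<in>I. a \<le> r \<and> r \<le> s \<and> s \<le> c) \<and>
        disjoint_family_on (\<lambda>(r, s). {r<..<s}) I \<and> (\<Sum>(r, s)\<in>I. s - r) < d1
        \<longrightarrow> (\<Sum>(r, s)\<in>I. dist (f (min r b)) (f (min s b))) < \<epsilon> / 2"
      using 1 e2 unfolding absolutely_continuous_curve_def by meson
    obtain d2 where "d2 > 0" and d2: "\<And>I :: (real \<times> real) set.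
        finite I \<and> (\<forall>(r, s)\<in>I. a \<le> r \<and> r \<le> s \<and> s \<le> c) \<and>
        disjoint_family_on (\<lambda>(r, s). {r<..<s}) I \<and> (\<Sum>(r, s)\<in>I. s - r) < d2
        \<longrightarrow> (\<Sum>(r, s)\<in>I. dist (f (max r b)) (f (max s b))) < \<epsilon> / 2"
      using 2 e2 unfolding absolutely_continuous_curve_def by meson
    show "\<exists>\<delta>>0. \<forall>I :: (real \<times> real) set.
        finite I \<and> (\<forall>(r, s)\<in>I. a \<le> r \<and> r \<le> s \<and> s \<le> c) \<and>
        disjoint_family_on (\<lambda>(r, s). {r<..<s}) I \<and> (\<Sum>(r, s)\<in>I. s - r) < \<delta>
        \<longrightarrow> (\<Sum>(r, s)\<in>I. dist (f r) (f s)) < \<epsilon>"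
    proof (intro exI[of _ "min d1 d2"] conjI allI impI)
      show "min d1 d2 > 0" using \<open>d1 > 0\<close> \<open>d2 > 0\<close> by simp
      fix I :: "(real \<times> real) set"
      assume I: "finite I \<and> (\<forall>(r, s)\<in>I. a \<le> r \<and> r \<le> s \<and> s \<le> c) \<and>
        disjoint_family_on (\<lambda>(r, s). {r<..<s}) I \<and> (\<Sum>(r, s)\<in>I. s - r) < min d1 d2"
      have "(\<Sum>(r, s)\<in>I. dist (f r) (f s))
          \<le> (\<Sum>(r, s)\<in>I. dist (f (min r b)) (f (min s b)) + dist (f (max r b)) (f (max s b)))"
      proof (rule sum_mono, clarify)
        fix r s assume "(r, s) \<in> I"
        then have "r \<le> s" using I by auto
        then show "dist (f r) (f s) \<le> dist (f (min r b)) (f (min s b)) + dist (f (max r b)) (f (max s b))"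
          by (auto simp: min_def max_def dist_triangle)
      qed
      also have "\<dots> = (\<Sum>(r, s)\<in>I. dist (f (min r b)) (f (min s b))) + (\<Sum>(r, s)\<in>I. dist (f (max r b)) (f (max s b)))"
        by (simp add: case_prod_unfold sum.distrib)
      also have "\<dots> < \<epsilon>" using d1[of I] d2[of I] I by simp
      finally show "(\<Sum>(r, s)\<in>I. dist (f r) (f s)) < \<epsilon>" .
    qed
  qed
qed

lemma AC_cong:
  assumes "absolutely_continuous_curve a b f" "\<And>x. x \<in> {a..b} \<Longrightarrow> f x = g x"
  shows "absolutely_continuous_curve a b g"
  unfolding absolutely_continuous_curve_def
proof (intro allI impI)
  fix \<epsilon> :: real assume "\<epsilon> > 0"
  then obtain \<delta> where "\<delta> > 0" and \<delta>: "\<And>I :: (real \<times> real) set.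
        finite I \<and> (\<forall>(r, s)\<in>I. a \<le> r \<and> r \<le> s \<and> s \<le> b) \<and>
        disjoint_family_on (\<lambda>(r, s). {r<..<s}) I \<and> (\<Sum>(r, s)\<in>I. s - r) < \<delta>
        \<longrightarrow> (\<Sum>(r, s)\<in>I. dist (f r) (f s)) < \<epsilon>"
    using assms(1) unfolding absolutely_continuous_curve_def by meson
  have "(\<Sum>(r, s)\<in>I. dist (g r) (g s)) = (\<Sum>(r, s)\<in>I. dist (f r) (f s))"
    if "\<forall>(r, s)\<in>I. a \<le> r \<and> r \<le> s \<and> s \<le> b" for I :: "(real \<times> real) set"
  proof (rule sum.cong[OF refl], clarify)
    fix r s assume "(r, s) \<in> I"
    then have "r \<in> {a..b}" "s \<in> {a..b}" using that by auto
    then show "dist (g r) (g s) = dist (f r) (f s)" using assms(2) by metis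
  qed
  then show "\<exists>\<delta>>0. \<forall>I :: (real \<times> real) set.
        finite I \<and> (\<forall>(r, s)\<in>I. a \<le> r \<and> r \<le> s \<and> s \<le> b) \<and>
        disjoint_family_on (\<lambda>(r, s). {r<..<s}) I \<and> (\<Sum>(r, s)\<in>I. s - r) < \<delta>
        \<longrightarrow> (\<Sum>(r, s)\<in>I. dist (g r) (g s)) < \<epsilon>"
    using \<delta> \<open>\<delta> > 0\<close> by (intro exI[of _ \<delta>]) auto
qed

section \<open>Integrals of non-measurable functions\<close>

text \<open>
  For a function that is not measurable, \<open>integral\<^sup>N\<close> is the lower integral. Additivity over disjoint
  sets and translation invariance survive, so measurability of the Lagrangian along a curve never has
  to be established.
\<close>

lemma nn_integral_lower_envelope:
  obtains w where "w \<in> borel_measurable M" "\<And>x. w x \<le> u x" "(\<integral>\<^sup>+x. w x \<partial>M) = (\<integral>\<^sup>+x. u x \<partial>M)"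
proof -
  define G where "G = {g. simple_function M g \<and> g \<le> u}"
  have "(\<lambda>_. 0) \<in> G" unfolding G_def by (auto simp: le_fun_def)
  then have "G \<noteq> {}" by blast
  then obtain s :: "nat \<Rightarrow> ennreal" where s: "range s \<subseteq> integral\<^sup>S M ` G" "(SUP g\<in>G. integral\<^sup>S M g) = (SUP i. s i)"
    using ennreal_SUP_countable_SUP[of G "integral\<^sup>S M"] by auto
  then have "\<forall>i. \<exists>g. g \<in> G \<and> s i = integral\<^sup>S M g" by blast
  then obtain g where g: "\<And>i. g i \<in> G" "\<And>i. s i = integral\<^sup>S M (g i)" by metis
  define w where "w = (\<lambda>x. SUP i. g i x)"
  have le: "w x \<le> u x" for x unfolding w_def
    by (rule SUP_least) (use g(1) in \<open>auto simp: G_def le_fun_def\<close>)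
  have wm: "w \<in> borel_measurable M" unfolding w_def
    by (rule borel_measurable_SUP) (use g(1) in \<open>auto simp: G_def intro: borel_measurable_simple_function\<close>)
  have "(\<integral>\<^sup>+x. u x \<partial>M) = (SUP i. s i)"
    unfolding nn_integral_def s(2)[symmetric] G_def by simp
  also have "\<dots> \<le> (\<integral>\<^sup>+x. w x \<partial>M)"
  proof (rule SUP_least)
    fix i
    have "s i = (\<integral>\<^sup>+x. g i x \<partial>M)"
      using g by (simp add: G_def nn_integral_eq_simple_integral)
    also have "\<dots> \<le> (\<integral>\<^sup>+x. w x \<partial>M)" unfolding w_def by (intro nn_integral_mono SUP_upper) auto
    finally show "s i \<le> (\<integral>\<^sup>+x. w x \<partial>M)" .
  qed
  finally have "(\<integral>\<^sup>+x. w x \<partial>M) = (\<integral>\<^sup>+x. u x \<partial>M)"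
    by (rule antisym[rotated]) (intro nn_integral_mono le)
  with wm le show ?thesis using that by blast
qed

text \<open>For one inequality a minorant on the union is restricted to A and to B, which keeps it
  measurable because the sets are. For the other, minorants on the two parts are added, which gives
  a minorant on the union because the parts are disjoint.\<close>

lemma nn_integral_indicator_Un:
  fixes u :: "'b \<Rightarrow> ennreal"
  assumes [measurable]: "A \<in> sets M" "B \<in> sets M" and "A \<inter> B = {}"
  shows "(\<integral>\<^sup>+x. u x * indicator (A \<union> B) x \<partial>M)
       = (\<integral>\<^sup>+x. u x * indicator A x \<partial>M) + (\<integral>\<^sup>+x. u x * indicator B x \<partial>M)"
proof (rule antisym)
  obtain w where [measurable]: "w \<in> borel_measurable M" and w: "\<And>x. w x \<le> u x * indicator (A \<union> B) x"
    "(\<integral>\<^sup>+x. w x \<partial>M) = (\<integral>\<^sup>+x. u x * indicator (A \<union> B) x \<partial>M)"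
    by (rule nn_integral_lower_envelope) (rule that)
  have "w x = w x * indicator A x + w x * indicator B x" for x
    using w(1)[of x] \<open>A \<inter> B = {}\<close> by (auto split: split_indicator_asm split: split_indicator)
  then have "(\<integral>\<^sup>+x. w x \<partial>M) = (\<integral>\<^sup>+x. w x * indicator A x + w x * indicator B x \<partial>M)" by presburger
  also have "\<dots> = (\<integral>\<^sup>+x. w x * indicator A x \<partial>M) + (\<integral>\<^sup>+x. w x * indicator B x \<partial>M)"
    by (rule nn_integral_add) auto
  also have "\<dots> \<le> (\<integral>\<^sup>+x. u x * indicator A x \<partial>M) + (\<integral>\<^sup>+x. u x * indicator B x \<partial>M)"
  proof (intro add_mono nn_integral_mono)
    fix x show "w x * indicator A x \<le> u x * indicator A x" "w x * indicator B x \<le> u x * indicator B x"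
      using w(1)[of x] by (auto split: split_indicator_asm split: split_indicator)
  qed
  finally show "(\<integral>\<^sup>+x. u x * indicator (A \<union> B) x \<partial>M)
      \<le> (\<integral>\<^sup>+x. u x * indicator A x \<partial>M) + (\<integral>\<^sup>+x. u x * indicator B x \<partial>M)"
    using w(2) by simp
next
  obtain v where [measurable]: "v \<in> borel_measurable M" and v: "\<And>x. v x \<le> u x * indicator A x"
    "(\<integral>\<^sup>+x. v x \<partial>M) = (\<integral>\<^sup>+x. u x * indicator A x \<partial>M)"
    by (rule nn_integral_lower_envelope) (rule that)
  obtain w where [measurable]: "w \<in> borel_measurable M" and w: "\<And>x. w x \<le> u x * indicator B x"
    "(\<integral>\<^sup>+x. w x \<partial>M) = (\<integral>\<^sup>+x. u x * indicator B x \<partial>M)"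
    by (rule nn_integral_lower_envelope) (rule that)
  have "(\<integral>\<^sup>+x. v x \<partial>M) + (\<integral>\<^sup>+x. w x \<partial>M) = (\<integral>\<^sup>+x. v x + w x \<partial>M)"
    by (rule nn_integral_add[symmetric]) auto
  also have "\<dots> \<le> (\<integral>\<^sup>+x. u x * indicator (A \<union> B) x \<partial>M)"
  proof (rule nn_integral_mono)
    fix x show "v x + w x \<le> u x * indicator (A \<union> B) x"
      using v(1)[of x] w(1)[of x] \<open>A \<inter> B = {}\<close>
      by (auto split: split_indicator_asm split: split_indicator)
  qed
  finally show "(\<integral>\<^sup>+x. u x * indicator A x \<partial>M) + (\<integral>\<^sup>+x. u x * indicator B x \<partial>M)
      \<le> (\<integral>\<^sup>+x. u x * indicator (A \<union> B) x \<partial>M)"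
    using v(2) w(2) by simp
qed

lemma nn_integral_lebesgue_on_combine:
  fixes u :: "real \<Rightarrow> ennreal"
  assumes "a \<le> b" "b \<le> c"
  shows "(\<integral>\<^sup>+x. u x \<partial>lebesgue_on {a..c}) = (\<integral>\<^sup>+x. u x \<partial>lebesgue_on {a..b}) + (\<integral>\<^sup>+x. u x \<partial>lebesgue_on {b..c})"
proof -
  have eq: "(\<integral>\<^sup>+x. u x * indicator {b<..c} x \<partial>lebesgue) = (\<integral>\<^sup>+x. u x * indicator {b..c} x \<partial>lebesgue)"
  proof (rule nn_integral_cong_AE)
    have "AE x in lebesgue. x \<noteq> b" using AE_not_in[of "{b}" lebesgue] by simp
    then show "AE x in lebesgue. u x * indicator {b<..c} x = u x * indicator {b..c} x"
      by eventually_elim (auto split: split_indicator)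
  qed
  have "{a..c} = {a..b} \<union> {b<..c}" using assms by auto
  then show ?thesis
    using nn_integral_indicator_Un[of "{a..b}" lebesgue "{b<..c}" u] eq
    by (simp add: nn_integral_restrict_space ivl_disj_int)
qed

lemma nn_integral_lebesgue_shift:
  fixes u :: "real \<Rightarrow> ennreal"
  shows "(\<integral>\<^sup>+x. u (x + h) \<partial>lebesgue) = (\<integral>\<^sup>+x. u x \<partial>lebesgue)"
proof -
  \<comment> \<open>One inequality for all u and all shifts is enough: for the shifted function and
    the opposite shift it is the reverse one.\<close>
  have ge: "(\<integral>\<^sup>+x. u x \<partial>lebesgue) \<le> (\<integral>\<^sup>+x. u (x + h) \<partial>lebesgue)" for u :: "real \<Rightarrow> ennreal" and h
  proof -
    obtain w where wm: "w \<in> borel_measurable lebesgue" and w: "\<And>x. w x \<le> u x"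
      "(\<integral>\<^sup>+x. w x \<partial>lebesgue) = (\<integral>\<^sup>+x. u x \<partial>lebesgue)"
      by (rule nn_integral_lower_envelope) (rule that)
    have "(\<integral>\<^sup>+x. u x \<partial>lebesgue) = (\<integral>\<^sup>+x. w (x + h) \<partial>lebesgue)"
      using nn_integral_real_affine_lebesgue[OF wm, of 1 h] w(2) by (simp add: add.commute)
    also have "\<dots> \<le> (\<integral>\<^sup>+x. u (x + h) \<partial>lebesgue)" by (intro nn_integral_mono w)
    finally show ?thesis .
  qed
  show ?thesis
    using ge[of u h] ge[of "\<lambda>x. u (x + h)" "- h"] by simp
qed

lemma nn_integral_lebesgue_on_shift:
  fixes u :: "real \<Rightarrow> ennreal"
  shows "(\<integral>\<^sup>+x. u (x + h) \<partial>lebesgue_on {a..b}) = (\<integral>\<^sup>+x. u x \<partial>lebesgue_on {a + h..b + h})"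
proof -
  have "(\<integral>\<^sup>+x. u (x + h) * indicator {a..b} x \<partial>lebesgue)
      = (\<integral>\<^sup>+x. u (x + h) * indicator {a + h..b + h} (x + h) \<partial>lebesgue)"
    by (rule nn_integral_cong) (auto split: split_indicator)
  then show ?thesis
    using nn_integral_lebesgue_shift[of "\<lambda>x. u x * indicator {a + h..b + h} x" h]
    by (simp add: nn_integral_restrict_space)
qed

section \<open>Extended real integrals on bounded intervals\<close>

lemma ereal_integral_cong_AE:
  assumes "AE x in M. f x = g x"
  shows "ereal_integral M f = ereal_integral M g"
proof -
  have "(\<integral>\<^sup>+ x. e2ennreal (f x) \<partial>M) = (\<integral>\<^sup>+ x. e2ennreal (g x) \<partial>M)"
    by (rule nn_integral_cong_AE) (use assms in \<open>auto elim!: eventually_mono\<close>)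
  moreover have "(\<integral>\<^sup>+ x. e2ennreal (- f x) \<partial>M) = (\<integral>\<^sup>+ x. e2ennreal (- g x) \<partial>M)"
    by (rule nn_integral_cong_AE) (use assms in \<open>auto elim!: eventually_mono\<close>)
  ultimately show ?thesis unfolding ereal_integral_def by simp
qed

lemma nn_integral_const_lebesgue_on:
  fixes a b :: real
  assumes "a \<le> b" "C \<ge> 0"
  shows "(\<integral>\<^sup>+ x. ennreal C \<partial>lebesgue_on {a..b}) = ennreal (C * (b - a))"
  using assms by (simp add: emeasure_restrict_space ennreal_mult)

lemma nn_integral_negative_part_bound:
  fixes a b :: real and f :: "real \<Rightarrow> ereal"
  assumes "a \<le> b" "C \<ge> 0" "\<And>x. - ereal C \<le> f x"
  shows "(\<integral>\<^sup>+ x. e2ennreal (- f x) \<partial>lebesgue_on {a..b}) \<le> ennreal (C * (b - a))"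
proof -
  have "e2ennreal (- f x) \<le> ennreal C" for x
  proof -
    have "- f x \<le> ereal C" using assms(3)[of x] by (simp add: ereal_uminus_le_reorder)
    then have "e2ennreal (- f x) \<le> e2ennreal (ereal C)" by (rule e2ennreal_mono)
    then show ?thesis by simp
  qed
  then show ?thesis
    unfolding nn_integral_const_lebesgue_on[OF assms(1,2), symmetric] by (intro nn_integral_mono)
qed

text \<open>The bound below keeps both negative parts finite, so the subtractions in
  \<open>ereal_integral\<close> can be regrouped without meeting \<infinity> - \<infinity>.\<close>

lemma ereal_integral_combine:
  fixes a b c :: real and f :: "real \<Rightarrow> ereal"
  assumes "a \<le> b" "b \<le> c" "C \<ge> 0" "\<And>x. - ereal C \<le> f x"
  shows "ereal_integral (lebesgue_on {a..c}) f
       = ereal_integral (lebesgue_on {a..b}) f + ereal_integral (lebesgue_on {b..c}) f"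
proof -
  have fin: "(\<integral>\<^sup>+ x. e2ennreal (- f x) \<partial>lebesgue_on {u..v}) \<noteq> \<infinity>" if "u \<le> v" for u v :: real
    using nn_integral_negative_part_bound[OF that, of C f] assms(3,4) by (auto simp: top_unique)
  have *: "enn2ereal (p + p') - enn2ereal (n + n') = enn2ereal p - enn2ereal n + (enn2ereal p' - enn2ereal n')"
    if "n \<noteq> \<infinity>" "n' \<noteq> \<infinity>" for p p' n n'
    using that by (cases p; cases p'; cases n; cases n') (auto simp: plus_ennreal.rep_eq enn2ereal_ennreal)
  show ?thesis
    unfolding ereal_integral_def nn_integral_lebesgue_on_combine[OF assms(1,2)]
    by (rule *) (use fin assms in auto)
qed

lemma ereal_integral_shift:
  fixes f :: "real \<Rightarrow> ereal"
  shows "ereal_integral (lebesgue_on {a..b}) (\<lambda>x. f (x + h)) = ereal_integral (lebesgue_on {a + h..b + h}) f"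
  unfolding ereal_integral_def
  using nn_integral_lebesgue_on_shift[where u = "\<lambda>x. e2ennreal (f x)"]
    nn_integral_lebesgue_on_shift[where u = "\<lambda>x. e2ennreal (- f x)"] by simp

lemma ereal_integral_le:
  fixes a b :: real
  assumes "a \<le> b" "M \<ge> 0" "AE x in lebesgue_on {a..b}. f x \<le> ereal M"
  shows "ereal_integral (lebesgue_on {a..b}) f \<le> ereal (M * (b - a))"
proof -
  have "(\<integral>\<^sup>+ x. e2ennreal (f x) \<partial>lebesgue_on {a..b}) \<le> (\<integral>\<^sup>+ x. ennreal M \<partial>lebesgue_on {a..b})"
  proof (rule nn_integral_mono_AE)
    show "AE x in lebesgue_on {a..b}. e2ennreal (f x) \<le> ennreal M"
      using assms(3)
    proof eventually_elim
      case (elim x)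
      then have "e2ennreal (f x) \<le> e2ennreal (ereal M)" by (rule e2ennreal_mono)
      then show ?case by simp
    qed
  qed
  then have "(\<integral>\<^sup>+ x. e2ennreal (f x) \<partial>lebesgue_on {a..b}) \<le> ennreal (M * (b - a))"
    unfolding nn_integral_const_lebesgue_on[OF assms(1,2)] .
  then have "enn2ereal (\<integral>\<^sup>+ x. e2ennreal (f x) \<partial>lebesgue_on {a..b}) \<le> ereal (M * (b - a))"
    using assms by (simp add: less_eq_ennreal.rep_eq enn2ereal_ennreal)
  moreover have "p - q \<le> p" if "0 \<le> q" for p q :: ereal
    using that by (cases p; cases q) auto
  ultimately show ?thesis unfolding ereal_integral_def
    by (meson enn2ereal_nonneg order_trans)
qed

lemma ereal_integral_ge:
  fixes a b :: real and f :: "real \<Rightarrow> ereal"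
  assumes "a \<le> b" "C \<ge> 0" "\<And>x. - ereal C \<le> f x"
  shows "- ereal (C * (b - a)) \<le> ereal_integral (lebesgue_on {a..b}) f"
proof -
  have "enn2ereal (\<integral>\<^sup>+ x. e2ennreal (- f x) \<partial>lebesgue_on {a..b}) \<le> ereal (C * (b - a))"
    using nn_integral_negative_part_bound[OF assms] assms
    by (simp add: less_eq_ennreal.rep_eq enn2ereal_ennreal)
  moreover have "- q \<le> p - q" if "0 \<le> p" for p q :: ereal
    using that by (cases p; cases q) auto
  ultimately show ?thesis unfolding ereal_integral_def
    by (meson enn2ereal_nonneg ereal_uminus_le_reorder ereal_minus_le_minus order_trans)
qed

text \<open>The factor 2 collects C twice: once because the positive part of f dominates A times the
  speed only up to C, and once for the negative part of f, whose integral is at most C (b - a). As f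
  may be nonmeasurable, the linear operations are carried out on g.\<close>

lemma AC_dist_le_ereal_integral:
  fixes \<xi> :: "real \<Rightarrow> 'b::euclidean_space"
  assumes AC: "absolutely_continuous_curve a b \<xi>" and "a \<le> b" "A \<ge> 0" "C \<ge> 0"
    and low: "\<And>x. ereal (A * norm (vector_derivative \<xi> (at x)) - C) \<le> f x"
  shows "ereal (A * dist (\<xi> a) (\<xi> b)) \<le> ereal_integral (lebesgue_on {a..b}) f + ereal (2 * C * (b - a))"
proof -
  let ?M = "lebesgue_on {a..b}"
  obtain g :: "real \<Rightarrow> real" where gm [measurable]: "g \<in> borel_measurable ?M"
    and g: "AE x in ?M. \<bar>g x\<bar> \<le> norm (vector_derivative \<xi> (at x))"
      "ennreal (dist (\<xi> a) (\<xi> b)) \<le> (\<integral>\<^sup>+x. ennreal \<bar>g x\<bar> \<partial>?M)"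
    by (rule AC_dist_le_nn_integral[OF AC \<open>a \<le> b\<close>]) (rule that)
  define P where "P = (\<integral>\<^sup>+ x. e2ennreal (f x) \<partial>?M)"
  have "ennreal (A * dist (\<xi> a) (\<xi> b)) = ennreal A * ennreal (dist (\<xi> a) (\<xi> b))"
    using \<open>A \<ge> 0\<close> by (simp add: ennreal_mult)
  also have "\<dots> \<le> ennreal A * (\<integral>\<^sup>+x. ennreal \<bar>g x\<bar> \<partial>?M)"
    using g(2) by (rule mult_left_mono) simp
  also have "\<dots> = (\<integral>\<^sup>+x. ennreal A * ennreal \<bar>g x\<bar> \<partial>?M)"
    by (rule nn_integral_cmult[symmetric]) simp
  also have "\<dots> \<le> (\<integral>\<^sup>+x. ennreal (A * \<bar>g x\<bar> - C) + ennreal C \<partial>?M)"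
  proof (rule nn_integral_mono)
    fix x
    have "A * \<bar>g x\<bar> \<le> max 0 (A * \<bar>g x\<bar> - C) + C" by auto
    then have "ennreal (A * \<bar>g x\<bar>) \<le> ennreal (max 0 (A * \<bar>g x\<bar> - C) + C)" by (rule ennreal_leI)
    also have "\<dots> = ennreal (max 0 (A * \<bar>g x\<bar> - C)) + ennreal C"
      using \<open>C \<ge> 0\<close> by (intro ennreal_plus) auto
    finally show "ennreal A * ennreal \<bar>g x\<bar> \<le> ennreal (A * \<bar>g x\<bar> - C) + ennreal C"
      using \<open>A \<ge> 0\<close> by (simp add: ennreal_mult ennreal_max_0 del: max_def)
  qed
  also have "\<dots> = (\<integral>\<^sup>+x. ennreal (A * \<bar>g x\<bar> - C) \<partial>?M) + ennreal (C * (b - a))"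
    unfolding nn_integral_const_lebesgue_on[OF \<open>a \<le> b\<close> \<open>C \<ge> 0\<close>, symmetric] by (rule nn_integral_add) auto
  also have "\<dots> \<le> P + ennreal (C * (b - a))"
    unfolding P_def
  proof (intro add_right_mono nn_integral_mono_AE)
    show "AE x in ?M. ennreal (A * \<bar>g x\<bar> - C) \<le> e2ennreal (f x)"
      using g(1)
    proof eventually_elim
      case (elim x)
      have "A * \<bar>g x\<bar> - C \<le> A * norm (vector_derivative \<xi> (at x)) - C"
        using elim \<open>A \<ge> 0\<close> by (simp add: mult_left_mono)
      then have "ereal (A * \<bar>g x\<bar> - C) \<le> f x" using low[of x] by (meson ereal_less_eq(3) order_trans)
      then have "e2ennreal (ereal (A * \<bar>g x\<bar> - C)) \<le> e2ennreal (f x)" by (rule e2ennreal_mono)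
      then show ?case by simp
    qed
  qed
  finally have "ennreal (A * dist (\<xi> a) (\<xi> b)) \<le> P + ennreal (C * (b - a))" .
  then have 1: "ereal (A * dist (\<xi> a) (\<xi> b)) \<le> enn2ereal P + ereal (C * (b - a))"
    using assms by (simp add: less_eq_ennreal.rep_eq enn2ereal_ennreal plus_ennreal.rep_eq)
  have "- ereal C \<le> f x" for x
  proof -
    have "- C \<le> A * norm (vector_derivative \<xi> (at x)) - C" using \<open>A \<ge> 0\<close> by simp
    then show ?thesis using low[of x] by (metis ereal_less_eq(3) order_trans uminus_ereal.simps(1))
  qed
  then have "(\<integral>\<^sup>+ x. e2ennreal (- f x) \<partial>?M) \<le> ennreal (C * (b - a))"
    by (intro nn_integral_negative_part_bound assms)
  then have 2: "enn2ereal (\<integral>\<^sup>+ x. e2ennreal (- f x) \<partial>?M) \<le> ereal (C * (b - a))"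
    using assms by (simp add: less_eq_ennreal.rep_eq enn2ereal_ennreal)
  have *: "ereal x \<le> p - n + ereal (2 * c)" if "ereal x \<le> p + ereal c" "n \<le> ereal c" "0 \<le> n" for x c :: real and p n :: ereal
    using that by (cases p; cases n) auto
  show ?thesis
    unfolding ereal_integral_def P_def[symmetric]
    using *[OF 1 2 enn2ereal_nonneg] by (simp add: mult.assoc)
qed

section \<open>Bounds on the Lagrangians\<close>

lemma superlinear_lower_bound:
  fixes h :: "real \<Rightarrow> real \<Rightarrow> real"
  assumes cont: "continuous_on ({0..1} \<times> UNIV) (\<lambda>(s, \<mu>). h s \<mu>)"
    and growth: "filterlim (\<lambda>\<mu>. INF s\<in>{0..1}. h s \<mu> / \<bar>\<mu>\<bar>) at_top at_infinity"
  shows "\<exists>K>0. \<forall>s\<in>{0..1}. \<forall>\<mu>. \<bar>\<mu>\<bar> \<ge> K \<longrightarrow> h s \<mu> \<ge> R * \<bar>\<mu>\<bar>"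
proof -
  have "\<forall>\<^sub>F \<mu> in at_infinity. R \<le> (INF s\<in>{0..1}. h s \<mu> / \<bar>\<mu>\<bar>)"
    using growth unfolding filterlim_at_top by blast
  then obtain b where b: "\<And>\<mu>. b \<le> \<bar>\<mu>\<bar> \<Longrightarrow> R \<le> (INF s\<in>{0..1}. h s \<mu> / \<bar>\<mu>\<bar>)"
    unfolding eventually_at_infinity by auto
  have "h s \<mu> \<ge> R * \<bar>\<mu>\<bar>" if s: "s \<in> {0..1}" and \<mu>: "\<bar>\<mu>\<bar> \<ge> max b 1" for s \<mu>
  proof -
    have "continuous_on {0..1} (\<lambda>s. (\<lambda>(s, \<mu>). h s \<mu>) (s, \<mu>))"
      by (rule continuous_on_compose2[OF cont]) (auto intro!: continuous_intros)
    then have "continuous_on {0..1} (\<lambda>s. h s \<mu> / \<bar>\<mu>\<bar>)"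
      using \<mu> by (intro continuous_on_divide continuous_on_const) auto
    then have "compact ((\<lambda>s. h s \<mu> / \<bar>\<mu>\<bar>) ` {0..1})"
      by (rule compact_continuous_image) auto
    then have "bdd_below ((\<lambda>s. h s \<mu> / \<bar>\<mu>\<bar>) ` {0..1})"
      by (intro bounded_imp_bdd_below compact_imp_bounded)
    then have "(INF s\<in>{0..1}. h s \<mu> / \<bar>\<mu>\<bar>) \<le> h s \<mu> / \<bar>\<mu>\<bar>"
      using s by (intro cINF_lower)
    then have "R \<le> h s \<mu> / \<bar>\<mu>\<bar>" using b[of \<mu>] \<mu> by linarith
    then show ?thesis using \<mu> by (simp add: pos_le_divide_eq)
  qed
  then show ?thesis by (intro exI[of _ "max b 1"]) auto
qed

lemma bounded_on_strip:
  fixes h :: "real \<Rightarrow> real \<Rightarrow> real"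
  assumes cont: "continuous_on ({0..1} \<times> UNIV) (\<lambda>(s, \<mu>). h s \<mu>)"
  shows "\<exists>B. \<forall>s\<in>{0..1}. \<forall>\<mu>. \<bar>\<mu>\<bar> \<le> K \<longrightarrow> \<bar>h s \<mu>\<bar> \<le> B"
proof -
  have "compact ((\<lambda>(s, \<mu>). h s \<mu>) ` ({0..1} \<times> {- K..K}))"
    by (intro compact_continuous_image compact_Times continuous_on_subset[OF cont]) auto
  then obtain B where B: "\<forall>y\<in>(\<lambda>(s, \<mu>). h s \<mu>) ` ({0..1} \<times> {- K..K}). norm y \<le> B"
    using compact_imp_bounded bounded_iff by metis
  show ?thesis
  proof (intro exI[of _ B] ballI allI impI)
    fix s \<mu> :: real assume "s \<in> {0..1}" "\<bar>\<mu>\<bar> \<le> K"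
    then have "(s, \<mu>) \<in> {0..1} \<times> {- K..K}" by auto
    then show "\<bar>h s \<mu>\<bar> \<le> B" using B by fastforce
  qed
qed

text \<open>Beyond some K, h dominates R \<bar>\<mu>\<bar>, so the terms are not positive there; the
  remaining strip is compact. Bounding the single terms also provides the boundedness that the real
  supremum in \<open>arc_lagrangian\<close> requires.\<close>

lemma legendre_upper_bound:
  fixes h :: "real \<Rightarrow> real \<Rightarrow> real"
  assumes "continuous_on ({0..1} \<times> UNIV) (\<lambda>(s, \<mu>). h s \<mu>)"
    and "filterlim (\<lambda>\<mu>. INF s\<in>{0..1}. h s \<mu> / \<bar>\<mu>\<bar>) at_top at_infinity"
  shows "\<exists>M. \<forall>s\<in>{0..1}. \<forall>l \<mu>. \<bar>l\<bar> \<le> R \<longrightarrow> l * \<mu> - h s \<mu> \<le> M"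
proof -
  obtain K where K: "K > 0" "\<And>s \<mu>. s \<in> {0..1} \<Longrightarrow> \<bar>\<mu>\<bar> \<ge> K \<Longrightarrow> h s \<mu> \<ge> R * \<bar>\<mu>\<bar>"
    using superlinear_lower_bound[OF assms, of R] by blast
  obtain B where B: "\<And>s \<mu>. s \<in> {0..1} \<Longrightarrow> \<bar>\<mu>\<bar> \<le> K \<Longrightarrow> \<bar>h s \<mu>\<bar> \<le> B"
    using bounded_on_strip[OF assms(1), of K] by blast
  have "l * \<mu> - h s \<mu> \<le> \<bar>R\<bar> * K + \<bar>B\<bar>" if "s \<in> {0..1}" "\<bar>l\<bar> \<le> R" for s l \<mu>
  proof -
    have "l * \<mu> \<le> \<bar>l\<bar> * \<bar>\<mu>\<bar>" by (metis abs_ge_self abs_mult)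
    also have "\<dots> \<le> R * \<bar>\<mu>\<bar>" using that by (intro mult_right_mono) auto
    finally have 1: "l * \<mu> \<le> R * \<bar>\<mu>\<bar>" .
    show ?thesis
    proof (cases "\<bar>\<mu>\<bar> \<ge> K")
      case True
      have "0 \<le> \<bar>R\<bar> * K" using K(1) by simp
      then show ?thesis using K(2)[OF that(1) True] 1 by linarith
    next
      case False
      have "R * \<bar>\<mu>\<bar> \<le> \<bar>R\<bar> * K" using False by (intro mult_mono) auto
      moreover have "\<bar>h s \<mu>\<bar> \<le> B" using B that(1) False by simp
      ultimately show ?thesis using 1 by linarith
    qed
  qed
  then show ?thesis by blast
qed

text \<open>Turns constants for single arcs into one for all arcs. Where a small positive constant
  is wanted, it is written as 1 / M to make the property monotone in M.\<close>

lemma finite_uniform_bound: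
  fixes P :: "'b \<Rightarrow> real \<Rightarrow> bool"
  assumes "finite A" "\<And>x. x \<in> A \<Longrightarrow> \<exists>M. P x M"
    and mono: "\<And>x M M'. P x M \<Longrightarrow> M \<le> M' \<Longrightarrow> P x M'"
  shows "\<exists>M. \<forall>x\<in>A. P x M"
  using assms(1,2)
proof (induction A rule: finite_induct)
  case (insert x A)
  then obtain M M' where "\<forall>y\<in>A. P y M" "P x M'" by (metis insert_iff)
  then show ?case using mono by (intro exI[of _ "max M M'"]) (metis insert_iff max.cobounded1 max.cobounded2)
qed simp

section \<open>Uniform bounds over a network\<close>

locale network_hamiltonians =
  fixes E :: "(real \<Rightarrow> 'a::euclidean_space) set"
    and H :: "(real \<Rightarrow> 'a) \<Rightarrow> real \<Rightarrow> real \<Rightarrow> real"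
    and c :: "'a \<Rightarrow> real"
  assumes net: "network E" and ham: "hamiltonians E H"
begin

lemma finite_arcs: "finite (arcs E)"
  using net unfolding network_def arcs_def by auto

lemma finite_vertices: "finite (vertices E)"
  unfolding vertices_def using finite_arcs by auto

lemma arcsD:
  assumes "\<gamma> \<in> arcs E"
  shows "continuous_on {0..1} \<gamma>" "inj_on \<gamma> {0..1}"
    "s \<in> {0..1} \<Longrightarrow> (\<gamma> has_vector_derivative velocity \<gamma> s) (at s within {0..1})"
    "s \<in> {0..1} \<Longrightarrow> velocity \<gamma> s \<noteq> 0"
    "continuous_on {0..1} (velocity \<gamma>)"
proof -
  have *: "simple_path \<gamma>" "regular_C1 \<gamma>" "\<gamma> 0 \<noteq> \<gamma> 1"
    using net assms unfolding network_def by auto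
  then show "continuous_on {0..1} \<gamma>" unfolding simple_path_def path_def by simp
  show "inj_on \<gamma> {0..1}"
    using * unfolding simple_path_def loop_free_def inj_on_def by metis
  show "s \<in> {0..1} \<Longrightarrow> (\<gamma> has_vector_derivative velocity \<gamma> s) (at s within {0..1})"
    "s \<in> {0..1} \<Longrightarrow> velocity \<gamma> s \<noteq> 0" "continuous_on {0..1} (velocity \<gamma>)"
    using *(2) unfolding regular_C1_def by auto
qed

lemma reversepath_in_arcs: "\<gamma> \<in> arcs E \<Longrightarrow> reversepath \<gamma> \<in> arcs E"
  unfolding arcs_def by auto

lemma velocity_reversepath:
  assumes "\<gamma> \<in> arcs E" "s \<in> {0..1}"
  shows "velocity (reversepath \<gamma>) s = - velocity \<gamma> (1 - s)"
proof -
  have "((\<lambda>s. 1 - s) has_vector_derivative (-1)) (at s within {0..1::real})"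
    by (auto intro!: derivative_eq_intros)
  moreover have "(\<lambda>s. 1 - s) ` {0..1::real} = {0..1}"
    by (auto simp: image_iff intro!: bexI[of _ "1 - x" for x])
  ultimately have "((\<gamma> \<circ> (\<lambda>s. 1 - s)) has_vector_derivative ((-1) *\<^sub>R velocity \<gamma> (1 - s))) (at s within {0..1})"
    using assms arcsD(3)[OF assms(1), of "1 - s"] by (intro vector_diff_chain_within) auto
  then have "(reversepath \<gamma> has_vector_derivative (- velocity \<gamma> (1 - s))) (at s within {0..1})"
    by (simp add: reversepath_def comp_def)
  then show ?thesis unfolding velocity_def
    using assms(2) by (intro vector_derivative_within_closed_interval) auto
qed

lemma speed_bounds:
  obtains v V where "v > 0" "V > 0"
    "\<And>\<gamma> s. \<gamma> \<in> arcs E \<Longrightarrow> s \<in> {0..1} \<Longrightarrow> v \<le> norm (velocity \<gamma> s) \<and> norm (velocity \<gamma> s) \<le> V"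
proof -
  have "\<exists>M. \<forall>\<gamma>\<in>arcs E. M > 0 \<and> (\<forall>s\<in>{0..1}. 1 / M \<le> norm (velocity \<gamma> s) \<and> norm (velocity \<gamma> s) \<le> M)"
  proof (rule finite_uniform_bound[OF finite_arcs])
    fix \<gamma> assume \<gamma>: "\<gamma> \<in> arcs E"
    have cont: "continuous_on {0..1} (\<lambda>s. norm (velocity \<gamma> s))"
      using arcsD(5)[OF \<gamma>] by (intro continuous_intros)
    obtain s0 where s0: "s0 \<in> {0..1}" "\<forall>s\<in>{0..1}. norm (velocity \<gamma> s0) \<le> norm (velocity \<gamma> s)"
      using continuous_attains_inf[OF _ _ cont] by auto
    obtain s1 where s1: "s1 \<in> {0..1}" "\<forall>s\<in>{0..1}. norm (velocity \<gamma> s) \<le> norm (velocity \<gamma> s1)"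
      using continuous_attains_sup[OF _ _ cont] by auto
    have "norm (velocity \<gamma> s0) > 0" using arcsD(4)[OF \<gamma> s0(1)] by simp
    let ?M = "max (1 / norm (velocity \<gamma> s0)) (norm (velocity \<gamma> s1))"
    have "?M > 0" using \<open>norm (velocity \<gamma> s0) > 0\<close> by (simp add: less_max_iff_disj)
    moreover have "1 / ?M \<le> norm (velocity \<gamma> s0)"
    proof -
      have "1 / ?M \<le> 1 / (1 / norm (velocity \<gamma> s0))"
        using \<open>norm (velocity \<gamma> s0) > 0\<close> \<open>?M > 0\<close> by (intro divide_left_mono mult_pos_pos) auto
      then show ?thesis by simp
    qed
    ultimately have "?M > 0 \<and> (\<forall>s\<in>{0..1}. 1 / ?M \<le> norm (velocity \<gamma> s) \<and> norm (velocity \<gamma> s) \<le> ?M)"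
      using s0(2) s1(2) by (meson max.coboundedI2 order_trans)
    then show "\<exists>M>0. \<forall>s\<in>{0..1}. 1 / M \<le> norm (velocity \<gamma> s) \<and> norm (velocity \<gamma> s) \<le> M" by blast
  next
    fix \<gamma> M M'
    assume *: "M > 0 \<and> (\<forall>s\<in>{0..1}. 1 / M \<le> norm (velocity \<gamma> s) \<and> norm (velocity \<gamma> s) \<le> M)" "M \<le> M'"
    then have "1 / M' \<le> 1 / M" by (intro divide_left_mono) auto
    then show "M' > 0 \<and> (\<forall>s\<in>{0..1}. 1 / M' \<le> norm (velocity \<gamma> s) \<and> norm (velocity \<gamma> s) \<le> M')"
      using * by force
  qed
  then obtain M where M: "\<forall>\<gamma>\<in>arcs E. M > 0 \<and> (\<forall>s\<in>{0..1}. 1 / M \<le> norm (velocity \<gamma> s) \<and> norm (velocity \<gamma> s) \<le> M)"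
    by blast
  show ?thesis
  proof (cases "arcs E = {}")
    case True
    then show ?thesis using that[of 1 1] by auto
  next
    case False
    then have "M > 0" using M by blast
    then show ?thesis using M by (intro that[of "1 / M" M]) auto
  qed
qed

lemma arc_lagrangian_le:
  obtains M where "\<And>\<gamma> s l. \<lbrakk>\<gamma> \<in> arcs E; s \<in> {0..1}; \<bar>l\<bar> \<le> R\<rbrakk> \<Longrightarrow> arc_lagrangian H \<gamma> s l \<le> M"
proof -
  have "\<exists>M. \<forall>\<gamma>\<in>arcs E. \<forall>s\<in>{0..1}. \<forall>l \<mu>. \<bar>l\<bar> \<le> R \<longrightarrow> l * \<mu> - H \<gamma> s \<mu> \<le> M"
  proof (rule finite_uniform_bound[OF finite_arcs])
    fix \<gamma> assume "\<gamma> \<in> arcs E"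
    then show "\<exists>M. \<forall>s\<in>{0..1}. \<forall>l \<mu>. \<bar>l\<bar> \<le> R \<longrightarrow> l * \<mu> - H \<gamma> s \<mu> \<le> M"
      using ham unfolding hamiltonians_def by (intro legendre_upper_bound) auto
  qed (meson order_trans)
  then obtain M where "\<forall>\<gamma>\<in>arcs E. \<forall>s\<in>{0..1}. \<forall>l \<mu>. \<bar>l\<bar> \<le> R \<longrightarrow> l * \<mu> - H \<gamma> s \<mu> \<le> M" by blast
  then show ?thesis
    by (intro that[of M]) (auto simp: arc_lagrangian_def intro!: cSUP_least)
qed

text \<open>The supremum is tested with R times the sign of l, which gives slope R for arbitrary R;
  the error is a bound of H on the compact strip where \<bar>\<mu>\<bar> is at most R.\<close>

lemma arc_lagrangian_ge:
  assumes "R \<ge> 0"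
  obtains B where "\<And>\<gamma> s l. \<lbrakk>\<gamma> \<in> arcs E; s \<in> {0..1}\<rbrakk> \<Longrightarrow> R * \<bar>l\<bar> - B \<le> arc_lagrangian H \<gamma> s l"
proof -
  have "\<exists>B. \<forall>\<gamma>\<in>arcs E. \<forall>s\<in>{0..1}. \<forall>\<mu>. \<bar>\<mu>\<bar> \<le> R \<longrightarrow> \<bar>H \<gamma> s \<mu>\<bar> \<le> B"
  proof (rule finite_uniform_bound[OF finite_arcs])
    fix \<gamma> assume "\<gamma> \<in> arcs E"
    then show "\<exists>B. \<forall>s\<in>{0..1}. \<forall>\<mu>. \<bar>\<mu>\<bar> \<le> R \<longrightarrow> \<bar>H \<gamma> s \<mu>\<bar> \<le> B"
      using ham unfolding hamiltonians_def by (intro bounded_on_strip) auto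
  qed (meson order_trans)
  then obtain B where B: "\<forall>\<gamma>\<in>arcs E. \<forall>s\<in>{0..1}. \<forall>\<mu>. \<bar>\<mu>\<bar> \<le> R \<longrightarrow> \<bar>H \<gamma> s \<mu>\<bar> \<le> B" by blast
  show ?thesis
  proof (rule that[of B])
    fix \<gamma> s l assume \<gamma>: "\<gamma> \<in> arcs E" and s: "s \<in> {0..1::real}"
    obtain M where "\<And>l' \<mu>. \<bar>l'\<bar> \<le> \<bar>l\<bar> \<Longrightarrow> l' * \<mu> - H \<gamma> s \<mu> \<le> M"
      using legendre_upper_bound[of "H \<gamma>" "\<bar>l\<bar>"] ham \<gamma> s unfolding hamiltonians_def by blast
    then have "bdd_above (range (\<lambda>\<mu>. l * \<mu> - H \<gamma> s \<mu>))" by (intro bdd_aboveI[of _ M]) auto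
    then have "l * (R * sgn l) - H \<gamma> s (R * sgn l) \<le> arc_lagrangian H \<gamma> s l"
      unfolding arc_lagrangian_def
      using cSUP_upper[of "R * sgn l" UNIV "\<lambda>\<mu>. l * \<mu> - H \<gamma> s \<mu>"] by simp
    moreover have "l * (R * sgn l) = R * \<bar>l\<bar>" by (simp add: abs_sgn mult_ac)
    moreover have "\<bar>R * sgn l\<bar> \<le> R" using assms by (simp add: abs_mult sgn_if)
    then have "\<bar>H \<gamma> s (R * sgn l)\<bar> \<le> B" using B \<gamma> s by blast
    ultimately show "R * \<bar>l\<bar> - B \<le> arc_lagrangian H \<gamma> s l" by linarith
  qed
qed

lemma carrier_arcs: "carrier E = (\<Union>\<gamma>\<in>arcs E. \<gamma> ` {0..1})"
proof -
  have "reversepath \<gamma> ` {0..1} = \<gamma> ` {0..1}" for \<gamma> :: "real \<Rightarrow> 'a"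
    using path_image_reversepath[of \<gamma>] unfolding path_image_def .
  then show ?thesis unfolding carrier_def arcs_def by auto
qed

lemma compact_carrier: "compact (carrier E)"
  unfolding carrier_arcs
  using finite_arcs by (intro compact_UN) (auto intro!: compact_continuous_image arcsD(1))

text \<open>No arc meets the interior of another, apart from an arc and its inverse. This makes the
  arc chosen by \<open>SOME\<close> in \<open>lagrangian\<close> compatible with the arc along which
  a tangent vector is given.\<close>

lemma arc_interior_unique:
  assumes \<gamma>: "\<gamma> \<in> arcs E" "\<gamma>' \<in> arcs E" and s: "s \<in> {0<..<1}" "s' \<in> {0..1}" and eq: "\<gamma> s = \<gamma>' s'"
  shows "\<gamma>' = \<gamma> \<and> s' = s \<or> \<gamma>' = reversepath \<gamma> \<and> s' = 1 - s"
proof -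
  have "\<not> (\<gamma> \<noteq> \<gamma>' \<and> \<gamma> \<noteq> reversepath \<gamma>')"
  proof
    assume "\<gamma> \<noteq> \<gamma>' \<and> \<gamma> \<noteq> reversepath \<gamma>'"
    then have "\<gamma> ` {0<..<1} \<inter> \<gamma>' ` {0..1} = {}" using net \<gamma> unfolding network_def by blast
    then show False using s eq by (metis disjoint_iff imageI)
  qed
  then consider "\<gamma>' = \<gamma>" | "\<gamma>' = reversepath \<gamma>" by fastforce
  then show ?thesis
  proof cases
    case 1
    then show ?thesis using inj_onD[OF arcsD(2)[OF \<gamma>(1)], of s s'] s eq by auto
  next
    case 2
    then have "\<gamma> s = \<gamma> (1 - s')" using eq by (simp add: reversepath_def)
    then show ?thesis using 2 inj_onD[OF arcsD(2)[OF \<gamma>(1)], of s "1 - s'"] s by auto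
  qed
qed

lemma inner_velocity_quotient:
  assumes "\<gamma> \<in> arcs E" "s \<in> {0..1}"
  shows "((l *\<^sub>R velocity \<gamma> s) \<bullet> velocity \<gamma> s) / (norm (velocity \<gamma> s))\<^sup>2 = l"
  using arcsD(4)[OF assms] by (simp add: dot_square_norm)

text \<open>Reduces estimates for L to single arcs: the minimum at a vertex runs over a finite
  nonempty set and so equals one of its terms.\<close>

lemma lagrangian_cases:
  assumes TB: "(x, q) \<in> tangent_bundle E"
  obtains \<gamma> s l where "\<gamma> \<in> arcs E" "s \<in> {0..1}" "q = l *\<^sub>R velocity \<gamma> s"
      "lagrangian E H c x q = ereal (arc_lagrangian H \<gamma> s l)"
  | "x \<in> vertices E" "q = 0" "lagrangian E H c x q = ereal (c x)"
proof -
  obtain \<gamma> s l where g: "\<gamma> \<in> arcs E" "s \<in> {0..1}" "x = \<gamma> s" "q = l *\<^sub>R velocity \<gamma> s"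
    using TB unfolding tangent_bundle_def mem_Collect_eq prod.case by blast
  consider (int) "\<exists>\<gamma>\<in>arcs E. x \<in> \<gamma> ` {0<..<1}"
    | (vert) "\<not> (\<exists>\<gamma>\<in>arcs E. x \<in> \<gamma> ` {0<..<1})" "q \<noteq> 0"
    | (zero) "\<not> (\<exists>\<gamma>\<in>arcs E. x \<in> \<gamma> ` {0<..<1})" "q = 0" by blast
  then show ?thesis
  proof cases
    case int
    define \<gamma>' where "\<gamma>' = (SOME \<gamma>. \<gamma> \<in> arcs E \<and> x \<in> \<gamma> ` {0<..<1})"
    have \<gamma>': "\<gamma>' \<in> arcs E" "x \<in> \<gamma>' ` {0<..<1}"
      using someI_ex[of "\<lambda>\<gamma>. \<gamma> \<in> arcs E \<and> x \<in> \<gamma> ` {0<..<1}"] int unfolding \<gamma>'_def by auto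
    obtain s' where s': "s' \<in> {0<..<1}" "x = \<gamma>' s'" using \<gamma>'(2) by blast
    have s'01: "s' \<in> {0..1}" using s' by auto
    have inv: "the_inv_into {0..1} \<gamma>' x = s'"
      using the_inv_into_f_f[OF arcsD(2)[OF \<gamma>'(1)] s'01] s'(2) by simp
    \<comment> \<open>The tangent vector may be given along the inverse of the chosen arc; its
      factor then changes sign.\<close>
    have "\<exists>l'. q = l' *\<^sub>R velocity \<gamma>' s'"
      using arc_interior_unique[OF \<gamma>'(1) g(1) s'(1) g(2)] s'(2) g(3)
    proof (elim meta_impE disjE conjE)
      assume "\<gamma> = \<gamma>'" "s = s'"
      then show ?thesis using g(4) by blast
    next
      assume *: "\<gamma> = reversepath \<gamma>'" "s = 1 - s'"
      then have "q = (- l) *\<^sub>R velocity \<gamma>' s'"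
        using g(2,4) velocity_reversepath[OF \<gamma>'(1), of s] by simp
      then show ?thesis by blast
    qed simp
    then obtain l' where l': "q = l' *\<^sub>R velocity \<gamma>' s'" by blast
    have "lagrangian E H c x q = ereal (arc_lagrangian H \<gamma>' s' l')"
      unfolding lagrangian_def Let_def \<gamma>'_def[symmetric] inv
      using TB int inner_velocity_quotient[OF \<gamma>'(1) s'01, of l'] l' by simp
    then show ?thesis using that(1)[OF \<gamma>'(1) s'01 l'] by blast
  next
    case vert
    define S where "S = {\<gamma> \<in> arcs_into E x. \<exists>l. q = l *\<^sub>R velocity \<gamma> 1}"
    define f where "f = (\<lambda>\<gamma>. arc_lagrangian H \<gamma> 1 ((q \<bullet> velocity \<gamma> 1) / (norm (velocity \<gamma> 1))\<^sup>2))"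
    have "s = 0 \<or> s = 1" using vert g(1,2,3) by fastforce
    then have "S \<noteq> {}"
    proof
      assume "s = 1"
      then have "\<gamma> \<in> S" using g unfolding S_def arcs_into_def by auto
      then show ?thesis by blast
    next
      \<comment> \<open>\<open>lagrangian\<close> looks at arcs that end in x, so an arc that starts
        there is replaced by its inverse.\<close>
      assume "s = 0"
      have "velocity (reversepath \<gamma>) 1 = - velocity \<gamma> 0" using velocity_reversepath[OF g(1), of 1] by simp
      then have "q = (- l) *\<^sub>R velocity (reversepath \<gamma>) 1" using g(4) \<open>s = 0\<close> by simp
      moreover have "reversepath \<gamma> 1 = x" using g(3) \<open>s = 0\<close> by (simp add: reversepath_def)
      ultimately have "reversepath \<gamma> \<in> S"
        using reversepath_in_arcs[OF g(1)] unfolding S_def arcs_into_def by blast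
      then show ?thesis by blast
    qed
    moreover have "finite S" unfolding S_def arcs_into_def using finite_arcs by auto
    ultimately have "Min (f ` S) \<in> f ` S" by (intro Min_in) auto
    then obtain \<gamma>' where \<gamma>': "\<gamma>' \<in> S" "Min (f ` S) = f \<gamma>'" by auto
    then obtain l' where l': "\<gamma>' \<in> arcs E" "q = l' *\<^sub>R velocity \<gamma>' 1" unfolding S_def arcs_into_def by auto
    have "lagrangian E H c x q = ereal (Min (f ` S))"
      unfolding lagrangian_def f_def S_def using TB vert by simp
    also have "\<dots> = ereal (arc_lagrangian H \<gamma>' 1 l')"
      using inner_velocity_quotient[OF l'(1), of 1 l'] l'(2) unfolding \<gamma>'(2) by (simp add: f_def)
    finally show ?thesis using that(1)[OF l'(1) _ l'(2)] by simp
  next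
    case zero
    have "s = 0 \<or> s = 1" using zero g(1,2,3) by fastforce
    then have "x \<in> vertices E"
      using g(1,3) unfolding vertices_def pathstart_def pathfinish_def by auto
    moreover have "lagrangian E H c x q = ereal (c x)"
      unfolding lagrangian_def using TB zero by simp
    ultimately show ?thesis using that(2) zero by blast
  qed
qed

lemma lagrangian_superlinear:
  assumes "K \<ge> 0"
  obtains C where "C \<ge> 0" "\<And>x q. ereal (K * norm q - C) \<le> lagrangian E H c x q"
proof -
  obtain v V where V: "V > 0"
    "\<And>\<gamma> s. \<gamma> \<in> arcs E \<Longrightarrow> s \<in> {0..1} \<Longrightarrow> v \<le> norm (velocity \<gamma> s) \<and> norm (velocity \<gamma> s) \<le> V"
    using speed_bounds by metis
  \<comment> \<open>As norm q is at most V \<bar>l\<bar>, slope K V in l gives slope K in q.\<close>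
  obtain B where B: "\<And>\<gamma> s l. \<lbrakk>\<gamma> \<in> arcs E; s \<in> {0..1}\<rbrakk> \<Longrightarrow> K * V * \<bar>l\<bar> - B \<le> arc_lagrangian H \<gamma> s l"
    using arc_lagrangian_ge[of "K * V"] assms V(1) by auto
  define C where "C = \<bar>B\<bar> + (\<Sum>x\<in>vertices E. \<bar>c x\<bar>)"
  have cC: "\<bar>c x\<bar> \<le> (\<Sum>x\<in>vertices E. \<bar>c x\<bar>)" if "x \<in> vertices E" for x
    using member_le_sum[OF that, of "\<lambda>x. \<bar>c x\<bar>"] finite_vertices by auto
  have sum0: "0 \<le> (\<Sum>x\<in>vertices E. \<bar>c x\<bar>)" by (rule sum_nonneg) simp
  show ?thesis
  proof (rule that[of C])
    show "C \<ge> 0" unfolding C_def using sum0 by simp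
    fix x q
    show "ereal (K * norm q - C) \<le> lagrangian E H c x q"
    proof (cases "(x, q) \<in> tangent_bundle E")
      case True
      then show ?thesis
      proof (cases rule: lagrangian_cases)
        case (1 \<gamma> s l)
        have "norm q = \<bar>l\<bar> * norm (velocity \<gamma> s)" using 1(3) by simp
        also have "\<dots> \<le> \<bar>l\<bar> * V" using V(2)[OF 1(1,2)] by (intro mult_left_mono) auto
        finally have "K * norm q \<le> K * (\<bar>l\<bar> * V)" using assms by (rule mult_left_mono)
        also have "\<dots> = K * V * \<bar>l\<bar>" by simp
        finally have "K * norm q - C \<le> K * V * \<bar>l\<bar> - B" unfolding C_def using sum0 by linarith
        also have "\<dots> \<le> arc_lagrangian H \<gamma> s l" using B 1 by blast
        finally show ?thesis using 1(4) by simp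
      next
        case 2
        then show ?thesis using cC[OF 2(1)] unfolding C_def by simp
      qed
    qed (simp add: lagrangian_def)
  qed
qed

lemma lagrangian_bounded:
  obtains M where "M \<ge> 0"
    "\<And>x q. \<lbrakk>(x, q) \<in> tangent_bundle E; norm q \<le> R\<rbrakk> \<Longrightarrow> lagrangian E H c x q \<le> ereal M"
proof -
  obtain v V where V: "v > 0"
    "\<And>\<gamma> s. \<gamma> \<in> arcs E \<Longrightarrow> s \<in> {0..1} \<Longrightarrow> v \<le> norm (velocity \<gamma> s) \<and> norm (velocity \<gamma> s) \<le> V"
    using speed_bounds by metis
  \<comment> \<open>Speeds are at least v, so a vector of length at most R has a factor l of size at
    most R / v.\<close>
  obtain M where M: "\<And>\<gamma> s l. \<lbrakk>\<gamma> \<in> arcs E; s \<in> {0..1}; \<bar>l\<bar> \<le> R / v\<rbrakk> \<Longrightarrow> arc_lagrangian H \<gamma> s l \<le> M"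
    using arc_lagrangian_le[of "R / v"] by metis
  define M' where "M' = \<bar>M\<bar> + (\<Sum>x\<in>vertices E. \<bar>c x\<bar>)"
  have cC: "\<bar>c x\<bar> \<le> (\<Sum>x\<in>vertices E. \<bar>c x\<bar>)" if "x \<in> vertices E" for x
    using member_le_sum[OF that, of "\<lambda>x. \<bar>c x\<bar>"] finite_vertices by auto
  have sum0: "0 \<le> (\<Sum>x\<in>vertices E. \<bar>c x\<bar>)" by (rule sum_nonneg) simp
  show ?thesis
  proof (rule that[of M'])
    show "M' \<ge> 0" unfolding M'_def using sum0 by simp
    fix x q assume TB: "(x, q) \<in> tangent_bundle E" and q: "norm q \<le> R"
    from TB show "lagrangian E H c x q \<le> ereal M'"
    proof (cases rule: lagrangian_cases)
      case (1 \<gamma> s l)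
      have "\<bar>l\<bar> * v \<le> \<bar>l\<bar> * norm (velocity \<gamma> s)" using V(2)[OF 1(1,2)] by (intro mult_left_mono) auto
      also have "\<dots> \<le> R" using 1(3) q by simp
      finally have "\<bar>l\<bar> \<le> R / v" using V(1) by (simp add: pos_le_divide_eq)
      then have "arc_lagrangian H \<gamma> s l \<le> M'" using M[OF 1(1,2), of l] sum0 unfolding M'_def by linarith
      then show ?thesis using 1(4) by simp
    next
      case 2
      then show ?thesis using cC[OF 2(1)] unfolding M'_def by simp
    qed
  qed
qed

lemma arc_lipschitz:
  obtains V where "V > 0" "\<And>\<gamma> s. \<gamma> \<in> arcs E \<Longrightarrow> s \<in> {0..1} \<Longrightarrow> norm (velocity \<gamma> s) \<le> V"
    "\<And>\<gamma> s s'. \<lbrakk>\<gamma> \<in> arcs E; s \<in> {0..1}; s' \<in> {0..1}\<rbrakk> \<Longrightarrow> dist (\<gamma> s) (\<gamma> s') \<le> V * \<bar>s - s'\<bar>"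
proof -
  obtain v V where V: "V > 0"
    "\<And>\<gamma> s. \<gamma> \<in> arcs E \<Longrightarrow> s \<in> {0..1} \<Longrightarrow> v \<le> norm (velocity \<gamma> s) \<and> norm (velocity \<gamma> s) \<le> V"
    using speed_bounds by metis
  have "dist (\<gamma> s) (\<gamma> s') \<le> V * \<bar>s - s'\<bar>" if *: "\<gamma> \<in> arcs E" "s \<in> {0..1}" "s' \<in> {0..1}" for \<gamma> s s'
  proof -
    have "norm (\<gamma> s - \<gamma> s') \<le> V * norm (s - s')"
    proof (rule differentiable_bound)
      show "(\<gamma> has_derivative (\<lambda>h. h *\<^sub>R velocity \<gamma> x)) (at x within {0..1})" if "x \<in> {0..1}" for x
        using arcsD(3)[OF *(1) that] unfolding has_vector_derivative_def .
      show "onorm (\<lambda>h. h *\<^sub>R velocity \<gamma> x) \<le> V" if "x \<in> {0..1}" for x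
      proof (rule onorm_le)
        fix h :: real
        have "norm (h *\<^sub>R velocity \<gamma> x) = norm (velocity \<gamma> x) * norm h" by simp
        also have "\<dots> \<le> V * norm h" using V(2)[OF *(1) that] by (intro mult_right_mono) auto
        finally show "norm (h *\<^sub>R velocity \<gamma> x) \<le> V * norm h" .
      qed
    qed (use * in auto)
    then show ?thesis by (simp add: dist_norm)
  qed
  then show ?thesis using that V by blast
qed

text \<open>By compactness, the points of an arc whose parameters are at least h away from every
  parameter of x keep a positive distance from x. A nearby y thus lies on an arc through x, at a
  nearby parameter. The radius depends on x, which suffices for continuity at x.\<close>

lemma short_arc_segment:
  assumes "x \<in> carrier E" "h > 0"
  obtains \<delta> where "\<delta> > 0" "\<And>y. \<lbrakk>y \<in> carrier E; dist x y < \<delta>\<rbrakk>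
    \<Longrightarrow> \<exists>\<gamma>\<in>arcs E. \<exists>s\<in>{0..1}. \<exists>s'\<in>{0..1}. \<gamma> s = x \<and> \<gamma> s' = y \<and> \<bar>s - s'\<bar> \<le> h"
proof -
  have "\<exists>M>0. \<forall>\<gamma>\<in>arcs E. \<forall>s'\<in>{0..1}. dist x (\<gamma> s') < 1 / M \<longrightarrow> (\<exists>s\<in>{0..1}. \<gamma> s = x \<and> \<bar>s - s'\<bar> \<le> h)"
  proof -
    have "\<exists>M. \<forall>\<gamma>\<in>arcs E. M > 0 \<and> (\<forall>s'\<in>{0..1}. dist x (\<gamma> s') < 1 / M \<longrightarrow> (\<exists>s\<in>{0..1}. \<gamma> s = x \<and> \<bar>s - s'\<bar> \<le> h))"
    proof (rule finite_uniform_bound[OF finite_arcs])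
      fix \<gamma> assume \<gamma>: "\<gamma> \<in> arcs E"
      \<comment> \<open>If the arc misses x, the intersection is over the empty family and K is the
        whole parameter interval.\<close>
      define K where "K = {0..1} \<inter> (\<Inter>s\<in>{s \<in> {0..1}. \<gamma> s = x}. {s'. h \<le> \<bar>s - s'\<bar>})"
      have "closed {s'. h \<le> \<bar>s - s'\<bar>}" for s :: real
        by (intro closed_Collect_le continuous_intros)
      then have "compact K" unfolding K_def by (intro compact_Int_closed closed_INT) auto
      then have "compact (\<gamma> ` K)"
        by (intro compact_continuous_image continuous_on_subset[OF arcsD(1)[OF \<gamma>]]) (auto simp: K_def)
      moreover have "x \<notin> \<gamma> ` K" unfolding K_def using \<open>h > 0\<close> by force
      ultimately obtain d where d: "d > 0" "\<forall>y\<in>\<gamma> ` K. d \<le> dist x y"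
        using separate_point_closed[OF compact_imp_closed] by blast
      have "\<exists>s\<in>{0..1}. \<gamma> s = x \<and> \<bar>s - s'\<bar> \<le> h" if s': "s' \<in> {0..1}" "dist x (\<gamma> s') < 1 / (1 / d)" for s'
      proof (rule ccontr)
        assume "\<not> ?thesis"
        then have "s' \<in> K" using s'(1) unfolding K_def by force
        then show False using d(2) s'(2) by force
      qed
      then show "\<exists>M>0. \<forall>s'\<in>{0..1}. dist x (\<gamma> s') < 1 / M \<longrightarrow> (\<exists>s\<in>{0..1}. \<gamma> s = x \<and> \<bar>s - s'\<bar> \<le> h)"
        using d(1) by (intro exI[of _ "1 / d"]) auto
    next
      fix \<gamma> M M'
      assume *: "M > 0 \<and> (\<forall>s'\<in>{0..1}. dist x (\<gamma> s') < 1 / M \<longrightarrow> (\<exists>s\<in>{0..1}. \<gamma> s = x \<and> \<bar>s - s'\<bar> \<le> h))" "M \<le> M'"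
      then have "1 / M' \<le> 1 / M" by (intro divide_left_mono) auto
      then show "M' > 0 \<and> (\<forall>s'\<in>{0..1}. dist x (\<gamma> s') < 1 / M' \<longrightarrow> (\<exists>s\<in>{0..1}. \<gamma> s = x \<and> \<bar>s - s'\<bar> \<le> h))"
        using * by force
    qed
    moreover have "arcs E \<noteq> {}" using assms(1) unfolding carrier_arcs by blast
    ultimately show ?thesis by blast
  qed
  then obtain M where M: "M > 0" "\<And>\<gamma> s'. \<lbrakk>\<gamma> \<in> arcs E; s' \<in> {0..1}; dist x (\<gamma> s') < 1 / M\<rbrakk>
      \<Longrightarrow> \<exists>s\<in>{0..1}. \<gamma> s = x \<and> \<bar>s - s'\<bar> \<le> h" by blast
  show ?thesis
  proof (rule that[of "1 / M"])
    fix y assume "y \<in> carrier E" "dist x y < 1 / M"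
    then obtain \<gamma> s' where g: "\<gamma> \<in> arcs E" "s' \<in> {0..1}" "y = \<gamma> s'" unfolding carrier_arcs by blast
    then show "\<exists>\<gamma>\<in>arcs E. \<exists>s\<in>{0..1}. \<exists>s'\<in>{0..1}. \<gamma> s = x \<and> \<gamma> s' = y \<and> \<bar>s - s'\<bar> \<le> h"
      using M(2)[OF g(1,2)] \<open>dist x y < 1 / M\<close> by blast
  qed (use M in simp)
qed

end

section \<open>The value function\<close>

text \<open>True also where no derivative exists: the two functions have the same derivatives at x,
  so the choice operator in \<open>vector_derivative\<close> returns the same vector.\<close>

lemma vector_derivative_cong_open:
  assumes "open S" "x \<in> S" "\<And>y. y \<in> S \<Longrightarrow> f y = g y"
  shows "vector_derivative f (at x) = vector_derivative g (at x)"
proof -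
  have "(f has_vector_derivative d) (at x) \<longleftrightarrow> (g has_vector_derivative d) (at x)" for d
    using has_vector_derivative_transform_within_open[of f d x S g]
      has_vector_derivative_transform_within_open[of g d x S f] assms by auto
  then show ?thesis unfolding vector_derivative_def by simp
qed

lemma vector_derivative_shift:
  "vector_derivative (\<lambda>\<tau>. f (\<tau> + h)) (at x) = vector_derivative f (at (x + h))"
proof -
  have *: "((\<lambda>\<tau>. f (\<tau> + h)) has_vector_derivative d) (at x)"
    if "(f has_vector_derivative d) (at (x + h))" for f :: "real \<Rightarrow> 'a" and d x h
  proof -
    have "((\<lambda>\<tau>. \<tau> + h) has_vector_derivative 1) (at x)"
      by (auto intro!: derivative_eq_intros)
    then have "((f \<circ> (\<lambda>\<tau>. \<tau> + h)) has_vector_derivative 1 *\<^sub>R d) (at x)"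
      using that by (rule vector_diff_chain_at)
    then show ?thesis by (simp add: comp_def)
  qed
  have "((\<lambda>\<tau>. f (\<tau> + h)) has_vector_derivative d) (at x) \<longleftrightarrow> (f has_vector_derivative d) (at (x + h))" for d
    using *[of f d x h] *[of "\<lambda>\<tau>. f (\<tau> + h)" d "x + h" "- h"] by auto
  then show ?thesis unfolding vector_derivative_def by simp
qed

lemma AE_lebesgue_on_interior:
  fixes a b :: real
  shows "AE x in lebesgue_on {a..b}. a < x \<and> x < b"
proof -
  have "AE x in lebesgue. x \<notin> {a, b}"
    by (rule AE_not_in) (metis negligible_iff_null_sets negligible_finite finite.emptyI finite_insert)
  then show ?thesis
    by (subst AE_restrict_space_iff, simp, elim eventually_mono) auto
qed

context network_hamiltonians
begin

lemma arc_in_carrier: "\<gamma> \<in> arcs E \<Longrightarrow> s \<in> {0..1} \<Longrightarrow> \<gamma> s \<in> carrier E"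
  unfolding carrier_arcs by blast

text \<open>The two-sided derivative does not refer to the time interval of the curve, so the costs
  of cut, translated and concatenated curves can be compared at each interior time.\<close>

definition running_cost :: "(real \<Rightarrow> 'a) \<Rightarrow> real \<Rightarrow> ereal" where
  "running_cost \<xi> \<tau> = lagrangian E H c (\<xi> \<tau>) (vector_derivative \<xi> (at \<tau>))"

lemma action_eq_integral_running_cost:
  "action E H c t \<xi> = ereal_integral (lebesgue_on {0..t}) (running_cost \<xi>)"
  unfolding action_def
proof (rule ereal_integral_cong_AE)
  show "AE \<tau> in lebesgue_on {0..t}.
      lagrangian E H c (\<xi> \<tau>) (vector_derivative \<xi> (at \<tau> within {0..t})) = running_cost \<xi> \<tau>"
    using AE_lebesgue_on_interior[of 0 t]
    by eventually_elim (simp add: running_cost_def at_within_Icc_at)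
qed

lemma running_cost_lower_bound:
  obtains C where "C \<ge> 0" "\<And>\<xi> \<tau>. - ereal C \<le> running_cost \<xi> \<tau>"
proof -
  obtain C where "C \<ge> 0" "\<And>x q. ereal (0 * norm q - C) \<le> lagrangian E H c x q"
    using lagrangian_superlinear[of 0] by auto
  then show ?thesis by (intro that[of C]) (auto simp: running_cost_def)
qed

section \<open>Prolonging a curve by an arc segment\<close>

text \<open>The parameter runs affinely from s to s' during the time h. Its speed is at most 1
  because \<bar>s - s'\<bar> is at most h, so V bounds the speed of the curve.\<close>

lemma segment_curve:
  assumes \<gamma>: "\<gamma> \<in> arcs E" and s: "s \<in> {0..1}" "s' \<in> {0..1}" and h: "h > 0" "\<bar>s - s'\<bar> \<le> h"
    and V: "\<And>s. s \<in> {0..1} \<Longrightarrow> norm (velocity \<gamma> s) \<le> V"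
    and lip: "\<And>s s'. \<lbrakk>s \<in> {0..1}; s' \<in> {0..1}\<rbrakk> \<Longrightarrow> dist (\<gamma> s) (\<gamma> s') \<le> V * \<bar>s - s'\<bar>"
  obtains \<zeta> where "absolutely_continuous_curve t (t + h) \<zeta>" "\<zeta> ` {t..t + h} \<subseteq> carrier E"
    "\<zeta> t = \<gamma> s" "\<zeta> (t + h) = \<gamma> s'"
    "\<And>\<tau>. \<lbrakk>t < \<tau>; \<tau> < t + h\<rbrakk> \<Longrightarrow> (\<zeta> \<tau>, vector_derivative \<zeta> (at \<tau>)) \<in> tangent_bundle E
      \<and> norm (vector_derivative \<zeta> (at \<tau>)) \<le> V"
proof -
  define p where "p = (\<lambda>\<tau>. s + (s' - s) * ((\<tau> - t) / h))"
  define \<zeta> where "\<zeta> = (\<lambda>\<tau>. \<gamma> (p \<tau>))"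
  have p_conv: "p \<tau> = (1 - (\<tau> - t) / h) * s + (\<tau> - t) / h * s'" for \<tau>
  proof -
    have "s + (s' - s) * w = (1 - w) * s + w * s'" for w by (simp add: algebra_simps)
    then show ?thesis unfolding p_def .
  qed
  have p01: "p \<tau> \<in> {0..1}" if "\<tau> \<in> {t..t + h}" for \<tau>
    unfolding p_conv
    using convexD_alt[OF convex_real_interval(5), of s 0 1 s' "(\<tau> - t) / h"] s that h by (simp add: field_simps)
  have V0: "V \<ge> 0" using V[OF s(1)] norm_ge_zero order_trans by blast
  have "absolutely_continuous_curve t (t + h) \<zeta>"
  proof (rule AC_lipschitz)
    fix r u assume ru: "t \<le> r" "r \<le> u" "u \<le> t + h"
    have "dist (\<zeta> r) (\<zeta> u) \<le> V * \<bar>p r - p u\<bar>"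
      unfolding \<zeta>_def using ru by (intro lip p01) auto
    also have "\<bar>p r - p u\<bar> = (\<bar>s - s'\<bar> / h) * (u - r)"
    proof -
      have "p r - p u = ((s - s') / h) * (u - r)"
        unfolding p_def using h by (simp add: field_simps)
      then show ?thesis using h ru by (simp add: abs_mult)
    qed
    also have "V * \<dots> \<le> V * (1 * (u - r))"
      using V0 h ru by (intro mult_left_mono mult_right_mono) auto
    finally show "dist (\<zeta> r) (\<zeta> u) \<le> V * (u - r)" by simp
  qed
  moreover have "\<zeta> ` {t..t + h} \<subseteq> carrier E"
    unfolding \<zeta>_def carrier_arcs using p01 \<gamma> by blast
  moreover have "\<zeta> t = \<gamma> s" "\<zeta> (t + h) = \<gamma> s'" unfolding \<zeta>_def p_def using h by auto
  moreover have "(\<zeta> \<tau>, vector_derivative \<zeta> (at \<tau>)) \<in> tangent_bundle E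
      \<and> norm (vector_derivative \<zeta> (at \<tau>)) \<le> V" if \<tau>: "t < \<tau>" "\<tau> < t + h" for \<tau>
  proof -
    have "(\<zeta> has_vector_derivative ((s' - s) / h) *\<^sub>R velocity \<gamma> (p \<tau>)) (at \<tau>)"
    \<comment> \<open>For s = s' the parameter may rest at 0 or 1, where an arc has only a one-sided
      derivative, but the curve is then constant. Otherwise the parameter is strictly between 0 and
      1.\<close>
    proof (cases "s = s'")
      case True
      then have "\<zeta> = (\<lambda>\<tau>. \<gamma> s)" unfolding \<zeta>_def p_def by auto
      then show ?thesis using True by simp
    next
      case False
      define w where "w = (\<tau> - t) / h"
      have w: "0 < w" "w < 1" unfolding w_def using \<tau> h by (auto simp: field_simps)
      have "0 < p \<tau> \<and> p \<tau> < 1"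
      proof (cases "s < s'")
        case True
        have "0 < (s' - s) * w" "(s' - s) * w < (s' - s) * 1"
          using True w by (auto intro: mult_strict_left_mono)
        then show ?thesis using s unfolding p_def w_def[symmetric] by auto
      next
        case nlt: False
        have "0 < (s - s') * w" "(s - s') * w < (s - s') * 1"
          using False nlt w by (auto intro: mult_strict_left_mono)
        then show ?thesis using s unfolding p_def w_def[symmetric] by (auto simp: algebra_simps)
      qed
      then have "(\<gamma> has_vector_derivative velocity \<gamma> (p \<tau>)) (at (p \<tau>))"
        using arcsD(3)[OF \<gamma>, of "p \<tau>"] by (simp add: at_within_Icc_at)
      moreover have "(p has_vector_derivative ((s' - s) / h)) (at \<tau>)"
        unfolding p_def using h by (auto intro!: derivative_eq_intros simp: divide_simps)
      ultimately show ?thesis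
        using vector_diff_chain_at[of p "(s' - s) / h" \<tau> \<gamma> "velocity \<gamma> (p \<tau>)"]
        by (simp add: \<zeta>_def comp_def)
    qed
    then have d: "vector_derivative \<zeta> (at \<tau>) = ((s' - s) / h) *\<^sub>R velocity \<gamma> (p \<tau>)"
      by (rule vector_derivative_at)
    have p: "p \<tau> \<in> {0..1}" using p01[of \<tau>] \<tau> by auto
    have "(\<zeta> \<tau>, vector_derivative \<zeta> (at \<tau>)) \<in> tangent_bundle E"
      unfolding tangent_bundle_def mem_Collect_eq prod.case
      using \<gamma> p d arc_in_carrier[OF \<gamma> p] \<zeta>_def by blast
    moreover have "\<bar>(s' - s) / h\<bar> * norm (velocity \<gamma> (p \<tau>)) \<le> 1 * V"
      using V[OF p] h by (intro mult_mono) auto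
    ultimately show ?thesis using d by simp
  qed
  ultimately show ?thesis using that by blast
qed

text \<open>M bounds L at speeds up to the maximal speed of the arcs, so it is uniform in the datum,
  the arc and the times. The case s = s' describes waiting at a point.\<close>

lemma value_function_forward:
  obtains M where "M \<ge> 0"
    "\<And>u0 \<gamma> s s' t h. \<lbrakk>\<gamma> \<in> arcs E; s \<in> {0..1}; s' \<in> {0..1}; \<bar>s - s'\<bar> \<le> h; h > 0; t \<ge> 0\<rbrakk>
      \<Longrightarrow> value_function E H c u0 (\<gamma> s') (t + h) \<le> value_function E H c u0 (\<gamma> s) t + ereal (M * h)"
proof -
  obtain V where V: "V > 0" "\<And>\<gamma> s. \<gamma> \<in> arcs E \<Longrightarrow> s \<in> {0..1} \<Longrightarrow> norm (velocity \<gamma> s) \<le> V"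
    "\<And>\<gamma> s s'. \<lbrakk>\<gamma> \<in> arcs E; s \<in> {0..1}; s' \<in> {0..1}\<rbrakk> \<Longrightarrow> dist (\<gamma> s) (\<gamma> s') \<le> V * \<bar>s - s'\<bar>"
    using arc_lipschitz by metis
  obtain M where M: "M \<ge> 0"
    "\<And>x q. \<lbrakk>(x, q) \<in> tangent_bundle E; norm q \<le> V\<rbrakk> \<Longrightarrow> lagrangian E H c x q \<le> ereal M"
    using lagrangian_bounded[of V] by metis
  obtain C where C: "C \<ge> 0" "\<And>\<xi> \<tau>. - ereal C \<le> running_cost \<xi> \<tau>"
    using running_cost_lower_bound by metis
  show ?thesis
  proof (rule that[OF M(1)])
    fix u0 :: "'a \<Rightarrow> real" and \<gamma> :: "real \<Rightarrow> 'a" and s s' t h :: real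
    assume a: "\<gamma> \<in> arcs E" "s \<in> {0..1}" "s' \<in> {0..1}" "\<bar>s - s'\<bar> \<le> h" "h > 0" "t \<ge> (0::real)"
    obtain \<zeta> where \<zeta>: "absolutely_continuous_curve t (t + h) \<zeta>" "\<zeta> ` {t..t + h} \<subseteq> carrier E"
      "\<zeta> t = \<gamma> s" "\<zeta> (t + h) = \<gamma> s'"
      "\<And>\<tau>. \<lbrakk>t < \<tau>; \<tau> < t + h\<rbrakk> \<Longrightarrow> (\<zeta> \<tau>, vector_derivative \<zeta> (at \<tau>)) \<in> tangent_bundle E
        \<and> norm (vector_derivative \<zeta> (at \<tau>)) \<le> V"
      by (rule segment_curve[OF a(1,2,3,5,4) V(2,3)[OF a(1)], of t]) (assumption+, rule that)
    \<comment> \<open>With the segment cost moved to the left, each competitor for the right side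
      can be treated separately.\<close>
    have "value_function E H c u0 (\<gamma> s') (t + h) - ereal (M * h) \<le> value_function E H c u0 (\<gamma> s) t"
      unfolding value_function_def[of E H c u0 "\<gamma> s" t]
    proof (rule INF_greatest)
      fix \<xi> assume "\<xi> \<in> {\<xi>. absolutely_continuous_curve 0 t \<xi> \<and> \<xi> ` {0..t} \<subseteq> carrier E \<and> \<xi> t = \<gamma> s}"
      then have \<xi>: "absolutely_continuous_curve 0 t \<xi>" "\<xi> ` {0..t} \<subseteq> carrier E" "\<xi> t = \<gamma> s" by auto
      define \<eta> where "\<eta> = (\<lambda>\<tau>. if \<tau> \<le> t then \<xi> \<tau> else \<zeta> \<tau>)"
      have \<eta>\<zeta>: "\<eta> \<tau> = \<zeta> \<tau>" if "t \<le> \<tau>" for \<tau> using that \<xi>(3) \<zeta>(3) unfolding \<eta>_def by (cases "\<tau> = t") auto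
      have "absolutely_continuous_curve 0 (t + h) \<eta>"
      proof (rule AC_combine[of 0 t])
        show "absolutely_continuous_curve 0 t \<eta>" by (rule AC_cong[OF \<xi>(1)]) (auto simp: \<eta>_def)
        show "absolutely_continuous_curve t (t + h) \<eta>" by (rule AC_cong[OF \<zeta>(1)]) (auto simp: \<eta>\<zeta>)
      qed (use a in auto)
      moreover have "\<eta> \<tau> \<in> carrier E" if "\<tau> \<in> {0..t + h}" for \<tau>
        using that \<xi>(2) \<zeta>(2) unfolding \<eta>_def by auto
      then have "\<eta> ` {0..t + h} \<subseteq> carrier E" by blast
      moreover have "\<eta> (t + h) = \<gamma> s'" using \<eta>\<zeta> \<zeta>(4) a by simp
      ultimately have "value_function E H c u0 (\<gamma> s') (t + h) \<le> action E H c (t + h) \<eta> + ereal (u0 (\<eta> 0))"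
        unfolding value_function_def by (intro INF_lower) auto
      also have "\<eta> 0 = \<xi> 0" unfolding \<eta>_def using a by simp
      also have "action E H c (t + h) \<eta> = ereal_integral (lebesgue_on {0..t}) (running_cost \<eta>)
          + ereal_integral (lebesgue_on {t..t + h}) (running_cost \<eta>)"
        unfolding action_eq_integral_running_cost
        by (rule ereal_integral_combine[OF _ _ C(1) C(2)]) (use a in auto)
      also have "ereal_integral (lebesgue_on {0..t}) (running_cost \<eta>) = action E H c t \<xi>"
        unfolding action_eq_integral_running_cost
      proof (rule ereal_integral_cong_AE)
        show "AE \<tau> in lebesgue_on {0..t}. running_cost \<eta> \<tau> = running_cost \<xi> \<tau>"
          using AE_lebesgue_on_interior[of 0 t]
        proof eventually_elim
          case (elim \<tau>)
          then have "vector_derivative \<eta> (at \<tau>) = vector_derivative \<xi> (at \<tau>)"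
            by (intro vector_derivative_cong_open[of "{..<t}"]) (auto simp: \<eta>_def)
          then show ?case using elim by (simp add: running_cost_def \<eta>_def)
        qed
      qed
      finally have 1: "value_function E H c u0 (\<gamma> s') (t + h) \<le> action E H c t \<xi>
          + ereal_integral (lebesgue_on {t..t + h}) (running_cost \<eta>) + ereal (u0 (\<xi> 0))" .
      have "ereal_integral (lebesgue_on {t..t + h}) (running_cost \<eta>) \<le> ereal (M * (t + h - t))"
      proof (rule ereal_integral_le[OF _ M(1)])
        show "AE \<tau> in lebesgue_on {t..t + h}. running_cost \<eta> \<tau> \<le> ereal M"
          using AE_lebesgue_on_interior[of t "t + h"]
        proof eventually_elim
          case (elim \<tau>)
          then have "vector_derivative \<eta> (at \<tau>) = vector_derivative \<zeta> (at \<tau>)"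
            by (intro vector_derivative_cong_open[of "{t<..}"]) (auto simp: \<eta>_def)
          then show ?case using elim \<zeta>(5)[of \<tau>] M(2) by (simp add: running_cost_def \<eta>_def)
        qed
      qed (use a in simp)
      then have 2: "ereal_integral (lebesgue_on {t..t + h}) (running_cost \<eta>) \<le> ereal (M * h)" by simp
      have "value_function E H c u0 (\<gamma> s') (t + h) \<le> action E H c t \<xi> + ereal (M * h) + ereal (u0 (\<xi> 0))"
        by (rule order_trans[OF 1]) (intro add_mono order_refl 2)
      then show "value_function E H c u0 (\<gamma> s') (t + h) - ereal (M * h) \<le> action E H c t \<xi> + ereal (u0 (\<xi> 0))"
        by (subst ereal_minus_le) (auto simp: add_ac)
    qed
    then show "value_function E H c u0 (\<gamma> s') (t + h) \<le> value_function E H c u0 (\<gamma> s) t + ereal (M * h)"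
      by (subst (asm) ereal_minus_le) auto
  qed
qed

section \<open>Initial values and bounds\<close>

lemma value_function_0:
  assumes "x \<in> carrier E"
  shows "value_function E H c u0 x 0 = ereal (u0 x)"
proof -
  obtain C where C: "C \<ge> 0" "\<And>\<xi> \<tau>. - ereal C \<le> running_cost \<xi> \<tau>"
    using running_cost_lower_bound by metis
  have act: "action E H c 0 \<xi> = 0" for \<xi>
  proof (rule antisym)
    \<comment> \<open>A one-point interval is a null set, so any bound holds almost everywhere on
      it.\<close>
    have "AE \<tau> in lebesgue_on {0..0}. running_cost \<xi> \<tau> \<le> ereal 0"
      using AE_lebesgue_on_interior[of 0 0] by eventually_elim auto
    then show "action E H c 0 \<xi> \<le> 0"
      using ereal_integral_le[of 0 0 0 "running_cost \<xi>"] unfolding action_eq_integral_running_cost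
      by (simp add: zero_ereal_def)
    show "0 \<le> action E H c 0 \<xi>"
      using ereal_integral_ge[of 0 0 C "running_cost \<xi>"] C unfolding action_eq_integral_running_cost
      by (simp add: zero_ereal_def)
  qed
  define S where "S = {\<xi>. absolutely_continuous_curve 0 0 \<xi> \<and> \<xi> ` {0..0} \<subseteq> carrier E \<and> \<xi> 0 = x}"
  have "absolutely_continuous_curve 0 0 (\<lambda>_. x)" by (rule AC_lipschitz[of 0 0 _ 0]) simp
  then have "(\<lambda>_. x) \<in> S" using assms unfolding S_def by auto
  then have "S \<noteq> {}" by blast
  have "value_function E H c u0 x 0 = (INF \<xi>\<in>S. action E H c 0 \<xi> + ereal (u0 (\<xi> 0)))"
    unfolding value_function_def S_def by simp
  also have "\<dots> = (INF \<xi>\<in>S. ereal (u0 x))"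
    by (rule INF_cong) (auto simp: S_def act)
  also have "\<dots> = ereal (u0 x)" using \<open>S \<noteq> {}\<close> by simp
  finally show ?thesis .
qed

text \<open>Waiting at x bounds the value from above, the lower bound of L bounds it from below.
  Uniformity of B in x and t enters the choice of constants for the cut.\<close>

lemma value_function_finite:
  assumes u0: "continuous_on (carrier E) u0"
  shows "\<exists>B\<ge>0. \<forall>x\<in>carrier E. \<forall>t\<in>{0..T}. \<exists>v. value_function E H c u0 x t = ereal v \<and> \<bar>v\<bar> \<le> B"
proof -
  obtain M where M: "M \<ge> 0"
    "\<And>u0 \<gamma> s s' t h. \<lbrakk>\<gamma> \<in> arcs E; s \<in> {0..1}; s' \<in> {0..1}; \<bar>s - s'\<bar> \<le> h; h > 0; t \<ge> 0\<rbrakk>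
      \<Longrightarrow> value_function E H c u0 (\<gamma> s') (t + h) \<le> value_function E H c u0 (\<gamma> s) t + ereal (M * h)"
    using value_function_forward by metis
  obtain C where C: "C \<ge> 0" "\<And>\<xi> \<tau>. - ereal C \<le> running_cost \<xi> \<tau>"
    using running_cost_lower_bound by metis
  have "bounded (u0 ` carrier E)"
    using u0 compact_carrier by (intro compact_imp_bounded compact_continuous_image)
  then obtain U where U: "\<And>x. x \<in> carrier E \<Longrightarrow> \<bar>u0 x\<bar> \<le> U" unfolding bounded_iff by auto
  define B where "B = \<bar>U\<bar> + (M + C) * \<bar>T\<bar>"
  have "\<exists>v. value_function E H c u0 x t = ereal v \<and> \<bar>v\<bar> \<le> B" if x: "x \<in> carrier E" and t: "t \<in> {0..T}" for x t
  proof -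
    have "value_function E H c u0 x t \<le> ereal (u0 x + M * t)"
    proof (cases "t = 0")
      case True
      then show ?thesis using value_function_0[OF x] by simp
    next
      case False
      obtain \<gamma> s where g: "\<gamma> \<in> arcs E" "s \<in> {0..1}" "x = \<gamma> s" using x unfolding carrier_arcs by blast
      show ?thesis
        using M(2)[OF g(1,2,2), of t 0 u0] False t value_function_0[OF x, of u0] g(3) by simp
    qed
    also have "\<dots> \<le> ereal B"
    proof -
      have "M * t \<le> M * \<bar>T\<bar>" using M(1) t by (intro mult_left_mono) auto
      moreover have "0 \<le> C * \<bar>T\<bar>" using C(1) by simp
      ultimately show ?thesis using U[OF x] unfolding B_def by (simp add: distrib_right)
    qed
    finally have 1: "value_function E H c u0 x t \<le> ereal B" .
    have 2: "ereal (- B) \<le> value_function E H c u0 x t"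
      unfolding value_function_def
    proof (rule INF_greatest)
      fix \<xi> assume "\<xi> \<in> {\<xi>. absolutely_continuous_curve 0 t \<xi> \<and> \<xi> ` {0..t} \<subseteq> carrier E \<and> \<xi> t = x}"
      then have "\<xi> 0 \<in> carrier E" using t by auto
      then have "- U \<le> u0 (\<xi> 0)" using U[of "\<xi> 0"] by linarith
      moreover have "- ereal (C * (t - 0)) \<le> action E H c t \<xi>"
        unfolding action_eq_integral_running_cost by (rule ereal_integral_ge) (use C t in auto)
      ultimately have "ereal (- (C * t)) + ereal (- U) \<le> action E H c t \<xi> + ereal (u0 (\<xi> 0))"
        by (intro add_mono) auto
      moreover have "- B \<le> - (C * t) + - U"
      proof -
        have "C * t \<le> C * \<bar>T\<bar>" using C(1) t by (intro mult_left_mono) auto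
        moreover have "0 \<le> M * \<bar>T\<bar>" using M(1) by simp
        ultimately show ?thesis unfolding B_def by (simp add: distrib_right)
      qed
      ultimately show "ereal (- B) \<le> action E H c t \<xi> + ereal (u0 (\<xi> 0))"
        by (metis ereal_less_eq(3) order_trans plus_ereal.simps(1))
    qed
    show ?thesis using 1 2 by (cases "value_function E H c u0 x t") auto
  qed
  moreover have "B \<ge> 0" unfolding B_def using M(1) C(1) by simp
  ultimately show ?thesis by blast
qed

text \<open>The loss consists of three parts of size \<epsilon> / 4: the defect of optimality of the
  curve, the action of the removed piece, which can be as low as -C h, and the change of u0 between
  the two initial points.\<close>

lemma value_function_backward:
  assumes u0: "continuous_on (carrier E) u0" and "\<epsilon> > 0"
  obtains h0 where "h0 > 0"
    "\<And>x t h. \<lbrakk>x \<in> carrier E; 0 \<le> h; h \<le> t; t \<le> T; h \<le> h0\<rbrakk>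
      \<Longrightarrow> value_function E H c u0 x (t - h) \<le> value_function E H c u0 x t + ereal \<epsilon>"
proof -
  obtain B where B: "B \<ge> 0"
    "\<And>x t. \<lbrakk>x \<in> carrier E; 0 \<le> t; t \<le> T\<rbrakk> \<Longrightarrow> \<exists>v. value_function E H c u0 x t = ereal v \<and> \<bar>v\<bar> \<le> B"
    using value_function_finite[OF u0, of T] by auto
  obtain C where C: "C \<ge> 0" "\<And>\<xi> \<tau>. - ereal C \<le> running_cost \<xi> \<tau>"
    using running_cost_lower_bound by metis
  have "bounded (u0 ` carrier E)"
    using u0 compact_carrier by (intro compact_imp_bounded compact_continuous_image)
  then obtain U where U: "\<And>x. x \<in> carrier E \<Longrightarrow> \<bar>u0 x\<bar> \<le> U" unfolding bounded_iff by auto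
  have "uniformly_continuous_on (carrier E) u0"
    using u0 compact_carrier by (rule compact_uniformly_continuous)
  then obtain \<delta> where \<delta>: "\<delta> > 0"
    "\<And>x y. \<lbrakk>x \<in> carrier E; y \<in> carrier E; dist x y < \<delta>\<rbrakk> \<Longrightarrow> \<bar>u0 y - u0 x\<bar> < \<epsilon> / 4"
    using \<open>\<epsilon> > 0\<close> unfolding uniformly_continuous_on_def dist_real_def
    by (metis zero_less_divide_iff zero_less_numeral dist_commute)
  \<comment> \<open>Bounds the action of the removed piece: the total cost is below v + \<epsilon> /
    4, the datum is at least -U, and the remaining piece costs at least -C times its
    duration.\<close>
  define W where "W = B + \<epsilon> + \<bar>U\<bar> + C * \<bar>T\<bar>"
  have "W > 0" unfolding W_def using B(1) C(1) \<open>\<epsilon> > 0\<close> by (simp add: add_nonneg_pos add_pos_nonneg)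
  \<comment> \<open>With action and additive error both at most W, growth rate A limits the
    displacement to 2 W / A = \<delta> / 2.\<close>
  define A where "A = 4 * W / \<delta>"
  have "A > 0" unfolding A_def using \<open>W > 0\<close> \<delta>(1) by simp
  obtain C' where C': "C' \<ge> 0" "\<And>x q. ereal (A * norm q - C') \<le> lagrangian E H c x q"
    using lagrangian_superlinear[of A] \<open>A > 0\<close> by auto
  \<comment> \<open>The first term makes the error 2 C' h at most W, the second makes C h at most
    \<epsilon> / 4; the added 1 avoids a zero denominator. C' depends on A, so h0 is chosen
    last.\<close>
  define h0 where "h0 = min (W / (2 * C' + 1)) (\<epsilon> / (4 * (C + 1)))"
  show ?thesis
  proof (rule that[of h0])
    show "h0 > 0" unfolding h0_def using \<open>W > 0\<close> \<open>\<epsilon> > 0\<close> C(1) C'(1) by simp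
    fix x t h assume x: "x \<in> carrier E" and h: "0 \<le> h" "h \<le> t" "t \<le> T" "h \<le> h0"
    have C'h: "2 * C' * h \<le> W"
    proof -
      have "2 * C' * h \<le> (2 * C' + 1) * h0" using C'(1) h by (intro mult_mono) auto
      also have "\<dots> \<le> (2 * C' + 1) * (W / (2 * C' + 1))"
        unfolding h0_def using C'(1) by (intro mult_left_mono) auto
      also have "\<dots> = W" using C'(1) by simp
      finally show ?thesis .
    qed
    have Ch: "C * h \<le> \<epsilon> / 4"
    proof -
      have "C * h \<le> (C + 1) * h0" using C(1) h by (intro mult_mono) auto
      also have "\<dots> \<le> (C + 1) * (\<epsilon> / (4 * (C + 1)))"
        unfolding h0_def using C(1) by (intro mult_left_mono) auto
      also have "\<dots> = \<epsilon> / 4" using C(1) by (simp add: field_simps)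
      finally show ?thesis .
    qed
    obtain v where v: "value_function E H c u0 x t = ereal v" "\<bar>v\<bar> \<le> B"
      using B(2)[OF x, of t] h by auto
    have "value_function E H c u0 x t < ereal (v + \<epsilon> / 4)" using v(1) \<open>\<epsilon> > 0\<close> by simp
    then obtain \<xi> where \<xi>: "absolutely_continuous_curve 0 t \<xi>" "\<xi> ` {0..t} \<subseteq> carrier E" "\<xi> t = x"
      and cost: "action E H c t \<xi> + ereal (u0 (\<xi> 0)) < ereal (v + \<epsilon> / 4)"
      unfolding value_function_def INF_less_iff by auto
    have \<xi>c: "\<xi> 0 \<in> carrier E" "\<xi> h \<in> carrier E" using \<xi>(2) h by auto
    define I1 where "I1 = ereal_integral (lebesgue_on {0..h}) (running_cost \<xi>)"
    define I2 where "I2 = ereal_integral (lebesgue_on {h..t}) (running_cost \<xi>)"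
    have act: "action E H c t \<xi> = I1 + I2"
      unfolding action_eq_integral_running_cost I1_def I2_def
      by (rule ereal_integral_combine[OF _ _ C(1) C(2)]) (use h in auto)
    have I1: "- ereal (C * (h - 0)) \<le> I1" and I2: "- ereal (C * (t - h)) \<le> I2"
      unfolding I1_def I2_def by (rule ereal_integral_ge[OF _ C(1) C(2)]; use h in simp)+
    obtain a1 a2 where a: "I1 = ereal a1" "I2 = ereal a2"
      using cost I1 I2 unfolding act by (cases I1; cases I2) auto
    have a12: "a1 + a2 + u0 (\<xi> 0) < v + \<epsilon> / 4" "- (C * h) \<le> a1" "- (C * (t - h)) \<le> a2"
      using cost I1 I2 unfolding act a by auto
    have "dist (\<xi> 0) (\<xi> h) < \<delta>"
    proof -
      have AC: "absolutely_continuous_curve 0 h \<xi>" by (rule AC_subinterval[OF \<xi>(1)]) (use h in auto)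
      have "ereal (A * dist (\<xi> 0) (\<xi> h)) \<le> I1 + ereal (2 * C' * (h - 0))"
        unfolding I1_def
        by (rule AC_dist_le_ereal_integral[OF AC]) (use h C' \<open>A > 0\<close> in \<open>auto simp: running_cost_def\<close>)
      then have "A * dist (\<xi> 0) (\<xi> h) \<le> a1 + 2 * C' * h" unfolding a by simp
      also have "a1 \<le> W"
      proof -
        have "C * (t - h) \<le> C * \<bar>T\<bar>" using C(1) h by (intro mult_left_mono) auto
        then show ?thesis using a12 v(2) U[OF \<xi>c(1)] \<open>\<epsilon> > 0\<close> unfolding W_def by linarith
      qed
      finally have "A * dist (\<xi> 0) (\<xi> h) \<le> 2 * W" using C'h by simp
      then have "dist (\<xi> 0) (\<xi> h) \<le> 2 * W / A" using \<open>A > 0\<close> by (simp add: pos_le_divide_eq mult_ac)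
      also have "\<dots> = \<delta> / 2" unfolding A_def using \<open>W > 0\<close> \<delta>(1) by simp
      also have "\<dots> < \<delta>" using \<delta>(1) by simp
      finally show ?thesis .
    qed
    then have u: "\<bar>u0 (\<xi> h) - u0 (\<xi> 0)\<bar> < \<epsilon> / 4" using \<delta>(2) \<xi>c by blast
    define \<eta> where "\<eta> = (\<lambda>\<tau>. \<xi> (\<tau> + h))"
    have "absolutely_continuous_curve 0 (t - h) \<eta>" unfolding \<eta>_def
      by (rule AC_compose_mono_nonexpansive[OF \<xi>(1)]) (use h in auto)
    moreover have "\<eta> ` {0..t - h} \<subseteq> carrier E" using \<xi>(2) h unfolding \<eta>_def by auto
    moreover have "\<eta> (t - h) = x" unfolding \<eta>_def using \<xi>(3) by simp
    ultimately have "value_function E H c u0 x (t - h) \<le> action E H c (t - h) \<eta> + ereal (u0 (\<eta> 0))"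
      unfolding value_function_def by (intro INF_lower) auto
    also have "action E H c (t - h) \<eta> = I2"
    proof -
      have "running_cost \<eta> = (\<lambda>\<tau>. running_cost \<xi> (\<tau> + h))"
        unfolding running_cost_def \<eta>_def vector_derivative_shift ..
      then show ?thesis
        unfolding action_eq_integral_running_cost I2_def
        using ereal_integral_shift[of 0 "t - h" "running_cost \<xi>" h] by simp
    qed
    also have "I2 + ereal (u0 (\<eta> 0)) \<le> value_function E H c u0 x t + ereal \<epsilon>"
    proof -
      have "a2 + u0 (\<xi> h) \<le> v + \<epsilon>" using a12 Ch u by linarith
      then show ?thesis unfolding a v(1) \<eta>_def by simp
    qed
    finally show "value_function E H c u0 x (t - h) \<le> value_function E H c u0 x t + ereal \<epsilon>" .
  qed
qed

section \<open>Continuity of the value function\<close>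

lemma continuous_on_value_function:
  assumes u0: "continuous_on (carrier E) u0"
  shows "continuous_on (carrier E \<times> {0..}) (\<lambda>(x, t). real_of_ereal (value_function E H c u0 x t))"
proof -
  define w where "w = (\<lambda>x t. real_of_ereal (value_function E H c u0 x t))"
  have w: "value_function E H c u0 x t = ereal (w x t)" if "x \<in> carrier E" "t \<ge> 0" for x t
    using value_function_finite[OF u0, of t] that unfolding w_def by force
  have w0: "w x 0 = u0 x" if "x \<in> carrier E" for x
    unfolding w_def value_function_0[OF that] by simp
  obtain M where M: "M \<ge> 0"
    "\<And>u0 \<gamma> s s' t h. \<lbrakk>\<gamma> \<in> arcs E; s \<in> {0..1}; s' \<in> {0..1}; \<bar>s - s'\<bar> \<le> h; h > 0; t \<ge> 0\<rbrakk>
      \<Longrightarrow> value_function E H c u0 (\<gamma> s') (t + h) \<le> value_function E H c u0 (\<gamma> s) t + ereal (M * h)"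
    using value_function_forward by metis
  have move: "w (\<gamma> s') (t + h) \<le> w (\<gamma> s) t + M * h"
    if "\<gamma> \<in> arcs E" "s \<in> {0..1}" "s' \<in> {0..1}" "\<bar>s - s'\<bar> \<le> h" "h > 0" "t \<ge> 0" for \<gamma> s s' t h
  proof -
    have "\<gamma> s \<in> carrier E" "\<gamma> s' \<in> carrier E" using that(1,2,3) arc_in_carrier by auto
    then show ?thesis using M(2)[OF that, of u0] w[of "\<gamma> s'" "t + h"] w[of "\<gamma> s" t] that by simp
  qed
  show ?thesis
    unfolding continuous_on_iff
  proof (intro ballI allI impI)
    fix z :: "'a \<times> real" and \<epsilon> :: real assume z: "z \<in> carrier E \<times> {0..}" and "\<epsilon> > 0"
    obtain x t where xt: "z = (x, t)" "x \<in> carrier E" "t \<ge> 0" using z by auto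
    obtain h0 where h0: "h0 > 0"
      "\<And>x' t' h. \<lbrakk>x' \<in> carrier E; 0 \<le> h; h \<le> t'; t' \<le> t + 1; h \<le> h0\<rbrakk>
        \<Longrightarrow> value_function E H c u0 x' (t' - h) \<le> value_function E H c u0 x' t' + ereal (\<epsilon> / 4)"
      using value_function_backward[OF u0, of "\<epsilon> / 4" "t + 1"] \<open>\<epsilon> > 0\<close> by auto
    have recede: "w x' (t' - h) \<le> w x' t' + \<epsilon> / 4"
      if "x' \<in> carrier E" "0 \<le> h" "h \<le> t'" "t' \<le> t + 1" "h \<le> h0" for x' t' h
      using h0(2)[OF that] w[OF that(1), of "t' - h"] w[OF that(1), of t'] that by simp
    \<comment> \<open>Going back from t1 to t2 - h takes less than 2 h, hence h0 / 2. The bound 1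
      keeps all times at most t + 1, and the last term makes the segment cost M h at most \<epsilon>
      / 4.\<close>
    define h where "h = min (h0 / 2) (min 1 (\<epsilon> / (4 * (M + 1))))"
    have h: "h > 0" "2 * h \<le> h0" "h \<le> 1"
      unfolding h_def using h0(1) \<open>\<epsilon> > 0\<close> M(1) by auto
    have Mh: "M * h \<le> \<epsilon> / 4"
    proof -
      have "M * h \<le> (M + 1) * (\<epsilon> / (4 * (M + 1)))"
        using M(1) h(1) by (intro mult_mono) (auto simp: h_def)
      also have "\<dots> = \<epsilon> / 4" using M(1) by (simp add: field_simps)
      finally show ?thesis .
    qed
    \<comment> \<open>A one-sided estimate, to be used for both orders of the two points; hence
      neither of them is fixed to be x.\<close>
    have key: "w y t2 < w x' t1 + \<epsilon>"
      if g: "\<gamma> \<in> arcs E" "s \<in> {0..1}" "s' \<in> {0..1}" "\<bar>s - s'\<bar> \<le> h" "\<gamma> s = x'" "\<gamma> s' = y"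
        and t: "t1 \<ge> 0" "t2 \<ge> 0" "t1 \<le> t + 1" "\<bar>t1 - t2\<bar> < h" and u: "\<bar>u0 y - u0 x'\<bar> < \<epsilon> / 4"
      for \<gamma> s s' x' y t1 t2
    proof -
      have xy: "x' \<in> carrier E" "y \<in> carrier E" using g arc_in_carrier by auto
      show ?thesis
      proof (cases "t2 \<ge> h")
        case True
        have "w y t2 \<le> w x' (t2 - h) + M * h"
          using move[OF g(1-4) h(1), of "t2 - h"] True g(5,6) by simp
        \<comment> \<open>t2 - h lies before t1 because \<bar>t1 - t2\<bar> < h, and it is
          nonnegative in this case.\<close>
        also have "w x' (t2 - h) \<le> w x' t1 + \<epsilon> / 4"
          using recede[OF xy(1), of "t1 - (t2 - h)" t1] True t h by simp
        finally show ?thesis using Mh \<open>\<epsilon> > 0\<close> by simp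
      next
        case False
        \<comment> \<open>There is no room to go back by h first. Instead y waits from time 0 to t2,
          x' goes back from t1 to time 0, which takes less than 2 h, and the data at the two points
          are compared.\<close>
        have "w y t2 \<le> u0 y + \<epsilon> / 4"
        proof (cases "t2 = 0")
          case True
          then show ?thesis using w0[OF xy(2)] \<open>\<epsilon> > 0\<close> by simp
        next
          case t2: False
          have "w y t2 \<le> w y 0 + M * t2"
            using move[OF g(1,3,3), of t2 0] t2 t g(6) by simp
          also have "M * t2 \<le> M * h" using False M(1) by (intro mult_left_mono) auto
          finally show ?thesis using Mh w0[OF xy(2)] by simp
        qed
        moreover have "u0 x' \<le> w x' t1 + \<epsilon> / 4"
          using recede[OF xy(1), of t1 t1] w0[OF xy(1)] False t h by simp
        ultimately show ?thesis using u \<open>\<epsilon> > 0\<close> by linarith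
      qed
    qed
    obtain \<delta> where \<delta>: "\<delta> > 0" "\<And>y. \<lbrakk>y \<in> carrier E; dist x y < \<delta>\<rbrakk>
        \<Longrightarrow> \<exists>\<gamma>\<in>arcs E. \<exists>s\<in>{0..1}. \<exists>s'\<in>{0..1}. \<gamma> s = x \<and> \<gamma> s' = y \<and> \<bar>s - s'\<bar> \<le> h"
      using short_arc_segment[OF xt(2) h(1)] by metis
    obtain \<delta>' where \<delta>': "\<delta>' > 0" "\<And>y. \<lbrakk>y \<in> carrier E; dist y x < \<delta>'\<rbrakk> \<Longrightarrow> \<bar>u0 y - u0 x\<bar> < \<epsilon> / 4"
      using u0 xt(2) \<open>\<epsilon> > 0\<close> unfolding continuous_on_iff dist_real_def
      by (metis zero_less_divide_iff zero_less_numeral)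
    show "\<exists>d>0. \<forall>z'\<in>carrier E \<times> {0..}. dist z' z < d \<longrightarrow>
        dist (case z' of (x, t) \<Rightarrow> real_of_ereal (value_function E H c u0 x t))
          (case z of (x, t) \<Rightarrow> real_of_ereal (value_function E H c u0 x t)) < \<epsilon>"
    proof (intro exI[of _ "min h (min \<delta> \<delta>')"] conjI ballI impI)
      show "min h (min \<delta> \<delta>') > 0" using h \<delta> \<delta>' by simp
      fix z' assume z': "z' \<in> carrier E \<times> {0..}" "dist z' z < min h (min \<delta> \<delta>')"
      obtain y r where yr: "z' = (y, r)" "y \<in> carrier E" "r \<ge> 0" using z' by auto
      have "dist y x \<le> dist z' z" "dist r t \<le> dist z' z"
        using dist_fst_le[of z' z] dist_snd_le[of z' z] xt(1) yr(1) by auto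
      then have d: "dist y x < \<delta>" "dist y x < \<delta>'" "\<bar>r - t\<bar> < h" using z'(2) by (auto simp: dist_real_def)
      obtain \<gamma> s s' where g: "\<gamma> \<in> arcs E" "s \<in> {0..1}" "s' \<in> {0..1}" "\<gamma> s = x" "\<gamma> s' = y" "\<bar>s - s'\<bar> \<le> h"
        using \<delta>(2)[OF yr(2)] d(1) by (auto simp: dist_commute)
      have u: "\<bar>u0 y - u0 x\<bar> < \<epsilon> / 4" using \<delta>'(2) yr(2) d(2) by blast
      have "w y r < w x t + \<epsilon>"
        by (rule key[OF g(1,2,3,6,4,5)]) (use xt yr d u in auto)
      \<comment> \<open>The same segment, traversed from y to x.\<close>
      moreover have "w x t < w y r + \<epsilon>"
        by (rule key[OF g(1,3,2) _ g(5,4)])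
          (use xt yr d u g(6) h in \<open>simp_all add: abs_minus_commute\<close>)
      ultimately show "dist (case z' of (x, t) \<Rightarrow> real_of_ereal (value_function E H c u0 x t))
          (case z of (x, t) \<Rightarrow> real_of_ereal (value_function E H c u0 x t)) < \<epsilon>"
        unfolding xt(1) yr(1) prod.case w_def[symmetric] dist_real_def by linarith
    qed
  qed
qed

end

text \<open>\<open>real_of_ereal\<close> sends infinite values to 0, so continuity of the real
  function expresses the claim only together with finiteness.\<close>

theorem proposition6p6:
  fixes E :: "(real \<Rightarrow> 'a::euclidean_space) set"
    and H :: "(real \<Rightarrow> 'a) \<Rightarrow> real \<Rightarrow> real \<Rightarrow> real"
    and c u0 :: "'a \<Rightarrow> real"
  assumes "network E"
    and "hamiltonians E H"
    and "flux_limiter E H c"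
    and "continuous_on (carrier E) u0"
  shows "(\<forall>x\<in>carrier E. \<forall>t\<ge>0. \<bar>value_function E H c u0 x t\<bar> \<noteq> \<infinity>) \<and>
         continuous_on (carrier E \<times> {0..}) (\<lambda>(x, t). real_of_ereal (value_function E H c u0 x t))"
proof -
  interpret network_hamiltonians E H c using assms(1,2) by unfold_locales
  have "\<bar>value_function E H c u0 x t\<bar> \<noteq> \<infinity>" if "x \<in> carrier E" "t \<ge> 0" for x t
    using value_function_finite[OF assms(4), of t] that by force
  with continuous_on_value_function[OF assms(4)] show ?thesis by simp
qed

end
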